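(* Let $X$ be any one of the six subsets of $\{\sigma,\delta,\epsilon\}$ other than $\{\delta\}$ and $\{\delta,\epsilon\}$, and let $!={!_X}$ and $?={?_X}$. Then the composition in the coKleisli bicategory $\mathbf{Prof}_?$ of $\Phi\in\mathbf{Prof}_?[\mathbf C,\mathbf C']$ and $\Psi\in\mathbf{Prof}_?[\mathbf C',\mathbf C'']$ is given, up to canonical isomorphism, by $$(\Psi\bullet\Phi)(\vec C,C'')=\int^{(C'_1,\ldots,C'_p)\in{?}\mathbf C'}\Psi((C'_1,\ldots,C'_p),C'')\times\int^{\vec D_1,\ldots,\vec D_p\in{?}\mathbf C}\Phi(\vec D_1,C'_1)\times\cdots\times\Phi(\vec D_p,C'_p)\times{?}\mathbf C[\vec D_1\cdots\vec D_p,\vec C],$$ where $\vec D_1\cdots\vec D_p$ is the concatenated sequence. In particular: 1. When $\mathbf C=\mathbf C'=\mathbf C''=\mathbf 1$ (the terminal category), so that $\Psi$ and $\Phi$ are functors $Y,Z:{?}\mathbf 1\to\mathbf{Set}$, this composition is the substitution operation $$(Y\bullet Z)p=\int^{m}Ym\times\int^{n_1,\ldots,n_m}Zn_1\times\cdots\times Zn_m\times{?}\mathbf 1[n_1+\cdots+n_m,p],$$ and the identity of $\mathbf 1$ in $\mathbf{Prof}_?$ is $I n={?}\mathbf 1[1,n]$. 2. When $\mathbf C=\emptyset$ (the empty category) and $\mathbf C'=\mathbf C''=\mathbf 1$, so that $\Psi$ is a functor $Y:{?}\mathbf 1\to\mathbf{Set}$ and $\Phi$ is a set $z$, the composite $\Psi\bullet\Phi$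 is the set $\int^{m}z^m\times Ym$, i.e. the value at $z$ of the left Kan extension $\mathrm{Lan}_{\subseteq}Y$ of $Y$ along the faithful functor $\subseteq\;:{?}\mathbf 1\to\mathbf{Set}$.
   Context: **The monads $!_X$.** For a category $\mathbf C$ and one of the six $X$, ${!_X}\mathbf C$ has as objects the finite (possibly empty) sequences of objects of $\mathbf C$. A morphism $(C_1,\ldots,C_n)\to(D_1,\ldots,D_m)$ is a string diagram built from morphisms of $\mathbf C$ and those of the combinators $\sigma:(C_1,C_2)\to(C_2,C_1)$, $\delta:(C)\to(C,C)$, $\epsilon:(C)\to()$ lying in $X$, modulo the usual equations (symmetry, comonoid, cocommutativity, naturality). Concretely it is a function $f:\{1,\ldots,m\}\to\{1,\ldots,n\}$ together with morphisms $g_j:C_{f(j)}\to D_j$, where $f$ ranges over: identities ($X=\emptyset$), monotone injections ($X=\{\epsilon\}$), bijections ($X=\{\sigma\}$), surjections ($X=\{\sigma,\delta\}$), injections ($X=\{\sigma,\epsilon\}$), all functions ($X=\{\sigma,\delta,\epsilon\}$). The unit of the monad $!$ sends $C$ to $(C)$ and the multiplication flattens sequences of sequences by concatenation. **The operation $?$.** ${?}\mathbf C=({!}(\mathbf C^{op}))^{op}$. The objects of ${?}\mathbf 1$ are written $0,1,2,\ldots$ (lengths of sequences); a morphism $m\to n$ in ${?}\mathbf 1$ is a function from an $m$-element to an $n$-element set in the class listed above, which gives the faithful functor $\subseteq\;:{?}\mathbf 1\to\mathbf{Set}$, $m\mapsto\{0,\ldots,m-1\}$. One has ${?}\emptyset=\mathbf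 1$. **Profunctors.** All categories are small. A profunctor $\Phi$ from $\mathbf C$ to $\mathbf C'$ is a functor $\Phi:\mathbf C\times\mathbf C'^{op}\to\mathbf{Set}$; composition is $(\Psi\circ\Phi)(C,C'')=\int^{C'}\Psi(C',C'')\times\Phi(C,C')$. $\mathbf{Prof}$ is the bicategory of categories, profunctors and natural transformations. It is self-dual: a profunctor $\Phi$ from $\mathbf C_1$ to $\mathbf C_2$ gives the profunctor $\Phi^{op}$ from $\mathbf C_2^{op}$ to $\mathbf C_1^{op}$, $\Phi^{op}(C_2,C_1)=\Phi(C_1,C_2)$. A functor $Z:{?}\mathbf 1\to\mathbf{Set}$ is identified with a profunctor from ${?}\mathbf 1$ to $\mathbf 1$. **The (pseudo-)comonad $?$ on $\mathbf{Prof}$.** The monad $!$ extends to $\mathbf{Prof}$: for $\Phi$ from $\mathbf C$ to $\mathbf C'$, ${!}\Phi$ from ${!}\mathbf C$ to ${!}\mathbf C'$ is $${!}\Phi((C_1,\ldots,C_n),\vec C')=\int^{D'_1,\ldots,D'_n\in\mathbf C'}\Phi(C_1,D'_1)\times\cdots\times\Phi(C_n,D'_n)\times{!}\mathbf C'[\vec C',(D'_1,\ldots,D'_n)],$$ with unit and multiplication the profunctors $(C,\vec D)\mapsto{!}\mathbf C[\vec D,(C)]$ and $((\vec C_1,\ldots,\vec C_n),\vec D)\mapsto{!}\mathbf C[\vec D,\vec C_1\cdots\vec C_n]$. By duality $?$ becomes a comonad on $\mathbf{Prof}$, with ${?}\Phi=({!}(\Phi^{op}))^{op}$, counit (from ${?}\mathbf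 C$ to $\mathbf C$) $(\vec C,D)\mapsto{?}\mathbf C[(D),\vec C]$, and comultiplication $d$ (from ${?}\mathbf C$ to ${??}\mathbf C$) $(\vec C,(\vec D_1,\ldots,\vec D_n))\mapsto{?}\mathbf C[\vec D_1\cdots\vec D_n,\vec C]$. **The coKleisli bicategory.** $\mathbf{Prof}_?$ has categories as objects and $\mathbf{Prof}_?[\mathbf C,\mathbf C']=\mathbf{Prof}[{?}\mathbf C,\mathbf C']$; the composite of $\Phi\in\mathbf{Prof}_?[\mathbf C,\mathbf C']$ and $\Psi\in\mathbf{Prof}_?[\mathbf C',\mathbf C'']$ is $\Psi\bullet\Phi=\Psi\circ({?}\Phi)\circ d$, and identities are the counits. All equalities of profunctors are understood up to canonical natural isomorphism; coherence issues are ignored (the paper's convention). *)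

theory Defs
  imports "HOL-Library.FuncSet"
begin

section \<open>Categories and functors\<close>

text \<open>
  Hom-sets are indexed by objects and need not be disjoint.  Accordingly, the composition
  \<open>Cmp C a b c g f\<close> of \<open>f : a \<rightarrow> b\<close> and \<open>g : b \<rightarrow> c\<close>, and the action \<open>FM F a b f\<close> of a functor on
  \<open>f : a \<rightarrow> b\<close>, receive the objects as arguments.
\<close>

record ('o, 'm) cat =
  Obj :: "'o set"
  Hom :: "'o \<Rightarrow> 'o \<Rightarrow> 'm set"
  Idn :: "'o \<Rightarrow> 'm"
  Cmp :: "'o \<Rightarrow> 'o \<Rightarrow> 'o \<Rightarrow> 'm \<Rightarrow> 'm \<Rightarrow> 'm"

record ('o, 'm, 'p, 'n) ftr =
  FO :: "'o \<Rightarrow> 'p"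
  FM :: "'o \<Rightarrow> 'o \<Rightarrow> 'm \<Rightarrow> 'n"

definition category :: "('o, 'm) cat \<Rightarrow> bool" where
  "category C \<longleftrightarrow>
     (\<forall>a\<in>Obj C. Idn C a \<in> Hom C a a) \<and>
     (\<forall>a\<in>Obj C. \<forall>b\<in>Obj C. \<forall>c\<in>Obj C. \<forall>f\<in>Hom C a b. \<forall>g\<in>Hom C b c. Cmp C a b c g f \<in> Hom C a c) \<and>
     (\<forall>a\<in>Obj C. \<forall>b\<in>Obj C. \<forall>f\<in>Hom C a b.
        Cmp C a a b f (Idn C a) = f \<and> Cmp C a b b (Idn C b) f = f) \<and>
     (\<forall>a\<in>Obj C. \<forall>b\<in>Obj C. \<forall>c\<in>Obj C. \<forall>d\<in>Obj C.
        \<forall>f\<in>Hom C a b. \<forall>g\<in>Hom C b c. \<forall>h\<in>Hom C c d.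
        Cmp C a c d h (Cmp C a b c g f) = Cmp C a b d (Cmp C b c d h g) f)"

definition is_functor :: "('o, 'm) cat \<Rightarrow> ('p, 'n) cat \<Rightarrow> ('o, 'm, 'p, 'n) ftr \<Rightarrow> bool" where
  "is_functor A B F \<longleftrightarrow>
     (\<forall>a\<in>Obj A. FO F a \<in> Obj B) \<and>
     (\<forall>a\<in>Obj A. \<forall>b\<in>Obj A. \<forall>f\<in>Hom A a b. FM F a b f \<in> Hom B (FO F a) (FO F b)) \<and>
     (\<forall>a\<in>Obj A. FM F a a (Idn A a) = Idn B (FO F a)) \<and>
     (\<forall>a\<in>Obj A. \<forall>b\<in>Obj A. \<forall>c\<in>Obj A. \<forall>f\<in>Hom A a b. \<forall>g\<in>Hom A b c.
        FM F a c (Cmp A a b c g f) =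
        Cmp B (FO F a) (FO F b) (FO F c) (FM F b c g) (FM F a b f))"

definition cat_iso :: "('o, 'm) cat \<Rightarrow> ('p, 'n) cat \<Rightarrow> ('o, 'm, 'p, 'n) ftr \<Rightarrow> bool" where
  "cat_iso A B F \<longleftrightarrow> is_functor A B F \<and> bij_betw (FO F) (Obj A) (Obj B) \<and>
     (\<forall>a\<in>Obj A. \<forall>b\<in>Obj A. bij_betw (FM F a b) (Hom A a b) (Hom B (FO F a) (FO F b)))"

definition ftr_comp :: "('p, 'n, 'q, 'k) ftr \<Rightarrow> ('o, 'm, 'p, 'n) ftr \<Rightarrow> ('o, 'm, 'q, 'k) ftr" where
  "ftr_comp G F = \<lparr>FO = (\<lambda>a. FO G (FO F a)), FM = (\<lambda>a b f. FM G (FO F a) (FO F b) (FM F a b f))\<rparr>"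

definition op_cat :: "('o, 'm) cat \<Rightarrow> ('o, 'm) cat" where
  "op_cat C = \<lparr>Obj = Obj C, Hom = (\<lambda>a b. Hom C b a), Idn = Idn C,
               Cmp = (\<lambda>a b c g f. Cmp C c b a f g)\<rparr>"

definition op_ftr :: "('o, 'm, 'p, 'n) ftr \<Rightarrow> ('o, 'm, 'p, 'n) ftr" where
  "op_ftr F = \<lparr>FO = FO F, FM = (\<lambda>a b. FM F b a)\<rparr>"

definition prod_cat :: "('o, 'm) cat \<Rightarrow> ('p, 'n) cat \<Rightarrow> ('o \<times> 'p, 'm \<times> 'n) cat" where
  "prod_cat A B =
     \<lparr>Obj = Obj A \<times> Obj B,
      Hom = (\<lambda>(a, b) (a', b'). Hom A a a' \<times> Hom B b b'),
      Idn = (\<lambda>(a, b). (Idn A a, Idn B b)),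
      Cmp = (\<lambda>(a, b) (a', b') (a'', b'') (g, g') (f, f'). (Cmp A a a' a'' g f, Cmp B b b' b'' g' f'))\<rparr>"

definition pow_cat :: "nat \<Rightarrow> ('o, 'm) cat \<Rightarrow> ('o list, 'm list) cat" where
  "pow_cat n C =
     \<lparr>Obj = {as. length as = n \<and> set as \<subseteq> Obj C},
      Hom = (\<lambda>as bs. {fs. length fs = n \<and> (\<forall>i<n. fs ! i \<in> Hom C (as ! i) (bs ! i))}),
      Idn = map (Idn C),
      Cmp = (\<lambda>as bs cs gs fs. map (\<lambda>i. Cmp C (as ! i) (bs ! i) (cs ! i) (gs ! i) (fs ! i)) [0..<n])\<rparr>"

definition one_cat :: "(unit, unit) cat" where
  "one_cat = \<lparr>Obj = {()}, Hom = (\<lambda>_ _. {()}), Idn = (\<lambda>_. ()), Cmp = (\<lambda>_ _ _ _ _. ())\<rparr>"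

definition empty_cat :: "(unit, unit) cat" where
  "empty_cat = \<lparr>Obj = {}, Hom = (\<lambda>_ _. {}), Idn = (\<lambda>_. ()), Cmp = (\<lambda>_ _ _ _ _. ())\<rparr>"

text \<open>
  The category of sets, seen through a type \<open>'x\<close>: its objects are all subsets of \<open>'x\<close>.  Functors
  to \<open>\<^bold>S\<^bold>e\<^bold>t\<close> take values in such a category, with a type depending on the functor; this is why
  natural transformations below go between functors with values in different types.
\<close>

definition set_cat :: "('x set, 'x \<Rightarrow> 'x) cat" where
  "set_cat = \<lparr>Obj = UNIV, Hom = (\<lambda>A B. A \<rightarrow>\<^sub>E B), Idn = (\<lambda>A. \<lambda>x\<in>A. x),
              Cmp = (\<lambda>A B D g f. compose A g f)\<rparr>"

type_synonym ('o, 'm, 'x) sftr = "('o, 'm, 'x set, 'x \<Rightarrow> 'x) ftr"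

definition nat_trans ::
  "('o, 'm) cat \<Rightarrow> ('o, 'm, 'x) sftr \<Rightarrow> ('o, 'm, 'y) sftr \<Rightarrow> ('o \<Rightarrow> 'x \<Rightarrow> 'y) \<Rightarrow> bool" where
  "nat_trans A F G \<alpha> \<longleftrightarrow> is_functor A set_cat F \<and> is_functor A set_cat G \<and>
     (\<forall>a\<in>Obj A. \<alpha> a \<in> FO F a \<rightarrow> FO G a) \<and>
     (\<forall>a\<in>Obj A. \<forall>b\<in>Obj A. \<forall>f\<in>Hom A a b. \<forall>x\<in>FO F a. \<alpha> b (FM F a b f x) = FM G a b f (\<alpha> a x))"

definition nat_iso ::
  "('o, 'm) cat \<Rightarrow> ('o, 'm, 'x) sftr \<Rightarrow> ('o, 'm, 'y) sftr \<Rightarrow> ('o \<Rightarrow> 'x \<Rightarrow> 'y) \<Rightarrow> bool" where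
  "nat_iso A F G \<alpha> \<longleftrightarrow> nat_trans A F G \<alpha> \<and> (\<forall>a\<in>Obj A. bij_betw (\<alpha> a) (FO F a) (FO G a))"

definition hom_ftr :: "('o, 'm) cat \<Rightarrow> 'o \<Rightarrow> ('o, 'm, 'm) sftr" where
  "hom_ftr A a = \<lparr>FO = Hom A a, FM = (\<lambda>b c g. \<lambda>x\<in>Hom A a b. Cmp A a b c g x)\<rparr>"


section \<open>Coends in the category of sets\<close>

text \<open>
  The coend of \<open>F : A\<^sup>o\<^sup>p \<times> A \<rightarrow> \<^bold>S\<^bold>e\<^bold>t\<close> is the quotient of the disjoint union of the sets \<open>F(a,a)\<close> by the
  equivalence relation generated by \<open>F(f,id) x \<sim> F(id,f) x\<close>, for \<open>f : a \<rightarrow> b\<close> and \<open>x \<in> F(b,a)\<close>.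
\<close>

definition coend_gen ::
  "('o, 'm) cat \<Rightarrow> ('o \<times> 'o, 'm \<times> 'm, 'x) sftr \<Rightarrow> (('o \<times> 'x) \<times> ('o \<times> 'x)) set" where
  "coend_gen A F =
     {((a, FM F (b, a) (a, a) (f, Idn A a) x), (b, FM F (b, a) (b, b) (Idn A b, f) x)) | a b f x.
        a \<in> Obj A \<and> b \<in> Obj A \<and> f \<in> Hom A a b \<and> x \<in> FO F (b, a)}"

definition coend_rel ::
  "('o, 'm) cat \<Rightarrow> ('o \<times> 'o, 'm \<times> 'm, 'x) sftr \<Rightarrow> (('o \<times> 'x) \<times> ('o \<times> 'x)) set" where
  "coend_rel A F = (coend_gen A F \<union> converse (coend_gen A F))\<^sup>*"

definition coend ::
  "('o, 'm) cat \<Rightarrow> ('o \<times> 'o, 'm \<times> 'm, 'x) sftr \<Rightarrow> ('o \<times> 'x) set set" where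
  "coend A F = (SIGMA a:Obj A. FO F (a, a)) // coend_rel A F"

definition coend_cls ::
  "('o, 'm) cat \<Rightarrow> ('o \<times> 'o, 'm \<times> 'm, 'x) sftr \<Rightarrow> 'o \<times> 'x \<Rightarrow> ('o \<times> 'x) set" where
  "coend_cls A F p = coend_rel A F `` {p}"

text \<open>
  The map out of a coend, with values in the coend of \<open>G\<close>, that sends the class of \<open>p\<close> to the class
  of \<open>\<tau> p\<close>: when \<open>\<tau>\<close> respects the equivalence relations, the union has one distinct member only.
\<close>

definition coend_map ::
  "('p, 'n) cat \<Rightarrow> ('p \<times> 'p, 'n \<times> 'n, 'y) sftr \<Rightarrow> ('o \<times> 'x \<Rightarrow> 'p \<times> 'y) \<Rightarrow>
   ('o \<times> 'x) set \<Rightarrow> ('p \<times> 'y) set" where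
  "coend_map B G \<tau> c = (\<Union>p\<in>c. coend_cls B G (\<tau> p))"


section \<open>Profunctors\<close>

type_synonym ('o, 'm, 'p, 'n, 'x) prof = "('o \<times> 'p, 'm \<times> 'n, 'x) sftr"

definition profunctor ::
  "('o, 'm) cat \<Rightarrow> ('p, 'n) cat \<Rightarrow> ('o, 'm, 'p, 'n, 'x) prof \<Rightarrow> bool" where
  "profunctor A B \<Phi> \<longleftrightarrow> is_functor (prod_cat A (op_cat B)) set_cat \<Phi>"

definition prof_op :: "('o, 'm, 'p, 'n, 'x) prof \<Rightarrow> ('p, 'n, 'o, 'm, 'x) prof" where
  "prof_op \<Phi> = \<lparr>FO = (\<lambda>(b, a). FO \<Phi> (a, b)),
                FM = (\<lambda>(b, a) (b', a') (g, f). FM \<Phi> (a, b) (a', b') (f, g))\<rparr>"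

definition prof_comp_int ::
  "('o, 'm) cat \<Rightarrow> ('q, 'k) cat \<Rightarrow> ('p, 'n, 'q, 'k, 'y) prof \<Rightarrow> ('o, 'm, 'p, 'n, 'x) prof \<Rightarrow>
   'o \<times> 'q \<Rightarrow> ('p \<times> 'p, 'n \<times> 'n, 'y \<times> 'x) sftr" where
  "prof_comp_int A D \<Psi> \<Phi> = (\<lambda>(a, d).
     \<lparr>FO = (\<lambda>(b, c). FO \<Psi> (c, d) \<times> FO \<Phi> (a, b)),
      FM = (\<lambda>(b, c) (b', c') (u, v). \<lambda>(y, x)\<in>FO \<Psi> (c, d) \<times> FO \<Phi> (a, b).
              (FM \<Psi> (c, d) (c', d) (v, Idn D d) y, FM \<Phi> (a, b) (a, b') (Idn A a, u) x))\<rparr>)"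

text \<open>The composite of \<open>\<Phi>\<close> from \<open>A\<close> to \<open>B\<close> and \<open>\<Psi>\<close> from \<open>B\<close> to \<open>D\<close>.\<close>

definition prof_comp ::
  "('o, 'm) cat \<Rightarrow> ('p, 'n) cat \<Rightarrow> ('q, 'k) cat \<Rightarrow>
   ('p, 'n, 'q, 'k, 'y) prof \<Rightarrow> ('o, 'm, 'p, 'n, 'x) prof \<Rightarrow>
   ('o, 'm, 'q, 'k, ('p \<times> 'y \<times> 'x) set) prof" where
  "prof_comp A B D \<Psi> \<Phi> =
     \<lparr>FO = (\<lambda>ad. coend B (prof_comp_int A D \<Psi> \<Phi> ad)),
      FM = (\<lambda>(a, d) (a', d') (f, g). \<lambda>w\<in>coend B (prof_comp_int A D \<Psi> \<Phi> (a, d)).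
              coend_map B (prof_comp_int A D \<Psi> \<Phi> (a', d'))
                (\<lambda>(b, y, x). (b, FM \<Psi> (b, d) (b, d') (Idn B b, g) y,
                                 FM \<Phi> (a, b) (a', b) (f, Idn B b) x)) w)\<rparr>"

definition prof_comp_el ::
  "('o, 'm) cat \<Rightarrow> ('p, 'n) cat \<Rightarrow> ('q, 'k) cat \<Rightarrow>
   ('p, 'n, 'q, 'k, 'y) prof \<Rightarrow> ('o, 'm, 'p, 'n, 'x) prof \<Rightarrow> 'o \<times> 'q \<Rightarrow> 'p \<Rightarrow> 'y \<Rightarrow> 'x \<Rightarrow>
   ('p \<times> 'y \<times> 'x) set" where
  "prof_comp_el A B D \<Psi> \<Phi> ad b y x = coend_cls B (prof_comp_int A D \<Psi> \<Phi> ad) (b, y, x)"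

text \<open>The profunctor \<open>(a, b) \<mapsto> A[F b, a]\<close> from \<open>A\<close> to \<open>B\<close> given by a functor \<open>F\<close> from \<open>B\<close> to \<open>A\<close>.\<close>

definition rep_prof ::
  "('o, 'm) cat \<Rightarrow> ('p, 'n, 'o, 'm) ftr \<Rightarrow> ('o, 'm, 'p, 'n, 'm) prof" where
  "rep_prof A F =
     \<lparr>FO = (\<lambda>(a, b). Hom A (FO F b) a),
      FM = (\<lambda>(a, b) (a', b') (h, g). \<lambda>x\<in>Hom A (FO F b) a.
              Cmp A (FO F b') a a' h (Cmp A (FO F b') (FO F b) a x (FM F b' b g)))\<rparr>"

text \<open>Functors to \<open>\<^bold>S\<^bold>e\<^bold>t\<close> as profunctors to the terminal category, and conversely.\<close>

definition prof_of :: "('o, 'm, 'x) sftr \<Rightarrow> ('o, 'm, unit, unit, 'x) prof" where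
  "prof_of F = \<lparr>FO = (\<lambda>(a, _). FO F a), FM = (\<lambda>(a, _) (b, _) (f, _). FM F a b f)\<rparr>"

definition ftr_of :: "('o, 'm, unit, unit, 'x) prof \<Rightarrow> ('o, 'm, 'x) sftr" where
  "ftr_of \<Phi> = \<lparr>FO = (\<lambda>a. FO \<Phi> (a, ())), FM = (\<lambda>a b f. FM \<Phi> (a, ()) (b, ()) (f, ()))\<rparr>"


section \<open>The constructions ! and ?\<close>

datatype comb = CSigma | CDelta | CEpsilon

text \<open>
  The functions from \<open>{0, \<dots>, m-1}\<close> to \<open>{0, \<dots>, n-1}\<close> that the combinators in \<open>X\<close> generate.  For the
  subsets \<open>{\<delta>}\<close> and \<open>{\<delta>,\<epsilon>}\<close>, which are excluded throughout, the value is irrelevant.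
\<close>

definition cls :: "comb set \<Rightarrow> nat \<Rightarrow> nat \<Rightarrow> (nat \<Rightarrow> nat) set" where
  "cls X m n = {f \<in> {..<m} \<rightarrow> {..<n}.
     (X = {} \<longrightarrow> m = n \<and> (\<forall>i<m. f i = i)) \<and>
     (X = {CEpsilon} \<longrightarrow> mono_on {..<m} f \<and> inj_on f {..<m}) \<and>
     (X = {CSigma} \<longrightarrow> bij_betw f {..<m} {..<n}) \<and>
     (X = {CSigma, CDelta} \<longrightarrow> f ` {..<m} = {..<n}) \<and>
     (X = {CSigma, CEpsilon} \<longrightarrow> inj_on f {..<m})}"

text \<open>
  A morphism from \<open>(C\<^sub>1,\<dots>,C\<^sub>n)\<close> to \<open>(D\<^sub>1,\<dots>,D\<^sub>m)\<close> is the list of the pairs \<open>(f j, g\<^sub>j)\<close>, where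
  \<open>g\<^sub>j : C\<^bsub>f j\<^esub> \<rightarrow> D\<^sub>j\<close>.  Indices start at 0.
\<close>

definition bang :: "comb set \<Rightarrow> ('o, 'm) cat \<Rightarrow> ('o list, (nat \<times> 'm) list) cat" where
  "bang X C =
     \<lparr>Obj = lists (Obj C),
      Hom = (\<lambda>cs ds. {h. length h = length ds \<and>
               (\<lambda>j. fst (h ! j)) \<in> cls X (length ds) (length cs) \<and>
               (\<forall>j<length ds. snd (h ! j) \<in> Hom C (cs ! fst (h ! j)) (ds ! j))}),
      Idn = (\<lambda>cs. map (\<lambda>i. (i, Idn C (cs ! i))) [0..<length cs]),
      Cmp = (\<lambda>cs ds es k h. map (\<lambda>l. let (j, g') = k ! l; (i, g) = h ! j
                                      in (i, Cmp C (cs ! i) (ds ! j) (es ! l) g' g))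
                                 [0..<length es])\<rparr>"

definition bang_unit :: "('o, 'm, 'o list, (nat \<times> 'm) list) ftr" where
  "bang_unit = \<lparr>FO = (\<lambda>c. [c]), FM = (\<lambda>_ _ g. [(0, g)])\<rparr>"

text \<open>
  The multiplication of the monad.  On a morphism from \<open>css\<close>, the indices into the sequence
  \<open>css ! i\<close> are shifted by the total length of the sequences that precede it.
\<close>

definition bang_mult :: "('o list list, (nat \<times> (nat \<times> 'm) list) list, 'o list, (nat \<times> 'm) list) ftr" where
  "bang_mult =
     \<lparr>FO = concat,
      FM = (\<lambda>css dss. concat \<circ>
              map (\<lambda>(i, G). map (\<lambda>(k, g). (length (concat (take i css)) + k, g)) G))\<rparr>"

text \<open>
  The morphism \<open>(D\<^sub>1,\<dots>,D\<^sub>n) \<rightarrow> (D\<^bsub>f 1\<^esub>,\<dots>,D\<^bsub>f m\<^esub>)\<close> with identity components, where \<open>f\<close> is the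
  function underlying \<open>h\<close>.
\<close>

definition reindex :: "('p, 'n) cat \<Rightarrow> 'p list \<Rightarrow> (nat \<times> 'm) list \<Rightarrow> (nat \<times> 'n) list" where
  "reindex C ds h = map (\<lambda>(i, _). (i, Idn C (ds ! i))) h"

text \<open>
  The extension of ! to profunctors.  Here \<open>\<Phi>\<close> goes from \<open>A\<close> to \<open>B\<close>, and \<open>enumerate 0 v\<close> is the
  morphism of \<open>!B\<close> with underlying function the identity and with components \<open>v\<close>.
\<close>

definition bang_prof_int ::
  "comb set \<Rightarrow> ('o, 'm) cat \<Rightarrow> ('p, 'n) cat \<Rightarrow> ('o, 'm, 'p, 'n, 'x) prof \<Rightarrow> 'o list \<times> 'p list \<Rightarrow>
   ('p list \<times> 'p list, 'n list \<times> 'n list, 'x list \<times> (nat \<times> 'n) list) sftr" where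
  "bang_prof_int X A B \<Phi> = (\<lambda>(as, bs).
     \<lparr>FO = (\<lambda>(ds, es). listset (map2 (\<lambda>a d. FO \<Phi> (a, d)) as ds) \<times> Hom (bang X B) bs es),
      FM = (\<lambda>(ds, es) (ds', es') (u, v).
              \<lambda>(xs, k)\<in>listset (map2 (\<lambda>a d. FO \<Phi> (a, d)) as ds) \<times> Hom (bang X B) bs es.
              (map (\<lambda>i. FM \<Phi> (as ! i, ds ! i) (as ! i, ds' ! i) (Idn A (as ! i), u ! i) (xs ! i))
                 [0..<length as],
               Cmp (bang X B) bs es es' (enumerate 0 v) k))\<rparr>)"

definition bang_prof ::
  "comb set \<Rightarrow> ('o, 'm) cat \<Rightarrow> ('p, 'n) cat \<Rightarrow> ('o, 'm, 'p, 'n, 'x) prof \<Rightarrow>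
   ('o list, (nat \<times> 'm) list, 'p list, (nat \<times> 'n) list,
    ('p list \<times> 'x list \<times> (nat \<times> 'n) list) set) prof" where
  "bang_prof X A B \<Phi> =
     \<lparr>FO = (\<lambda>(as, bs). coend (pow_cat (length as) B) (bang_prof_int X A B \<Phi> (as, bs))),
      FM = (\<lambda>(as, bs) (as', bs') (h, w).
              \<lambda>z\<in>coend (pow_cat (length as) B) (bang_prof_int X A B \<Phi> (as, bs)).
              coend_map (pow_cat (length as') B) (bang_prof_int X A B \<Phi> (as', bs'))
                (\<lambda>(ds, xs, k).
                   let ds' = map (\<lambda>(i, _). ds ! i) h
                   in (ds',
                       map (\<lambda>j. let (i, g) = h ! j
                                 in FM \<Phi> (as ! i, ds ! i) (as' ! j, ds ! i) (g, Idn B (ds ! i)) (xs ! i))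
                         [0..<length h],
                       Cmp (bang X B) bs' ds ds' (reindex B ds h) (Cmp (bang X B) bs' bs ds k w))) z)\<rparr>"

definition quest :: "comb set \<Rightarrow> ('o, 'm) cat \<Rightarrow> ('o list, (nat \<times> 'm) list) cat" where
  "quest X C = op_cat (bang X (op_cat C))"

text \<open>\<open>?\<Phi>\<close> for \<open>\<Phi>\<close> from \<open>A\<close> to \<open>B\<close>.\<close>

definition quest_prof ::
  "comb set \<Rightarrow> ('o, 'm) cat \<Rightarrow> ('p, 'n) cat \<Rightarrow> ('o, 'm, 'p, 'n, 'x) prof \<Rightarrow>
   ('o list, (nat \<times> 'm) list, 'p list, (nat \<times> 'n) list,
    ('o list \<times> 'x list \<times> (nat \<times> 'm) list) set) prof" where
  "quest_prof X A B \<Phi> = prof_op (bang_prof X (op_cat B) (op_cat A) (prof_op \<Phi>))"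

definition counit ::
  "comb set \<Rightarrow> ('o, 'm) cat \<Rightarrow> ('o list, (nat \<times> 'm) list, 'o, 'm, (nat \<times> 'm) list) prof" where
  "counit X C = rep_prof (quest X C) (op_ftr bang_unit)"

definition comult ::
  "comb set \<Rightarrow> ('o, 'm) cat \<Rightarrow>
   ('o list, (nat \<times> 'm) list, 'o list list, (nat \<times> (nat \<times> 'm) list) list, (nat \<times> 'm) list) prof" where
  "comult X C = rep_prof (quest X C) (op_ftr bang_mult)"


section \<open>Composition in the coKleisli bicategory\<close>

text \<open>\<open>\<Psi> \<bullet> \<Phi> = \<Psi> \<circ> (?\<Phi> \<circ> d)\<close> for \<open>\<Phi>\<close> from \<open>?A\<close> to \<open>B\<close> and \<open>\<Psi>\<close> from \<open>?B\<close> to \<open>D\<close>.\<close>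

definition quest_ext ::
  "comb set \<Rightarrow> ('o, 'm) cat \<Rightarrow> ('p, 'n) cat \<Rightarrow> ('o list, (nat \<times> 'm) list, 'p, 'n, 'x) prof \<Rightarrow>
   ('o list, (nat \<times> 'm) list, 'p list, (nat \<times> 'n) list,
    ('o list list \<times> ('o list list \<times> 'x list \<times> (nat \<times> (nat \<times> 'm) list) list) set
       \<times> (nat \<times> 'm) list) set) prof" where
  "quest_ext X A B \<Phi> =
     prof_comp (quest X A) (quest X (quest X A)) (quest X B)
       (quest_prof X (quest X A) B \<Phi>) (comult X A)"

definition cokl_comp ::
  "comb set \<Rightarrow> ('o, 'm) cat \<Rightarrow> ('p, 'n) cat \<Rightarrow> ('q, 'k) cat \<Rightarrow>
   ('p list, (nat \<times> 'n) list, 'q, 'k, 'y) prof \<Rightarrow> ('o list, (nat \<times> 'm) list, 'p, 'n, 'x) prof \<Rightarrow>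
   ('o list, (nat \<times> 'm) list, 'q, 'k,
    ('p list \<times> 'y \<times>
      ('o list list \<times> ('o list list \<times> 'x list \<times> (nat \<times> (nat \<times> 'm) list) list) set
         \<times> (nat \<times> 'm) list) set) set) prof" where
  "cokl_comp X A B D \<Psi> \<Phi> = prof_comp (quest X A) (quest X B) D \<Psi> (quest_ext X A B \<Phi>)"

definition cokl_id ::
  "comb set \<Rightarrow> ('o, 'm) cat \<Rightarrow> ('o list, (nat \<times> 'm) list, 'o, 'm, (nat \<times> 'm) list) prof" where
  "cokl_id X C = counit X C"

text \<open>
  The element of \<open>(\<Psi> \<bullet> \<Phi>)(as, d)\<close> represented by \<open>bs \<in> ?B\<close>, \<open>y \<in> \<Psi>(bs, d)\<close>, \<open>dss \<in> ??A\<close>, a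
  sequence \<open>ess\<close> of objects of \<open>?A\<close>, the elements \<open>xs ! i \<in> \<Phi>(ess ! i, bs ! i)\<close> and the morphisms
  \<open>h : ess \<rightarrow> dss\<close> of \<open>??A\<close> and \<open>k : concat dss \<rightarrow> as\<close> of \<open>?A\<close>.  All elements are of this form, so that
  a map out of \<open>(\<Psi> \<bullet> \<Phi>)(as, d)\<close> is determined by its values on them.
\<close>

definition cokl_comp_el where
  "cokl_comp_el X A B D \<Psi> \<Phi> as d bs y dss ess xs h k =
     prof_comp_el (quest X A) (quest X B) D \<Psi> (quest_ext X A B \<Phi>) (as, d) bs y
       (prof_comp_el (quest X A) (quest X (quest X A)) (quest X B)
          (quest_prof X (quest X A) B \<Phi>) (comult X A) (as, bs) dss
          (coend_cls (pow_cat (length bs) (op_cat (quest X A)))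
             (bang_prof_int X (op_cat B) (op_cat (quest X A)) (prof_op \<Phi>) (bs, dss)) (ess, xs, h))
          k)"

definition cokl_rep where
  "cokl_rep X A B D \<Psi> \<Phi> as d bs y dss ess xs h k \<longleftrightarrow>
     bs \<in> Obj (quest X B) \<and> y \<in> FO \<Psi> (bs, d) \<and>
     dss \<in> Obj (quest X (quest X A)) \<and>
     ess \<in> Obj (quest X (quest X A)) \<and> length ess = length bs \<and>
     xs \<in> listset (map2 (\<lambda>b e. FO \<Phi> (e, b)) bs ess) \<and>
     h \<in> Hom (quest X (quest X A)) ess dss \<and>
     k \<in> Hom (quest X A) (concat dss) as"

text \<open>The composite \<open>k \<circ> concat h : concat ess \<rightarrow> as\<close> in \<open>?A\<close>.\<close>

definition cokl_rep_mor where
  "cokl_rep_mor X A as dss ess h k =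
     Cmp (quest X A) (concat ess) (concat dss) as k (FM (op_ftr bang_mult) ess dss h)"


section \<open>The explicit formula for the composition\<close>

text \<open>
  The inner coend of the formula,
  \<open>\<integral>\<^bsup>D\<^sub>1,\<dots>,D\<^sub>p\<^esup> \<Phi>(D\<^sub>1,b\<^sub>1) \<times> \<dots> \<times> \<Phi>(D\<^sub>p,b\<^sub>p) \<times> ?A[D\<^sub>1\<cdots>D\<^sub>p, as]\<close>, as a profunctor from \<open>?A\<close> to \<open>?B\<close>.
  A morphism of \<open>?B\<close> from \<open>(b'\<^sub>1,\<dots>,b'\<^sub>q)\<close> to \<open>(b\<^sub>1,\<dots>,b\<^sub>p)\<close>, with underlying function \<open>f\<close>, acts by
  reindexing the sequences of \<open>D\<^sub>i\<close> along \<open>f\<close> and by precomposition with the resulting morphism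
  \<open>D\<^bsub>f 1\<^esub>\<cdots>D\<^bsub>f q\<^esub> \<rightarrow> D\<^sub>1\<cdots>D\<^sub>p\<close>.
\<close>

definition kernel_int ::
  "comb set \<Rightarrow> ('o, 'm) cat \<Rightarrow> ('p, 'n) cat \<Rightarrow> ('o list, (nat \<times> 'm) list, 'p, 'n, 'x) prof \<Rightarrow>
   'o list \<times> 'p list \<Rightarrow>
   ('o list list \<times> 'o list list, (nat \<times> 'm) list list \<times> (nat \<times> 'm) list list,
    'x list \<times> (nat \<times> 'm) list) sftr" where
  "kernel_int X A B \<Phi> = (\<lambda>(as, bs).
     \<lparr>FO = (\<lambda>(dss, ess). listset (map2 (\<lambda>b e. FO \<Phi> (e, b)) bs ess) \<times>
                          Hom (quest X A) (concat dss) as),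
      FM = (\<lambda>(dss, ess) (dss', ess') (u, v).
              \<lambda>(xs, k)\<in>listset (map2 (\<lambda>b e. FO \<Phi> (e, b)) bs ess) \<times> Hom (quest X A) (concat dss) as.
              (map (\<lambda>i. FM \<Phi> (ess ! i, bs ! i) (ess' ! i, bs ! i) (v ! i, Idn B (bs ! i)) (xs ! i))
                 [0..<length bs],
               Cmp (quest X A) (concat dss') (concat dss) as k
                 (FM (op_ftr bang_mult) dss' dss (enumerate 0 u))))\<rparr>)"

definition kernel ::
  "comb set \<Rightarrow> ('o, 'm) cat \<Rightarrow> ('p, 'n) cat \<Rightarrow> ('o list, (nat \<times> 'm) list, 'p, 'n, 'x) prof \<Rightarrow>
   ('o list, (nat \<times> 'm) list, 'p list, (nat \<times> 'n) list,
    ('o list list \<times> 'x list \<times> (nat \<times> 'm) list) set) prof" where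
  "kernel X A B \<Phi> =
     \<lparr>FO = (\<lambda>(as, bs). coend (pow_cat (length bs) (quest X A)) (kernel_int X A B \<Phi> (as, bs))),
      FM = (\<lambda>(as, bs) (as', bs') (w, h).
              \<lambda>z\<in>coend (pow_cat (length bs) (quest X A)) (kernel_int X A B \<Phi> (as, bs)).
              coend_map (pow_cat (length bs') (quest X A)) (kernel_int X A B \<Phi> (as', bs'))
                (\<lambda>(dss, xs, k).
                   let dss' = map (\<lambda>(i, _). dss ! i) h
                   in (dss',
                       map (\<lambda>j. let (i, g) = h ! j
                                 in FM \<Phi> (dss ! i, bs ! i) (dss ! i, bs' ! j)
                                      (Idn (quest X A) (dss ! i), g) (xs ! i))
                         [0..<length h],
                       Cmp (quest X A) (concat dss') as as' w
                         (Cmp (quest X A) (concat dss') (concat dss) as k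
                           (FM (op_ftr bang_mult) dss' dss (reindex (quest X A) dss h))))) z)\<rparr>"

text \<open>
  The right-hand side
  \<open>\<integral>\<^bsup>bs\<^esup> \<Psi>(bs,d) \<times> \<integral>\<^bsup>D\<^sub>1,\<dots>,D\<^sub>p\<^esup> \<Phi>(D\<^sub>1,b\<^sub>1) \<times> \<dots> \<times> \<Phi>(D\<^sub>p,b\<^sub>p) \<times> ?A[D\<^sub>1\<cdots>D\<^sub>p, as]\<close>
  as a functor of \<open>(as, d)\<close>: the outer coend is the one that defines \<open>prof_comp\<close>.
\<close>

definition formula ::
  "comb set \<Rightarrow> ('o, 'm) cat \<Rightarrow> ('p, 'n) cat \<Rightarrow> ('q, 'k) cat \<Rightarrow>
   ('p list, (nat \<times> 'n) list, 'q, 'k, 'y) prof \<Rightarrow> ('o list, (nat \<times> 'm) list, 'p, 'n, 'x) prof \<Rightarrow>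
   ('o list, (nat \<times> 'm) list, 'q, 'k,
    ('p list \<times> 'y \<times> ('o list list \<times> 'x list \<times> (nat \<times> 'm) list) set) set) prof" where
  "formula X A B D \<Psi> \<Phi> = prof_comp (quest X A) (quest X B) D \<Psi> (kernel X A B \<Phi>)"

definition formula_el where
  "formula_el X A B D \<Psi> \<Phi> as d bs y ess xs k =
     prof_comp_el (quest X A) (quest X B) D \<Psi> (kernel X A B \<Phi>) (as, d) bs y
       (coend_cls (pow_cat (length bs) (quest X A)) (kernel_int X A B \<Phi> (as, bs)) (ess, xs, k))"


section \<open>The category \<open>?1\<close> and substitution\<close>

text \<open>\<open>?1\<close> with its objects written \<open>0, 1, 2, \<dots>\<close>, and the identification \<open>len\<close> of \<open>?1\<close> with it.\<close>

definition nats :: "comb set \<Rightarrow> (nat, nat \<Rightarrow> nat) cat" where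
  "nats X = \<lparr>Obj = UNIV, Hom = (\<lambda>m n. ({..<m} \<rightarrow>\<^sub>E {..<n}) \<inter> cls X m n), Idn = (\<lambda>m. \<lambda>i\<in>{..<m}. i),
             Cmp = (\<lambda>l m n g f. compose {..<l} g f)\<rparr>"

definition len :: "(unit list, (nat \<times> unit) list, nat, nat \<Rightarrow> nat) ftr" where
  "len = \<lparr>FO = length, FM = (\<lambda>ls ms h. \<lambda>i\<in>{..<length ls}. fst (h ! i))\<rparr>"

text \<open>
  The function \<open>n\<^sub>1 + \<cdots> + n\<^sub>m \<rightarrow> n'\<^sub>1 + \<cdots> + n'\<^sub>l\<close> sending the \<open>j\<close>-th summand to the summand of
  index \<open>f j\<close> by \<open>g\<^sub>j : n\<^sub>j \<rightarrow> n'\<^bsub>f j\<^esub>\<close>, where \<open>fs\<close> is the list of the pairs \<open>(f j, g\<^sub>j)\<close>.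
\<close>

definition block_map :: "nat list \<Rightarrow> nat list \<Rightarrow> (nat \<times> (nat \<Rightarrow> nat)) list \<Rightarrow> nat \<Rightarrow> nat" where
  "block_map ns ns' fs = (\<lambda>t\<in>{..<sum_list ns}.
     concat (map2 (\<lambda>n (i, g). map (\<lambda>s. sum_list (take i ns') + g s) [0..<n]) ns fs) ! t)"

definition subst_int ::
  "comb set \<Rightarrow> (nat, nat \<Rightarrow> nat, 'z) sftr \<Rightarrow> nat \<times> nat \<Rightarrow>
   (nat list \<times> nat list, (nat \<Rightarrow> nat) list \<times> (nat \<Rightarrow> nat) list, 'z list \<times> (nat \<Rightarrow> nat)) sftr" where
  "subst_int X Z = (\<lambda>(p, m).
     \<lparr>FO = (\<lambda>(ns, ls). listset (map (FO Z) ls) \<times> Hom (nats X) (sum_list ns) p),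
      FM = (\<lambda>(ns, ls) (ns', ls') (u, v).
              \<lambda>(zs, k)\<in>listset (map (FO Z) ls) \<times> Hom (nats X) (sum_list ns) p.
              (map (\<lambda>i. FM Z (ls ! i) (ls' ! i) (v ! i) (zs ! i)) [0..<m],
               Cmp (nats X) (sum_list ns') (sum_list ns) p k (block_map ns' ns (enumerate 0 u))))\<rparr>)"

text \<open>
  The profunctor \<open>(p, m) \<mapsto> \<integral>\<^bsup>n\<^sub>1,\<dots>,n\<^sub>m\<^esup> Zn\<^sub>1 \<times> \<dots> \<times> Zn\<^sub>m \<times> ?1[n\<^sub>1 + \<cdots> + n\<^sub>m, p]\<close>.
\<close>

definition subst_kernel ::
  "comb set \<Rightarrow> (nat, nat \<Rightarrow> nat, 'z) sftr \<Rightarrow>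
   (nat, nat \<Rightarrow> nat, nat, nat \<Rightarrow> nat, (nat list \<times> 'z list \<times> (nat \<Rightarrow> nat)) set) prof" where
  "subst_kernel X Z =
     \<lparr>FO = (\<lambda>(p, m). coend (pow_cat m (nats X)) (subst_int X Z (p, m))),
      FM = (\<lambda>(p, m) (p', m') (w, f).
              \<lambda>c\<in>coend (pow_cat m (nats X)) (subst_int X Z (p, m)).
              coend_map (pow_cat m' (nats X)) (subst_int X Z (p', m'))
                (\<lambda>(ns, zs, k).
                   let ns' = map (\<lambda>j. ns ! f j) [0..<m']
                   in (ns',
                       map (\<lambda>j. zs ! f j) [0..<m'],
                       Cmp (nats X) (sum_list ns') p p' w
                         (Cmp (nats X) (sum_list ns') (sum_list ns) p k
                           (block_map ns' ns
                             (map (\<lambda>j. (f j, Idn (nats X) (ns ! f j))) [0..<m']))))) c)\<rparr>"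

text \<open>The functor \<open>p \<mapsto> \<integral>\<^bsup>m\<^esup> Ym \<times> \<integral>\<^bsup>n\<^sub>1,\<dots>,n\<^sub>m\<^esup> Zn\<^sub>1 \<times> \<dots> \<times> Zn\<^sub>m \<times> ?1[n\<^sub>1 + \<cdots> + n\<^sub>m, p]\<close>.\<close>

definition subst ::
  "comb set \<Rightarrow> (nat, nat \<Rightarrow> nat, 'y) sftr \<Rightarrow> (nat, nat \<Rightarrow> nat, 'z) sftr \<Rightarrow>
   (nat, nat \<Rightarrow> nat, (nat \<times> 'y \<times> (nat list \<times> 'z list \<times> (nat \<Rightarrow> nat)) set) set) sftr" where
  "subst X Y Z = ftr_of (prof_comp (nats X) (nats X) one_cat (prof_of Y) (subst_kernel X Z))"

definition subst_el where
  "subst_el X Y Z p m y ns zs k =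
     prof_comp_el (nats X) (nats X) one_cat (prof_of Y) (subst_kernel X Z) (p, ()) m y
       (coend_cls (pow_cat m (nats X)) (subst_int X Z (p, m)) (ns, zs, k))"


section \<open>Left Kan extensions\<close>

text \<open>
  \<open>(L, \<eta>)\<close> is a left Kan extension of \<open>Y : A \<rightarrow> \<^bold>S\<^bold>e\<^bold>t\<close> along \<open>K : A \<rightarrow> E\<close>: its universal property with
  respect to all functors \<open>G\<close> from \<open>E\<close> to sets with elements in the type \<open>'g\<close>.
\<close>

definition left_kan ::
  "'g itself \<Rightarrow> ('o, 'm) cat \<Rightarrow> ('p, 'n) cat \<Rightarrow> ('o, 'm, 'p, 'n) ftr \<Rightarrow> ('o, 'm, 'y) sftr \<Rightarrow>
   ('p, 'n, 'l) sftr \<Rightarrow> ('o \<Rightarrow> 'y \<Rightarrow> 'l) \<Rightarrow> bool" where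
  "left_kan _ A E K Y L \<eta> \<longleftrightarrow>
     is_functor A E K \<and> is_functor E set_cat L \<and> nat_trans A Y (ftr_comp L K) \<eta> \<and>
     (\<forall>(G :: ('p, 'n, 'g) sftr) \<gamma>. is_functor E set_cat G \<and> nat_trans A Y (ftr_comp G K) \<gamma> \<longrightarrow>
        (\<exists>\<beta>. (nat_trans E L G \<beta> \<and> (\<forall>a\<in>Obj A. \<forall>y\<in>FO Y a. \<beta> (FO K a) (\<eta> a y) = \<gamma> a y)) \<and>
             (\<forall>\<beta>'. nat_trans E L G \<beta>' \<and> (\<forall>a\<in>Obj A. \<forall>y\<in>FO Y a. \<beta>' (FO K a) (\<eta> a y) = \<gamma> a y) \<longrightarrow>
                   (\<forall>s\<in>Obj E. \<forall>x\<in>FO L s. \<beta>' s x = \<beta> s x))))"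

text \<open>
  The functor \<open>m \<mapsto> {0, \<dots>, m-1}\<close> from \<open>?1\<close> to sets with elements in \<open>'u\<close>, where the natural numbers
  are regarded as elements of \<open>'u\<close> by means of an injection \<open>e\<close>.
\<close>

definition nat_incl :: "(nat \<Rightarrow> 'u) \<Rightarrow> (nat, nat \<Rightarrow> nat, 'u) sftr" where
  "nat_incl e = \<lparr>FO = (\<lambda>m. e ` {..<m}),
             FM = (\<lambda>m n f. \<lambda>x\<in>e ` {..<m}. e (f (the_inv_into {..<m} e x)))\<rparr>"

text \<open>The functor \<open>z \<mapsto> \<integral>\<^bsup>m\<^esup> z\<^sup>m \<times> Ym\<close>.\<close>

definition power_coend_int ::
  "(nat, nat \<Rightarrow> nat, 'y) sftr \<Rightarrow> 'z set \<Rightarrow>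
   (nat \<times> nat, (nat \<Rightarrow> nat) \<times> (nat \<Rightarrow> nat), (nat \<Rightarrow> 'z) \<times> 'y) sftr" where
  "power_coend_int Y z =
     \<lparr>FO = (\<lambda>(m, n). ({..<m} \<rightarrow>\<^sub>E z) \<times> FO Y n),
      FM = (\<lambda>(m, n) (m', n') (f, g). \<lambda>(t, y)\<in>({..<m} \<rightarrow>\<^sub>E z) \<times> FO Y n.
              (compose {..<m'} t f, FM Y n n' g y))\<rparr>"

definition power_coend ::
  "comb set \<Rightarrow> (nat, nat \<Rightarrow> nat, 'y) sftr \<Rightarrow> ('z set, 'z \<Rightarrow> 'z, (nat \<times> (nat \<Rightarrow> 'z) \<times> 'y) set) sftr" where
  "power_coend X Y =
     \<lparr>FO = (\<lambda>z. coend (nats X) (power_coend_int Y z)),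
      FM = (\<lambda>z z' s. \<lambda>c\<in>coend (nats X) (power_coend_int Y z).
              coend_map (nats X) (power_coend_int Y z') (\<lambda>(m, t, y). (m, compose {..<m} s t, y)) c)\<rparr>"

definition power_coend_el where
  "power_coend_el X Y z m t y = coend_cls (nats X) (power_coend_int Y z) (m, t, y)"

end

theory Submission
  imports Defs
begin

text \<open>
  The composite \<open>\<Psi> \<bullet> \<Phi>\<close> is \<open>\<Psi> \<circ> E\<close> with \<open>E = ?\<Phi> \<circ> d\<close>, and the formula is \<open>\<Psi> \<circ> kernel\<close>, with the same outer
  coend.  So everything reduces to a natural bijection between \<open>E(as, bs)\<close> and \<open>kernel(as, bs)\<close>.
  Unfolding the definitions,
  \<open>E(as, bs) = \<integral>\<^bsup>dss\<^esup> (\<integral>\<^bsup>ess\<^esup> \<Phi>(ess\<^sub>1, bs\<^sub>1) \<times> \<dots> \<times> ??A[ess, dss]) \<times> ?A[concat dss, as]\<close>, and the co-Yoneda lemma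
  eliminates \<open>dss\<close>: the class of \<open>(dss, [ess, xs, h], k)\<close> is sent to the class of \<open>(ess, xs, k \<circ> concat h)\<close>, and
  conversely \<open>(ess, xs, k)\<close> to \<open>(ess, [ess, xs, id], k)\<close>.  One composite is the identity because
  \<open>concat id = id\<close>; the other one because sliding \<open>h : ess \<rightarrow> dss\<close> across the outer coend turns
  \<open>(ess, [ess, xs, id], k \<circ> concat h)\<close> into \<open>(dss, [ess, xs, h], k)\<close> (\<open>quest_ext_slide\<close>).  The two lemmas
  \<open>kernel_of_bij\<close> and \<open>kernel_of_natural\<close> carry this step.  It needs that concatenation is a functor
  (\<open>functor_bang_mult\<close>), and this is where the classes of functions enter: each of them is closed under composition and under
  gluing functions between blocks (\<open>cls_comp\<close>, \<open>cls_block\<close>).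

  Since composition with \<open>\<Psi>\<close> respects natural bijections, even along an isomorphism of the middle
  category (\<open>prof_comp_iso\<close>), the composite can be computed from any profunctor that is isomorphic to the kernel
  (\<open>cokl_comp_iso\<close>).  The kernel itself gives the formula.  The two special cases
  arise from the isomorphism \<open>len\<close> between \<open>?\<one>\<close> and the category \<open>nats\<close> of natural numbers.  Under it the kernel for \<open>A = B = \<one>\<close>
  becomes \<open>subst_kernel\<close>, since concatenation becomes \<open>block_map\<close>.  When \<open>A\<close> is empty, \<open>?A\<close> has one object and one
  morphism, so that the inner coend identifies nothing and the kernel is the profunctor of tuples \<open>m \<mapsto> z\<^sup>m\<close>; the
  resulting coend \<open>\<integral>\<^sup>m z\<^sup>m \<times> Ym\<close> has the universal property of the left Kan extension, because its element
  \<open>[m, t, y]\<close> is the image under \<open>t\<close> of the element \<open>[m, id, y]\<close> that comes from \<open>Ym\<close>.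

  A morphism of \<open>?A\<close> is a morphism of \<open>qop X A = !(A\<^sup>o\<^sup>p)\<close> in the opposite direction.  The proofs compute in the
  latter category, where \<open>k \<circ> concat h\<close> is \<open>concat h\<close> after \<open>k\<close>.
\<close>

section \<open>Categories, functors and profunctors\<close>

lemma category_id: "category C \<Longrightarrow> a \<in> Obj C \<Longrightarrow> Idn C a \<in> Hom C a a"
  by (simp add: category_def)

lemma category_comp:
  "category C \<Longrightarrow> a \<in> Obj C \<Longrightarrow> b \<in> Obj C \<Longrightarrow> c \<in> Obj C \<Longrightarrow> f \<in> Hom C a b \<Longrightarrow> g \<in> Hom C b c \<Longrightarrow>
   Cmp C a b c g f \<in> Hom C a c"
  by (simp add: category_def)

lemma category_idr:
  "category C \<Longrightarrow> a \<in> Obj C \<Longrightarrow> b \<in> Obj C \<Longrightarrow> f \<in> Hom C a b \<Longrightarrow> Cmp C a a b f (Idn C a) = f"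
  by (simp add: category_def)

lemma category_idl:
  "category C \<Longrightarrow> a \<in> Obj C \<Longrightarrow> b \<in> Obj C \<Longrightarrow> f \<in> Hom C a b \<Longrightarrow> Cmp C a b b (Idn C b) f = f"
  by (simp add: category_def)

lemma category_assoc:
  "category C \<Longrightarrow> a \<in> Obj C \<Longrightarrow> b \<in> Obj C \<Longrightarrow> c \<in> Obj C \<Longrightarrow> d \<in> Obj C \<Longrightarrow>
   f \<in> Hom C a b \<Longrightarrow> g \<in> Hom C b c \<Longrightarrow> h \<in> Hom C c d \<Longrightarrow>
   Cmp C a c d h (Cmp C a b c g f) = Cmp C a b d (Cmp C b c d h g) f"
  by (simp add: category_def)

lemma categoryI:
  assumes "\<And>a. a \<in> Obj C \<Longrightarrow> Idn C a \<in> Hom C a a"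
    and "\<And>a b c f g. \<lbrakk>a \<in> Obj C; b \<in> Obj C; c \<in> Obj C; f \<in> Hom C a b; g \<in> Hom C b c\<rbrakk> \<Longrightarrow>
      Cmp C a b c g f \<in> Hom C a c"
    and "\<And>a b f. \<lbrakk>a \<in> Obj C; b \<in> Obj C; f \<in> Hom C a b\<rbrakk> \<Longrightarrow> Cmp C a a b f (Idn C a) = f"
    and "\<And>a b f. \<lbrakk>a \<in> Obj C; b \<in> Obj C; f \<in> Hom C a b\<rbrakk> \<Longrightarrow> Cmp C a b b (Idn C b) f = f"
    and "\<And>a b c d f g h. \<lbrakk>a \<in> Obj C; b \<in> Obj C; c \<in> Obj C; d \<in> Obj C;
      f \<in> Hom C a b; g \<in> Hom C b c; h \<in> Hom C c d\<rbrakk> \<Longrightarrow>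
      Cmp C a c d h (Cmp C a b c g f) = Cmp C a b d (Cmp C b c d h g) f"
  shows "category C"
  unfolding category_def by (intro conjI ballI) (simp_all add: assms)

lemma functor_ob: "is_functor A B F \<Longrightarrow> a \<in> Obj A \<Longrightarrow> FO F a \<in> Obj B"
  by (simp add: is_functor_def)

lemma functor_mor:
  "is_functor A B F \<Longrightarrow> a \<in> Obj A \<Longrightarrow> b \<in> Obj A \<Longrightarrow> f \<in> Hom A a b \<Longrightarrow>
   FM F a b f \<in> Hom B (FO F a) (FO F b)"
  by (simp add: is_functor_def)

lemma functor_id: "is_functor A B F \<Longrightarrow> a \<in> Obj A \<Longrightarrow> FM F a a (Idn A a) = Idn B (FO F a)"
  by (simp add: is_functor_def)

lemma functor_comp:
  "is_functor A B F \<Longrightarrow> a \<in> Obj A \<Longrightarrow> b \<in> Obj A \<Longrightarrow> c \<in> Obj A \<Longrightarrow> f \<in> Hom A a b \<Longrightarrow> g \<in> Hom A b c \<Longrightarrow>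
   FM F a c (Cmp A a b c g f) = Cmp B (FO F a) (FO F b) (FO F c) (FM F b c g) (FM F a b f)"
  by (simp add: is_functor_def)

lemma functorI:
  assumes "\<And>a. a \<in> Obj A \<Longrightarrow> FO F a \<in> Obj B"
    and "\<And>a b f. \<lbrakk>a \<in> Obj A; b \<in> Obj A; f \<in> Hom A a b\<rbrakk> \<Longrightarrow> FM F a b f \<in> Hom B (FO F a) (FO F b)"
    and "\<And>a. a \<in> Obj A \<Longrightarrow> FM F a a (Idn A a) = Idn B (FO F a)"
    and "\<And>a b c f g. \<lbrakk>a \<in> Obj A; b \<in> Obj A; c \<in> Obj A; f \<in> Hom A a b; g \<in> Hom A b c\<rbrakk> \<Longrightarrow>
      FM F a c (Cmp A a b c g f) = Cmp B (FO F a) (FO F b) (FO F c) (FM F b c g) (FM F a b f)"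
  shows "is_functor A B F"
  unfolding is_functor_def by (intro conjI ballI) (simp_all add: assms)

lemma op_cat_sel [simp]:
  "Obj (op_cat C) = Obj C" "Hom (op_cat C) a b = Hom C b a" "Idn (op_cat C) = Idn C"
  "Cmp (op_cat C) a b c g f = Cmp C c b a f g"
  by (simp_all add: op_cat_def)

lemma op_op_cat [simp]: "op_cat (op_cat C) = C"
  by (simp add: op_cat_def)

lemma category_op: "category C \<Longrightarrow> category (op_cat C)"
  by (rule categoryI) (simp_all add: category_id category_comp category_idl category_idr category_assoc)

lemma op_ftr_sel [simp]: "FO (op_ftr F) = FO F" "FM (op_ftr F) a b = FM F b a"
  by (simp_all add: op_ftr_def)

lemma functor_op: "is_functor A B F \<Longrightarrow> is_functor (op_cat A) (op_cat B) (op_ftr F)"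
  by (rule functorI) (simp_all add: functor_ob functor_mor functor_id functor_comp)

lemma ftr_comp_sel [simp]:
  "FO (ftr_comp G F) a = FO G (FO F a)" "FM (ftr_comp G F) a b f = FM G (FO F a) (FO F b) (FM F a b f)"
  by (simp_all add: ftr_comp_def)

lemma functor_ftr_comp: "is_functor A B F \<Longrightarrow> is_functor B C G \<Longrightarrow> is_functor A C (ftr_comp G F)"
  by (rule functorI) (simp_all add: functor_ob functor_mor functor_id functor_comp)

lemma prod_cat_sel [simp]:
  "Obj (prod_cat A B) = Obj A \<times> Obj B"
  "Hom (prod_cat A B) (a, b) (a', b') = Hom A a a' \<times> Hom B b b'"
  "Idn (prod_cat A B) (a, b) = (Idn A a, Idn B b)"
  "Cmp (prod_cat A B) (a, b) (a', b') (a'', b'') (g, g') (f, f') =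
     (Cmp A a a' a'' g f, Cmp B b b' b'' g' f')"
  by (simp_all add: prod_cat_def)

lemma category_prod: "category A \<Longrightarrow> category B \<Longrightarrow> category (prod_cat A B)"
  by (rule categoryI)
    (auto simp: category_id category_comp category_idl category_idr category_assoc)

lemma one_cat_sel [simp]:
  "Obj one_cat = {()}" "Hom one_cat a b = {()}" "Idn one_cat a = ()" "Cmp one_cat a b c g f = ()"
  by (simp_all add: one_cat_def)

lemma category_one: "category one_cat"
  by (rule categoryI) simp_all

lemma op_one_cat [simp]: "op_cat one_cat = one_cat"
  by (simp add: op_cat_def one_cat_def)

lemma category_empty: "category empty_cat"
  by (rule categoryI) (simp_all add: empty_cat_def)

definition id_ftr :: "('o, 'm, 'o, 'm) ftr" where
  "id_ftr = \<lparr>FO = (\<lambda>a. a), FM = (\<lambda>_ _ f. f)\<rparr>"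

lemma id_ftr_sel [simp]: "FO id_ftr a = a" "FM id_ftr a b f = f"
  by (simp_all add: id_ftr_def)

lemma cat_iso_id: "cat_iso A A id_ftr"
  by (auto simp: cat_iso_def bij_betw_def inj_on_def intro!: functorI)

text \<open>Elementwise form of the laws of a functor to sets.\<close>

lemma set_cat_sel [simp]:
  "Obj set_cat = UNIV" "Hom set_cat P Q = P \<rightarrow>\<^sub>E Q" "Idn set_cat P = (\<lambda>x\<in>P. x)"
  "Cmp set_cat P Q R g f = compose P g f"
  by (simp_all add: set_cat_def)

lemma category_set: "category set_cat"
  by (rule categoryI)
    (auto simp: compose_def fun_eq_iff PiE_def extensional_def Pi_def)

lemma set_functor_mor:
  "is_functor A set_cat F \<Longrightarrow> a \<in> Obj A \<Longrightarrow> b \<in> Obj A \<Longrightarrow> f \<in> Hom A a b \<Longrightarrow>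
   FM F a b f \<in> FO F a \<rightarrow>\<^sub>E FO F b"
  by (drule (3) functor_mor) simp

lemma set_functor_app:
  "is_functor A set_cat F \<Longrightarrow> a \<in> Obj A \<Longrightarrow> b \<in> Obj A \<Longrightarrow> f \<in> Hom A a b \<Longrightarrow> x \<in> FO F a \<Longrightarrow>
   FM F a b f x \<in> FO F b"
  by (drule (3) set_functor_mor) auto

lemma set_functor_id:
  "is_functor A set_cat F \<Longrightarrow> a \<in> Obj A \<Longrightarrow> x \<in> FO F a \<Longrightarrow> FM F a a (Idn A a) x = x"
  by (simp add: functor_id)

lemma set_functor_comp:
  "is_functor A set_cat F \<Longrightarrow> a \<in> Obj A \<Longrightarrow> b \<in> Obj A \<Longrightarrow> c \<in> Obj A \<Longrightarrow> f \<in> Hom A a b \<Longrightarrow> g \<in> Hom A b c \<Longrightarrow>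
   x \<in> FO F a \<Longrightarrow> FM F a c (Cmp A a b c g f) x = FM F b c g (FM F a b f x)"
  by (simp add: functor_comp compose_eq)

lemma set_functorI:
  assumes "category A"
    and mor: "\<And>a b f. \<lbrakk>a \<in> Obj A; b \<in> Obj A; f \<in> Hom A a b\<rbrakk> \<Longrightarrow> FM F a b f \<in> FO F a \<rightarrow>\<^sub>E FO F b"
    and id: "\<And>a x. \<lbrakk>a \<in> Obj A; x \<in> FO F a\<rbrakk> \<Longrightarrow> FM F a a (Idn A a) x = x"
    and comp: "\<And>a b c f g x. \<lbrakk>a \<in> Obj A; b \<in> Obj A; c \<in> Obj A; f \<in> Hom A a b; g \<in> Hom A b c; x \<in> FO F a\<rbrakk> \<Longrightarrow>
      FM F a c (Cmp A a b c g f) x = FM F b c g (FM F a b f x)"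
  shows "is_functor A set_cat F"
proof (rule functorI)
  fix a assume a: "a \<in> Obj A"
  have "FM F a a (Idn A a) \<in> FO F a \<rightarrow>\<^sub>E FO F a"
    using mor[OF a a] category_id[OF assms(1) a] .
  then show "FM F a a (Idn A a) = Idn set_cat (FO F a)"
    by (intro extensionalityI[of _ "FO F a"]) (auto simp: id a PiE_iff)
next
  fix a b c f g assume *: "a \<in> Obj A" "b \<in> Obj A" "c \<in> Obj A" "f \<in> Hom A a b" "g \<in> Hom A b c"
  have "FM F a c (Cmp A a b c g f) \<in> FO F a \<rightarrow>\<^sub>E FO F c"
    using * by (intro mor category_comp assms(1))
  then show "FM F a c (Cmp A a b c g f) =
      Cmp set_cat (FO F a) (FO F b) (FO F c) (FM F b c g) (FM F a b f)"
    by (intro extensionalityI[of _ "FO F a"]) (auto simp: comp * compose_eq PiE_iff)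
qed (simp_all add: mor)

lemma profunctor_mor:
  assumes "profunctor A B \<Phi>" "a \<in> Obj A" "b \<in> Obj B" "a' \<in> Obj A" "b' \<in> Obj B" "f \<in> Hom A a a'" "g \<in> Hom B b' b"
  shows "FM \<Phi> (a, b) (a', b') (f, g) \<in> FO \<Phi> (a, b) \<rightarrow>\<^sub>E FO \<Phi> (a', b')"
  using set_functor_mor[of "prod_cat A (op_cat B)" \<Phi> "(a, b)" "(a', b')" "(f, g)"] assms
  by (simp add: profunctor_def)

lemma profunctor_app:
  assumes "profunctor A B \<Phi>" "a \<in> Obj A" "b \<in> Obj B" "a' \<in> Obj A" "b' \<in> Obj B" "f \<in> Hom A a a'" "g \<in> Hom B b' b"
    "x \<in> FO \<Phi> (a, b)"
  shows "FM \<Phi> (a, b) (a', b') (f, g) x \<in> FO \<Phi> (a', b')"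
  using profunctor_mor[OF assms(1-7)] assms(8) by auto

lemma profunctor_id:
  assumes "profunctor A B \<Phi>" "a \<in> Obj A" "b \<in> Obj B" "x \<in> FO \<Phi> (a, b)"
  shows "FM \<Phi> (a, b) (a, b) (Idn A a, Idn B b) x = x"
  using set_functor_id[of "prod_cat A (op_cat B)" \<Phi> "(a, b)" x] assms by (simp add: profunctor_def)

lemma profunctor_comp:
  assumes "profunctor A B \<Phi>" "a \<in> Obj A" "b \<in> Obj B" "a' \<in> Obj A" "b' \<in> Obj B" "a'' \<in> Obj A" "b'' \<in> Obj B"
    "f \<in> Hom A a a'" "g \<in> Hom B b' b" "f' \<in> Hom A a' a''" "g' \<in> Hom B b'' b'" "x \<in> FO \<Phi> (a, b)"
  shows "FM \<Phi> (a', b') (a'', b'') (f', g') (FM \<Phi> (a, b) (a', b') (f, g) x) =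
    FM \<Phi> (a, b) (a'', b'') (Cmp A a a' a'' f' f, Cmp B b'' b' b g g') x"
  using set_functor_comp[of "prod_cat A (op_cat B)" \<Phi> "(a, b)" "(a', b')" "(a'', b'')" "(f, g)" "(f', g')" x] assms
  by (simp add: profunctor_def)

lemma profunctorI:
  assumes "category A" "category B"
    and mor: "\<And>a b a' b' f g. \<lbrakk>a \<in> Obj A; b \<in> Obj B; a' \<in> Obj A; b' \<in> Obj B; f \<in> Hom A a a'; g \<in> Hom B b' b\<rbrakk> \<Longrightarrow>
      FM \<Phi> (a, b) (a', b') (f, g) \<in> FO \<Phi> (a, b) \<rightarrow>\<^sub>E FO \<Phi> (a', b')"
    and id: "\<And>a b x. \<lbrakk>a \<in> Obj A; b \<in> Obj B; x \<in> FO \<Phi> (a, b)\<rbrakk> \<Longrightarrow> FM \<Phi> (a, b) (a, b) (Idn A a, Idn B b) x = x"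
    and comp: "\<And>a b a' b' a'' b'' f g f' g' x.
      \<lbrakk>a \<in> Obj A; b \<in> Obj B; a' \<in> Obj A; b' \<in> Obj B; a'' \<in> Obj A; b'' \<in> Obj B;
       f \<in> Hom A a a'; g \<in> Hom B b' b; f' \<in> Hom A a' a''; g' \<in> Hom B b'' b'; x \<in> FO \<Phi> (a, b)\<rbrakk> \<Longrightarrow>
      FM \<Phi> (a, b) (a'', b'') (Cmp A a a' a'' f' f, Cmp B b'' b' b g g') x =
      FM \<Phi> (a', b') (a'', b'') (f', g') (FM \<Phi> (a, b) (a', b') (f, g) x)"
  shows "profunctor A B \<Phi>"
  unfolding profunctor_def
proof (rule set_functorI)
  show "category (prod_cat A (op_cat B))"
    by (intro category_prod category_op assms)
next
  fix p q h assume "p \<in> Obj (prod_cat A (op_cat B))" "q \<in> Obj (prod_cat A (op_cat B))"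
    "h \<in> Hom (prod_cat A (op_cat B)) p q"
  then show "FM \<Phi> p q h \<in> FO \<Phi> p \<rightarrow>\<^sub>E FO \<Phi> q"
    by (cases p; cases q; cases h) (simp add: mor)
next
  fix p x assume "p \<in> Obj (prod_cat A (op_cat B))" "x \<in> FO \<Phi> p"
  then show "FM \<Phi> p p (Idn (prod_cat A (op_cat B)) p) x = x"
    by (cases p) (simp add: id)
next
  fix p q r h k x assume "p \<in> Obj (prod_cat A (op_cat B))" "q \<in> Obj (prod_cat A (op_cat B))"
    "r \<in> Obj (prod_cat A (op_cat B))" "h \<in> Hom (prod_cat A (op_cat B)) p q"
    "k \<in> Hom (prod_cat A (op_cat B)) q r" "x \<in> FO \<Phi> p"
  then show "FM \<Phi> p r (Cmp (prod_cat A (op_cat B)) p q r k h) x = FM \<Phi> q r k (FM \<Phi> p q h x)"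
    by (cases p; cases q; cases r; cases h; cases k) (simp add: comp)
qed

lemma profunctor_op:
  assumes "category A" "category B" "profunctor A B \<Phi>"
  shows "profunctor (op_cat B) (op_cat A) (prof_op \<Phi>)"
proof (rule profunctorI)
  fix a b a' b' f g
  assume "a \<in> Obj (op_cat B)" "b \<in> Obj (op_cat A)" "a' \<in> Obj (op_cat B)" "b' \<in> Obj (op_cat A)"
    "f \<in> Hom (op_cat B) a a'" "g \<in> Hom (op_cat A) b' b"
  then show "FM (prof_op \<Phi>) (a, b) (a', b') (f, g) \<in> FO (prof_op \<Phi>) (a, b) \<rightarrow>\<^sub>E FO (prof_op \<Phi>) (a', b')"
    using profunctor_mor[OF assms(3), of b a b' a' g f] by (simp add: prof_op_def)
qed (use assms in \<open>simp_all add: prof_op_def category_op profunctor_id profunctor_comp\<close>)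

text \<open>
  A natural bijection \<open>\<Phi>(a, b) \<cong> \<Phi>'(J a, K b)\<close>.  The functors \<open>J\<close> and \<open>K\<close> account for categories that are
  identified only up to isomorphism, such as \<open>?\<one>\<close> and \<open>nats\<close>.
\<close>

definition prof_iso ::
  "('o, 'm) cat \<Rightarrow> ('p, 'n) cat \<Rightarrow> ('o, 'm, 'p, 'n, 'x) prof \<Rightarrow> ('o1, 'm1, 'p1, 'n1, 'x1) prof \<Rightarrow>
   ('o, 'm, 'o1, 'm1) ftr \<Rightarrow> ('p, 'n, 'p1, 'n1) ftr \<Rightarrow> ('o \<Rightarrow> 'p \<Rightarrow> 'x \<Rightarrow> 'x1) \<Rightarrow> bool" where
  "prof_iso A B \<Phi> \<Phi>' J K \<beta> \<longleftrightarrow>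
     (\<forall>a\<in>Obj A. \<forall>b\<in>Obj B. bij_betw (\<beta> a b) (FO \<Phi> (a, b)) (FO \<Phi>' (FO J a, FO K b))) \<and>
     (\<forall>a\<in>Obj A. \<forall>b\<in>Obj B. \<forall>a'\<in>Obj A. \<forall>b'\<in>Obj B. \<forall>f\<in>Hom A a a'. \<forall>g\<in>Hom B b' b. \<forall>x\<in>FO \<Phi> (a, b).
        \<beta> a' b' (FM \<Phi> (a, b) (a', b') (f, g) x) =
        FM \<Phi>' (FO J a, FO K b) (FO J a', FO K b') (FM J a a' f, FM K b' b g) (\<beta> a b x))"

lemma prof_iso_bij:
  "prof_iso A B \<Phi> \<Phi>' J K \<beta> \<Longrightarrow> a \<in> Obj A \<Longrightarrow> b \<in> Obj B \<Longrightarrow> bij_betw (\<beta> a b) (FO \<Phi> (a, b)) (FO \<Phi>' (FO J a, FO K b))"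
  by (simp add: prof_iso_def)

lemma prof_iso_app:
  "prof_iso A B \<Phi> \<Phi>' J K \<beta> \<Longrightarrow> a \<in> Obj A \<Longrightarrow> b \<in> Obj B \<Longrightarrow> x \<in> FO \<Phi> (a, b) \<Longrightarrow> \<beta> a b x \<in> FO \<Phi>' (FO J a, FO K b)"
  by (rule bij_betw_apply[OF prof_iso_bij])

lemma prof_iso_nat:
  "prof_iso A B \<Phi> \<Phi>' J K \<beta> \<Longrightarrow> a \<in> Obj A \<Longrightarrow> b \<in> Obj B \<Longrightarrow> a' \<in> Obj A \<Longrightarrow> b' \<in> Obj B \<Longrightarrow>
   f \<in> Hom A a a' \<Longrightarrow> g \<in> Hom B b' b \<Longrightarrow> x \<in> FO \<Phi> (a, b) \<Longrightarrow>
   \<beta> a' b' (FM \<Phi> (a, b) (a', b') (f, g) x) =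
   FM \<Phi>' (FO J a, FO K b) (FO J a', FO K b') (FM J a a' f, FM K b' b g) (\<beta> a b x)"
  by (simp add: prof_iso_def)

lemma prof_iso_id: "prof_iso A B \<Phi> \<Phi> id_ftr id_ftr (\<lambda>_ _ x. x)"
  by (simp add: prof_iso_def bij_betw_def)

lemma prof_iso_trans:
  assumes "prof_iso A B \<Phi> \<Phi>' id_ftr id_ftr \<beta>" "prof_iso A B \<Phi>' \<Phi>'' J K \<beta>'"
  shows "prof_iso A B \<Phi> \<Phi>'' J K (\<lambda>a b x. \<beta>' a b (\<beta> a b x))"
  unfolding prof_iso_def
proof (intro conjI ballI)
  fix a b assume "a \<in> Obj A" "b \<in> Obj B"
  from bij_betw_trans[OF prof_iso_bij[OF assms(1) this] prof_iso_bij[OF assms(2), unfolded id_ftr_sel]] this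
  show "bij_betw (\<lambda>x. \<beta>' a b (\<beta> a b x)) (FO \<Phi> (a, b)) (FO \<Phi>'' (FO J a, FO K b))"
    by (simp add: comp_def)
qed (use assms prof_iso_app[OF assms(1)] in \<open>simp add: prof_iso_nat\<close>)

text \<open>
  Functoriality is transported along isomorphisms of categories and natural bijections, so that it
  need not be checked for a functor that is compared with another one.
\<close>

lemma profunctor_transport:
  assumes cat: "category A" "category B" "category A'" "category B'"
    and \<Phi>: "profunctor A B \<Phi>" and J: "cat_iso A A' J" and K: "cat_iso B B' K"
    and \<beta>: "prof_iso A B \<Phi> \<Phi>' J K \<beta>"
    and ext: "\<And>a b a' b' f g. FM \<Phi>' (a, b) (a', b') (f, g) \<in> extensional (FO \<Phi>' (a, b))"
  shows "profunctor A' B' \<Phi>'"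
proof (rule profunctorI)
  have JO: "\<exists>a\<in>Obj A. a' = FO J a" if "a' \<in> Obj A'" for a'
    using that J unfolding cat_iso_def bij_betw_def by blast
  have KO: "\<exists>a\<in>Obj B. a' = FO K a" if "a' \<in> Obj B'" for a'
    using that K unfolding cat_iso_def bij_betw_def by blast
  have JM: "\<exists>f'\<in>Hom A a b. f = FM J a b f'" if "a \<in> Obj A" "b \<in> Obj A" "f \<in> Hom A' (FO J a) (FO J b)" for a b f
    using that J unfolding cat_iso_def bij_betw_def by blast
  have KM: "\<exists>f'\<in>Hom B a b. f = FM K a b f'" if "a \<in> Obj B" "b \<in> Obj B" "f \<in> Hom B' (FO K a) (FO K b)" for a b f
    using that K unfolding cat_iso_def bij_betw_def by blast
  have JF: "is_functor A A' J" and KF: "is_functor B B' K"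
    using J K by (simp_all add: cat_iso_def)
  have X: "\<exists>x\<in>FO \<Phi> (a, b). x' = \<beta> a b x" if "a \<in> Obj A" "b \<in> Obj B" "x' \<in> FO \<Phi>' (FO J a, FO K b)" for a b x'
    using prof_iso_bij[OF \<beta> that(1,2)] that(3) unfolding bij_betw_def by blast
  have X': "\<beta> a b x \<in> FO \<Phi>' (FO J a, FO K b)" if "a \<in> Obj A" "b \<in> Obj B" "x \<in> FO \<Phi> (a, b)" for a b x
    using prof_iso_bij[OF \<beta> that(1,2)] that(3) unfolding bij_betw_def by blast
  note nat = prof_iso_nat[OF \<beta>]
  show "category A'" "category B'" by fact+
  {
    fix a b a' b' f g
    assume *: "a \<in> Obj A'" "b \<in> Obj B'" "a' \<in> Obj A'" "b' \<in> Obj B'" "f \<in> Hom A' a a'" "g \<in> Hom B' b' b"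
    obtain a0 b0 a1 b1 where o: "a = FO J a0" "a0 \<in> Obj A" "b = FO K b0" "b0 \<in> Obj B"
      "a' = FO J a1" "a1 \<in> Obj A" "b' = FO K b1" "b1 \<in> Obj B"
      using * JO KO by meson
    obtain f0 g0 where m: "f = FM J a0 a1 f0" "f0 \<in> Hom A a0 a1" "g = FM K b1 b0 g0" "g0 \<in> Hom B b1 b0"
      using JM[of a0 a1 f] KM[of b1 b0 g] o * by blast
    have "FM \<Phi>' (a, b) (a', b') (f, g) x \<in> FO \<Phi>' (a', b')" if x: "x \<in> FO \<Phi>' (a, b)" for x
    proof -
      obtain x0 where "x0 \<in> FO \<Phi> (a0, b0)" "x = \<beta> a0 b0 x0" using X[of a0 b0 x] x o by blast
      then show ?thesis using o m by (simp add: nat[symmetric] X' profunctor_app[OF \<Phi>])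
    qed
    then show "FM \<Phi>' (a, b) (a', b') (f, g) \<in> FO \<Phi>' (a, b) \<rightarrow>\<^sub>E FO \<Phi>' (a', b')"
      using ext by (auto simp: PiE_def)
  }
  {
    fix a b x assume *: "a \<in> Obj A'" "b \<in> Obj B'" "x \<in> FO \<Phi>' (a, b)"
    obtain a0 b0 where o: "a = FO J a0" "a0 \<in> Obj A" "b = FO K b0" "b0 \<in> Obj B" using * JO KO by meson
    obtain x0 where x: "x0 \<in> FO \<Phi> (a0, b0)" "x = \<beta> a0 b0 x0" using * X o by blast
    show "FM \<Phi>' (a, b) (a, b) (Idn A' a, Idn B' b) x = x"
      using nat[of a0 b0 a0 b0 "Idn A a0" "Idn B b0" x0] o x
      by (simp add: functor_id[OF JF] functor_id[OF KF] category_id cat profunctor_id[OF \<Phi>])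
  }
  {
    fix a b a' b' a'' b'' f g f' g' x
    assume *: "a \<in> Obj A'" "b \<in> Obj B'" "a' \<in> Obj A'" "b' \<in> Obj B'" "a'' \<in> Obj A'" "b'' \<in> Obj B'"
      "f \<in> Hom A' a a'" "g \<in> Hom B' b' b" "f' \<in> Hom A' a' a''" "g' \<in> Hom B' b'' b'" "x \<in> FO \<Phi>' (a, b)"
    obtain a0 b0 a1 b1 where o: "a = FO J a0" "a0 \<in> Obj A" "b = FO K b0" "b0 \<in> Obj B"
      "a' = FO J a1" "a1 \<in> Obj A" "b' = FO K b1" "b1 \<in> Obj B"
      using * JO KO by meson
    obtain a2 b2 where o2: "a'' = FO J a2" "a2 \<in> Obj A" "b'' = FO K b2" "b2 \<in> Obj B"
      using * JO KO by meson
    obtain f0 g0 where m: "f = FM J a0 a1 f0" "f0 \<in> Hom A a0 a1" "g = FM K b1 b0 g0" "g0 \<in> Hom B b1 b0"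
      using JM[of a0 a1 f] KM[of b1 b0 g] o * by blast
    obtain f1 g1 where m1: "f' = FM J a1 a2 f1" "f1 \<in> Hom A a1 a2" "g' = FM K b2 b1 g1" "g1 \<in> Hom B b2 b1"
      using JM[of a1 a2 f'] KM[of b2 b1 g'] o o2 * by blast
    obtain x0 where x: "x0 \<in> FO \<Phi> (a0, b0)" "x = \<beta> a0 b0 x0" using * X o by blast
    note c = functor_comp[OF JF, of a0 a1 a2 f0 f1, symmetric] functor_comp[OF KF, of b2 b1 b0 g1 g0, symmetric]
    show "FM \<Phi>' (a, b) (a'', b'') (Cmp A' a a' a'' f' f, Cmp B' b'' b' b g g') x =
      FM \<Phi>' (a', b') (a'', b'') (f', g') (FM \<Phi>' (a, b) (a', b') (f, g) x)"
      using o o2 m m1 x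
      by (simp add: c category_comp cat nat[symmetric] profunctor_app[OF \<Phi>] profunctor_comp[OF \<Phi>])
  }
qed

lemma nat_isoI_prof:
  assumes "profunctor A B \<Phi>" "profunctor A B \<Phi>'" and \<alpha>: "prof_iso A B \<Phi> \<Phi>' id_ftr id_ftr \<alpha>"
  shows "nat_iso (prod_cat A (op_cat B)) \<Phi> \<Phi>' (\<lambda>(a, b). \<alpha> a b)"
  using assms(1,2) prof_iso_bij[OF \<alpha>] prof_iso_nat[OF \<alpha>] prof_iso_app[OF \<alpha>]
  by (auto simp: nat_iso_def nat_trans_def profunctor_def)


section \<open>Coends\<close>

abbreviation coend_dom :: "('o, 'm) cat \<Rightarrow> ('o \<times> 'o, 'm \<times> 'm, 'x) sftr \<Rightarrow> ('o \<times> 'x) set" where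
  "coend_dom A F \<equiv> SIGMA a:Obj A. FO F (a, a)"

lemma coend_cls_self: "p \<in> coend_cls A F p"
  by (simp add: coend_cls_def coend_rel_def)

lemma coend_cls_in: "p \<in> coend_dom A F \<Longrightarrow> coend_cls A F p \<in> coend A F"
  unfolding coend_def coend_cls_def by (rule quotientI)

lemma coendE:
  assumes "c \<in> coend A F"
  obtains p where "p \<in> coend_dom A F" "c = coend_cls A F p"
  using assms unfolding coend_def coend_cls_def by (rule quotientE)

lemma coend_cls_gen:
  assumes "(p, q) \<in> coend_gen A F"
  shows "coend_cls A F p = coend_cls A F q"
proof -
  have "trans (coend_rel A F)" "(p, q) \<in> coend_rel A F" "(q, p) \<in> coend_rel A F"
    using assms by (auto simp: coend_rel_def trans_rtrancl)
  then show ?thesis unfolding coend_cls_def by (auto elim: transE)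
qed

text \<open>
  The universal property of the coend: a function that agrees on the two sides of each generating
  pair factors through the classes.  The union plays the role of the choice of a representative.
\<close>

lemma coend_lift:
  assumes "\<And>p q. (p, q) \<in> coend_gen A F \<Longrightarrow> T p = T q"
  shows "(\<Union>p\<in>coend_cls A F p0. T p) = T p0"
proof -
  have "T p = T p0" if "(p0, p) \<in> coend_rel A F" for p
    using that unfolding coend_rel_def
    by (induction rule: rtrancl_induct) (auto dest: assms)
  then show ?thesis
    using coend_cls_self[of p0 A F] unfolding coend_cls_def by blast
qed

lemma coend_map_cls:
  assumes "\<And>p q. (p, q) \<in> coend_gen A F \<Longrightarrow> coend_cls B G (\<tau> p) = coend_cls B G (\<tau> q)"
  shows "coend_map B G \<tau> (coend_cls A F p) = coend_cls B G (\<tau> p)"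
  unfolding coend_map_def by (rule coend_lift) (rule assms)

text \<open>
  The inverse of \<open>\<sigma>\<close> respects generating pairs as well, so that both descend to the coends.  The members
  of generating pairs have to lie in the domain, since \<open>\<sigma>\<close> is invertible only there.
\<close>

lemma coend_map_bij:
  assumes bij: "bij_betw \<sigma> (coend_dom A F) (coend_dom B G)"
    and gen: "coend_gen A F \<subseteq> coend_dom A F \<times> coend_dom A F"
    and gen': "coend_gen B G = map_prod \<sigma> \<sigma> ` coend_gen A F"
  shows "coend_map B G \<sigma> (coend_cls A F p) = coend_cls B G (\<sigma> p)"
    and "bij_betw (coend_map B G \<sigma>) (coend A F) (coend B G)"
proof -
  show m: "coend_map B G \<sigma> (coend_cls A F p) = coend_cls B G (\<sigma> p)" for p
    by (rule coend_map_cls, rule coend_cls_gen) (force simp: gen')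
  define \<rho> where "\<rho> = inv_into (coend_dom A F) \<sigma>"
  have \<rho>: "\<rho> (\<sigma> p) = p" if "p \<in> coend_dom A F" for p
    unfolding \<rho>_def using bij that by (rule bij_betw_inv_into_left)
  have m': "coend_map A F \<rho> (coend_cls B G p) = coend_cls A F (\<rho> p)" for p
  proof (rule coend_map_cls)
    fix p q assume "(p, q) \<in> coend_gen B G"
    then obtain p' q' where *: "p = \<sigma> p'" "q = \<sigma> q'" "(p', q') \<in> coend_gen A F" by (auto simp: gen')
    moreover have "p' \<in> coend_dom A F" "q' \<in> coend_dom A F" using *(3) gen by blast+
    ultimately show "coend_cls A F (\<rho> p) = coend_cls A F (\<rho> q)" by (simp only: \<rho> coend_cls_gen)
  qed
  have \<sigma>: "\<sigma> p \<in> coend_dom B G" if "p \<in> coend_dom A F" for p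
    using bij that by (rule bij_betw_apply)
  have inv: "coend_map A F \<rho> (coend_map B G \<sigma> c) = c" if c: "c \<in> coend A F" for c
    using c by (rule coendE) (simp only: m m' \<rho>)
  show "bij_betw (coend_map B G \<sigma>) (coend A F) (coend B G)"
    unfolding bij_betw_def
  proof
    show "inj_on (coend_map B G \<sigma>) (coend A F)"
      using inv by (rule inj_on_inverseI)
    show "coend_map B G \<sigma> ` coend A F = coend B G"
    proof
      show "coend_map B G \<sigma> ` coend A F \<subseteq> coend B G"
      proof
        fix c assume "c \<in> coend_map B G \<sigma> ` coend A F"
        then obtain c' where c': "c' \<in> coend A F" "c = coend_map B G \<sigma> c'" by blast
        from c'(1) obtain p where "p \<in> coend_dom A F" "c' = coend_cls A F p" by (rule coendE)
        then show "c \<in> coend B G" unfolding c' by (simp only: m coend_cls_in \<sigma>)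
      qed
      show "coend B G \<subseteq> coend_map B G \<sigma> ` coend A F"
      proof
        fix c assume "c \<in> coend B G"
        then obtain q where q: "q \<in> coend_dom B G" "c = coend_cls B G q" by (rule coendE)
        then obtain p where p: "p \<in> coend_dom A F" "q = \<sigma> p"
          using bij unfolding bij_betw_def by blast
        show "c \<in> coend_map B G \<sigma> ` coend A F"
          using coend_cls_in[OF p(1)] by (rule rev_image_eqI) (simp only: m q p)
      qed
    qed
  qed
qed


text \<open>
  The inverse direction needs that \<open>K\<close> is surjective on objects and morphisms, and each \<open>s a b\<close> on
  elements: then every generating pair of \<open>F'\<close> is the image of one of \<open>F\<close>.
\<close>

lemma coend_map_iso:
  assumes C: "category C" and K: "cat_iso C C' K"
    and bij: "\<forall>a\<in>Obj C. \<forall>b\<in>Obj C. bij_betw (s a b) (FO F (a, b)) (FO F' (FO K a, FO K b))"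
    and app: "\<forall>a\<in>Obj C. \<forall>b\<in>Obj C. \<forall>a'\<in>Obj C. \<forall>b'\<in>Obj C. \<forall>u\<in>Hom C a' a. \<forall>v\<in>Hom C b b'. \<forall>x\<in>FO F (a, b).
      FM F (a, b) (a', b') (u, v) x \<in> FO F (a', b')"
    and nat: "\<forall>a\<in>Obj C. \<forall>b\<in>Obj C. \<forall>a'\<in>Obj C. \<forall>b'\<in>Obj C. \<forall>u\<in>Hom C a' a. \<forall>v\<in>Hom C b b'. \<forall>x\<in>FO F (a, b).
      s a' b' (FM F (a, b) (a', b') (u, v) x) =
      FM F' (FO K a, FO K b) (FO K a', FO K b') (FM K a' a u, FM K b b' v) (s a b x)"
    and \<sigma>: "\<And>a x. \<sigma> (a, x) = (FO K a, s a a x)"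
  shows "coend_gen C F \<subseteq> coend_dom C F \<times> coend_dom C F"
    and "coend_gen C' F' = map_prod \<sigma> \<sigma> ` coend_gen C F"
    and "coend_map C' F' \<sigma> (coend_cls C F p) = coend_cls C' F' (\<sigma> p)"
    and "bij_betw (coend_map C' F' \<sigma>) (coend C F) (coend C' F')"
proof -
  have KF: "is_functor C C' K" and Kinj: "inj_on (FO K) (Obj C)" and Ksurj: "FO K ` Obj C = Obj C'"
    and Kfull: "\<And>a b. a \<in> Obj C \<Longrightarrow> b \<in> Obj C \<Longrightarrow> FM K a b ` Hom C a b = Hom C' (FO K a) (FO K b)"
    using K by (auto simp: cat_iso_def bij_betw_def)
  have simg: "s a b ` FO F (a, b) = FO F' (FO K a, FO K b)" and sinj: "inj_on (s a b) (FO F (a, b))"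
    if "a \<in> Obj C" "b \<in> Obj C" for a b
    using bij that by (simp_all add: bij_betw_def)
  show dom: "coend_gen C F \<subseteq> coend_dom C F \<times> coend_dom C F"
    unfolding coend_gen_def by (auto intro!: app[rule_format] category_id C)
  have \<sigma>gen: "map_prod \<sigma> \<sigma> ((a, FM F (b, a) (a, a) (f, Idn C a) x), (b, FM F (b, a) (b, b) (Idn C b, f) x)) =
      ((FO K a, FM F' (FO K b, FO K a) (FO K a, FO K a) (FM K a b f, Idn C' (FO K a)) (s b a x)),
       (FO K b, FM F' (FO K b, FO K a) (FO K b, FO K b) (Idn C' (FO K b), FM K a b f) (s b a x)))"
    if "a \<in> Obj C" "b \<in> Obj C" "f \<in> Hom C a b" "x \<in> FO F (b, a)" for a b f x
    using that by (simp add: \<sigma> nat category_id[OF C] functor_id[OF KF])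
  show gen: "coend_gen C' F' = map_prod \<sigma> \<sigma> ` coend_gen C F"
  proof (intro equalityI subsetI)
    fix r assume "r \<in> coend_gen C' F'"
    then obtain a' b' f' x' where r: "r = ((a', FM F' (b', a') (a', a') (f', Idn C' a') x'), (b', FM F' (b', a') (b', b') (Idn C' b', f') x'))"
      "a' \<in> Obj C'" "b' \<in> Obj C'" "f' \<in> Hom C' a' b'" "x' \<in> FO F' (b', a')"
      unfolding coend_gen_def by blast
    obtain a b where ab: "a \<in> Obj C" "a' = FO K a" "b \<in> Obj C" "b' = FO K b" using r Ksurj by blast
    obtain f where f: "f \<in> Hom C a b" "f' = FM K a b f" using Kfull[of a b] ab r by blast
    obtain x where x: "x \<in> FO F (b, a)" "x' = s b a x" using simg[of b a] ab r by blast
    show "r \<in> map_prod \<sigma> \<sigma> ` coend_gen C F"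
      using \<sigma>gen[OF ab(1,3) f(1) x(1)] ab f x unfolding r(1) coend_gen_def
      by (intro image_eqI[where x = "((a, FM F (b, a) (a, a) (f, Idn C a) x), (b, FM F (b, a) (b, b) (Idn C b, f) x))"]) auto
  next
    fix r assume "r \<in> map_prod \<sigma> \<sigma> ` coend_gen C F"
    then obtain r0 where r: "r = map_prod \<sigma> \<sigma> r0" "r0 \<in> coend_gen C F" by (rule imageE)
    obtain a b f x where *: "r0 = ((a, FM F (b, a) (a, a) (f, Idn C a) x), (b, FM F (b, a) (b, b) (Idn C b, f) x))"
      "a \<in> Obj C" "b \<in> Obj C" "f \<in> Hom C a b" "x \<in> FO F (b, a)"
      using r(2) unfolding coend_gen_def by blast
    have "FO K a \<in> Obj C'" "FO K b \<in> Obj C'" "FM K a b f \<in> Hom C' (FO K a) (FO K b)" "s b a x \<in> FO F' (FO K b, FO K a)"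
      using * simg[of b a] by (auto intro: functor_ob[OF KF] functor_mor[OF KF])
    then show "r \<in> coend_gen C' F'"
      unfolding r(1) *(1) \<sigma>gen[OF *(2-5)] coend_gen_def by blast
  qed
  have "bij_betw \<sigma> (coend_dom C F) (coend_dom C' F')"
    unfolding bij_betw_def
  proof
    show "inj_on \<sigma> (coend_dom C F)"
    proof (rule inj_onI)
      fix p q assume pq: "p \<in> coend_dom C F" "q \<in> coend_dom C F" "\<sigma> p = \<sigma> q"
      obtain a x b y where e: "p = (a, x)" "q = (b, y)" by (metis surj_pair)
      show "p = q" using pq inj_onD[OF Kinj, of a b] inj_onD[OF sinj[of a a], of x y] by (simp add: e \<sigma>)
    qed
    show "\<sigma> ` coend_dom C F = coend_dom C' F'"
    proof (intro equalityI subsetI)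
      fix q assume "q \<in> coend_dom C' F'"
      then obtain a' x' where q: "q = (a', x')" "a' \<in> Obj C'" "x' \<in> FO F' (a', a')" by auto
      obtain a where a: "a \<in> Obj C" "a' = FO K a" using q Ksurj by blast
      obtain x where x: "x \<in> FO F (a, a)" "x' = s a a x" using simg[of a a] a q by blast
      show "q \<in> \<sigma> ` coend_dom C F" by (rule image_eqI[of _ _ "(a, x)"]) (use q a x in \<open>simp_all add: \<sigma>\<close>)
    qed (use bij_betw_apply[OF bij[rule_format]] functor_ob[OF KF] in \<open>auto simp: \<sigma>\<close>)
  qed
  note cm = coend_map_bij[OF this dom gen]
  show "coend_map C' F' \<sigma> (coend_cls C F p) = coend_cls C' F' (\<sigma> p)" by (rule cm(1))
  show "bij_betw (coend_map C' F' \<sigma>) (coend C F) (coend C' F')" by (rule cm(2))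
qed


section \<open>Composition of profunctors\<close>

lemma prof_comp_int_dom:
  "coend_dom B (prof_comp_int A D \<Psi> \<Phi> (a, d)) = (SIGMA b:Obj B. FO \<Psi> (b, d) \<times> FO \<Phi> (a, b))"
  by (simp add: prof_comp_int_def)

text \<open>The generating pairs, with the identity morphisms removed.\<close>

lemma prof_comp_gen:
  assumes "category A" "category B" "category D" and \<Phi>: "profunctor A B \<Phi>" and \<Psi>: "profunctor B D \<Psi>"
    and "a \<in> Obj A" "d \<in> Obj D"
  shows "coend_gen B (prof_comp_int A D \<Psi> \<Phi> (a, d)) =
    {((b, y, FM \<Phi> (a, b') (a, b) (Idn A a, u) x), (b', FM \<Psi> (b, d) (b', d) (u, Idn D d) y, x)) | b b' u y x.
      b \<in> Obj B \<and> b' \<in> Obj B \<and> u \<in> Hom B b b' \<and> y \<in> FO \<Psi> (b, d) \<and> x \<in> FO \<Phi> (a, b')}" (is "_ = ?R")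
proof -
  have "\<And>y b. b \<in> Obj B \<Longrightarrow> y \<in> FO \<Psi> (b, d) \<Longrightarrow> FM \<Psi> (b, d) (b, d) (Idn B b, Idn D d) y = y"
    "\<And>x b. b \<in> Obj B \<Longrightarrow> x \<in> FO \<Phi> (a, b) \<Longrightarrow> FM \<Phi> (a, b) (a, b) (Idn A a, Idn B b) x = x"
    using assms by (auto simp: profunctor_id)
  note id = this
  have "coend_gen B (prof_comp_int A D \<Psi> \<Phi> (a, d)) =
    {((b, FM \<Psi> (b, d) (b, d) (Idn B b, Idn D d) y, FM \<Phi> (a, b') (a, b) (Idn A a, u) x),
      (b', FM \<Psi> (b, d) (b', d) (u, Idn D d) y, FM \<Phi> (a, b') (a, b') (Idn A a, Idn B b') x)) | b b' u y x.
      b \<in> Obj B \<and> b' \<in> Obj B \<and> u \<in> Hom B b b' \<and> y \<in> FO \<Psi> (b, d) \<and> x \<in> FO \<Phi> (a, b')}"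
    (is "?L = {?P b b' u y x | b b' u y x. ?Q b b' u y x}")
  proof (intro equalityI subsetI)
    fix r assume "r \<in> ?L"
    then obtain b b' u y x where "?Q b b' u y x" "r = ?P b b' u y x"
      unfolding coend_gen_def prof_comp_int_def by auto
    then show "r \<in> {?P b b' u y x | b b' u y x. ?Q b b' u y x}" by blast
  next
    fix r assume "r \<in> {?P b b' u y x | b b' u y x. ?Q b b' u y x}"
    then obtain b b' u y x where "?Q b b' u y x" "r = ?P b b' u y x" by blast
    then show "r \<in> ?L"
      unfolding coend_gen_def prof_comp_int_def
      by (simp, intro exI[of _ u] exI[of _ y] exI[of _ x]) simp
  qed
  also have "\<dots> = ?R"
    by (rule Collect_cong, intro ex_cong1) (auto simp: id)
  finally show ?thesis .
qed

lemma prof_comp_balance: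
  assumes "category A" "category B" "category D" "profunctor A B \<Phi>" "profunctor B D \<Psi>"
    and "a \<in> Obj A" "d \<in> Obj D" "b \<in> Obj B" "b' \<in> Obj B" "u \<in> Hom B b b'" "y \<in> FO \<Psi> (b, d)" "x \<in> FO \<Phi> (a, b')"
  shows "prof_comp_el A B D \<Psi> \<Phi> (a, d) b y (FM \<Phi> (a, b') (a, b) (Idn A a, u) x) =
    prof_comp_el A B D \<Psi> \<Phi> (a, d) b' (FM \<Psi> (b, d) (b', d) (u, Idn D d) y) x"
  unfolding prof_comp_el_def by (rule coend_cls_gen, subst prof_comp_gen) (use assms in blast)+

lemma prof_comp_el_in:
  "b \<in> Obj B \<Longrightarrow> y \<in> FO \<Psi> (b, d) \<Longrightarrow> x \<in> FO \<Phi> (a, b) \<Longrightarrow>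
   prof_comp_el A B D \<Psi> \<Phi> (a, d) b y x \<in> FO (prof_comp A B D \<Psi> \<Phi>) (a, d)"
  by (simp add: prof_comp_el_def prof_comp_def, rule coend_cls_in) (simp add: prof_comp_int_def)

lemma prof_compE:
  assumes "w \<in> FO (prof_comp A B D \<Psi> \<Phi>) (a, d)"
  obtains b y x where "b \<in> Obj B" "y \<in> FO \<Psi> (b, d)" "x \<in> FO \<Phi> (a, b)" "w = prof_comp_el A B D \<Psi> \<Phi> (a, d) b y x"
proof -
  have "w \<in> coend B (prof_comp_int A D \<Psi> \<Phi> (a, d))" using assms by (simp add: prof_comp_def)
  then show thesis
    by (rule coendE) (auto simp: prof_comp_int_dom prof_comp_el_def intro: that)
qed

lemma prof_comp_FM:
  assumes cat: "category A" "category B" "category D" and \<Phi>: "profunctor A B \<Phi>" and \<Psi>: "profunctor B D \<Psi>"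
    and o: "a \<in> Obj A" "d \<in> Obj D" "a' \<in> Obj A" "d' \<in> Obj D" "f \<in> Hom A a a'" "g \<in> Hom D d' d"
    and el: "b \<in> Obj B" "y \<in> FO \<Psi> (b, d)" "x \<in> FO \<Phi> (a, b)"
  shows "FM (prof_comp A B D \<Psi> \<Phi>) (a, d) (a', d') (f, g) (prof_comp_el A B D \<Psi> \<Phi> (a, d) b y x) =
    prof_comp_el A B D \<Psi> \<Phi> (a', d') b (FM \<Psi> (b, d) (b, d') (Idn B b, g) y) (FM \<Phi> (a, b) (a', b) (f, Idn B b) x)"
proof -
  let ?\<tau> = "\<lambda>(b, y, x). (b, FM \<Psi> (b, d) (b, d') (Idn B b, g) y, FM \<Phi> (a, b) (a', b) (f, Idn B b) x)"
  let ?C = "coend_cls B (prof_comp_int A D \<Psi> \<Phi> (a', d'))"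
  have "coend_map B (prof_comp_int A D \<Psi> \<Phi> (a', d')) ?\<tau>
      (coend_cls B (prof_comp_int A D \<Psi> \<Phi> (a, d)) (b, y, x)) = ?C (?\<tau> (b, y, x))"
  proof (rule coend_map_cls)
    fix p q assume "(p, q) \<in> coend_gen B (prof_comp_int A D \<Psi> \<Phi> (a, d))"
    then obtain b b' u y x where pq: "p = (b, y, FM \<Phi> (a, b') (a, b) (Idn A a, u) x)"
      "q = (b', FM \<Psi> (b, d) (b', d) (u, Idn D d) y, x)" and
      *: "b \<in> Obj B" "b' \<in> Obj B" "u \<in> Hom B b b'" "y \<in> FO \<Psi> (b, d)" "x \<in> FO \<Phi> (a, b')"
      unfolding prof_comp_gen[OF cat \<Phi> \<Psi> o(1,2)] by blast
    let ?y = "FM \<Psi> (b, d) (b, d') (Idn B b, g) y" and ?x = "FM \<Phi> (a, b') (a', b') (f, Idn B b') x"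
    have "?\<tau> p = (b, ?y, FM \<Phi> (a', b') (a', b) (Idn A a', u) ?x)"
      using * o cat by (simp add: pq category_id profunctor_comp[OF \<Phi>] category_idl category_idr)
    moreover have "?\<tau> q = (b', FM \<Psi> (b, d') (b', d') (u, Idn D d') ?y, ?x)"
      using * o cat by (simp add: pq category_id profunctor_comp[OF \<Psi>] category_idl category_idr)
    moreover have "?y \<in> FO \<Psi> (b, d')" "?x \<in> FO \<Phi> (a', b')"
      using * o cat by (auto intro!: profunctor_app[OF \<Phi>] profunctor_app[OF \<Psi>] category_id)
    ultimately show "?C (?\<tau> p) = ?C (?\<tau> q)"
      using prof_comp_balance[OF cat \<Phi> \<Psi>, of a' d' b b' u ?y ?x] * o by (simp only: prof_comp_el_def)
  qed
  then show ?thesis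
    using prof_comp_el_in[of b B y \<Psi> d x \<Phi> a A D] el
    by (simp add: prof_comp_def prof_comp_el_def)
qed

lemma profunctor_prof_comp:
  assumes cat: "category A" "category B" "category D" and \<Phi>: "profunctor A B \<Phi>" and \<Psi>: "profunctor B D \<Psi>"
  shows "profunctor A D (prof_comp A B D \<Psi> \<Phi>)"
proof (rule profunctorI)
  fix a d a' d' f g
  assume *: "a \<in> Obj A" "d \<in> Obj D" "a' \<in> Obj A" "d' \<in> Obj D" "f \<in> Hom A a a'" "g \<in> Hom D d' d"
  have "FM (prof_comp A B D \<Psi> \<Phi>) (a, d) (a', d') (f, g) w \<in> FO (prof_comp A B D \<Psi> \<Phi>) (a', d')"
    if "w \<in> FO (prof_comp A B D \<Psi> \<Phi>) (a, d)" for w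
    using that
    by (rule prof_compE)
      (use * cat in \<open>auto simp: prof_comp_FM[OF cat \<Phi> \<Psi>] category_id
          intro!: prof_comp_el_in profunctor_app[OF \<Phi>] profunctor_app[OF \<Psi>]\<close>)
  moreover have "FM (prof_comp A B D \<Psi> \<Phi>) (a, d) (a', d') (f, g) \<in> extensional (FO (prof_comp A B D \<Psi> \<Phi>) (a, d))"
    by (simp add: prof_comp_def)
  ultimately show "FM (prof_comp A B D \<Psi> \<Phi>) (a, d) (a', d') (f, g) \<in>
      FO (prof_comp A B D \<Psi> \<Phi>) (a, d) \<rightarrow>\<^sub>E FO (prof_comp A B D \<Psi> \<Phi>) (a', d')"
    by (auto simp: PiE_def)
next
  fix a d w assume *: "a \<in> Obj A" "d \<in> Obj D" "w \<in> FO (prof_comp A B D \<Psi> \<Phi>) (a, d)"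
  from *(3) show "FM (prof_comp A B D \<Psi> \<Phi>) (a, d) (a, d) (Idn A a, Idn D d) w = w"
    by (rule prof_compE)
      (use * cat in \<open>simp add: prof_comp_FM[OF cat \<Phi> \<Psi>] category_id profunctor_id[OF \<Phi>] profunctor_id[OF \<Psi>]\<close>)
next
  fix a d a' d' a'' d'' f g f' g' w
  assume *: "a \<in> Obj A" "d \<in> Obj D" "a' \<in> Obj A" "d' \<in> Obj D" "a'' \<in> Obj A" "d'' \<in> Obj D"
    "f \<in> Hom A a a'" "g \<in> Hom D d' d" "f' \<in> Hom A a' a''" "g' \<in> Hom D d'' d'"
    "w \<in> FO (prof_comp A B D \<Psi> \<Phi>) (a, d)"
  from *(11) show "FM (prof_comp A B D \<Psi> \<Phi>) (a, d) (a'', d'') (Cmp A a a' a'' f' f, Cmp D d'' d' d g g') w =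
      FM (prof_comp A B D \<Psi> \<Phi>) (a', d') (a'', d'') (f', g') (FM (prof_comp A B D \<Psi> \<Phi>) (a, d) (a', d') (f, g) w)"
    by (rule prof_compE)
      (use * cat in \<open>simp add: prof_comp_FM[OF cat \<Phi> \<Psi>] category_id category_comp category_idl
         profunctor_app[OF \<Phi>] profunctor_app[OF \<Psi>] profunctor_comp[OF \<Phi>] profunctor_comp[OF \<Psi>]\<close>)
qed fact+

text \<open>
  By means of \<open>\<beta>\<close>, an isomorphism \<open>K\<close> of the middle categories turns the integrand of the one composite into
  that of the other, so that \<open>coend_map_iso\<close> applies.
\<close>

lemma prof_comp_iso:
  fixes \<Phi> :: "('o, 'm, 'p, 'n, 'x) prof" and \<Psi> :: "('p, 'n, 'q, 'k, 'y) prof"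
    and \<Phi>' :: "('o1, 'm1, 'p1, 'n1, 'x1) prof" and \<Psi>' :: "('p1, 'n1, 'q, 'k, 'y) prof"
  assumes cat: "category A" "category B" "category D" "category A'" "category B'"
    and \<Phi>: "profunctor A B \<Phi>" and \<Psi>: "profunctor B D \<Psi>"
    and \<Phi>': "profunctor A' B' \<Phi>'" and \<Psi>': "profunctor B' D \<Psi>'"
    and J: "is_functor A A' J" and K: "cat_iso B B' K"
    and \<beta>: "prof_iso A B \<Phi> \<Phi>' J K \<beta>"
    and \<Psi>O: "\<And>b d. FO \<Psi> (b, d) = FO \<Psi>' (FO K b, d)"
    and \<Psi>M: "\<And>b d b' d' u v. FM \<Psi> (b, d) (b', d') (u, v) = FM \<Psi>' (FO K b, d) (FO K b', d') (FM K b b' u, v)"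
    and \<alpha>_def: "\<And>a d. \<alpha> a d =
      coend_map B' (prof_comp_int A' D \<Psi>' \<Phi>' (FO J a, d)) (\<lambda>(b, y, x). (FO K b, y, \<beta> a b x))"
  shows "a \<in> Obj A \<Longrightarrow> d \<in> Obj D \<Longrightarrow>
      \<alpha> a d (prof_comp_el A B D \<Psi> \<Phi> (a, d) b y x) =
      prof_comp_el A' B' D \<Psi>' \<Phi>' (FO J a, d) (FO K b) y (\<beta> a b x)"
    and "prof_iso A D (prof_comp A B D \<Psi> \<Phi>) (prof_comp A' B' D \<Psi>' \<Phi>') J id_ftr \<alpha>"
proof -
  have KF: "is_functor B B' K" using K by (simp add: cat_iso_def)
  have \<beta>in: "\<beta> a b x \<in> FO \<Phi>' (FO J a, FO K b)" if "a \<in> Obj A" "b \<in> Obj B" "x \<in> FO \<Phi> (a, b)" for a b x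
    using prof_iso_app[OF \<beta> that] .
  {
    fix a d assume ad: "a \<in> Obj A" "d \<in> Obj D"
    let ?F = "prof_comp_int A D \<Psi> \<Phi> (a, d)" and ?G = "prof_comp_int A' D \<Psi>' \<Phi>' (FO J a, d)"
    have ids: "Idn A a \<in> Hom A a a" "Idn D d \<in> Hom D d d" using ad cat by (simp_all add: category_id)
    have b: "\<forall>b\<in>Obj B. \<forall>c\<in>Obj B. bij_betw (map_prod id (\<beta> a b)) (FO ?F (b, c)) (FO ?G (FO K b, FO K c))"
    proof (intro ballI)
      fix b c assume "b \<in> Obj B" "c \<in> Obj B"
      then have "bij_betw (\<beta> a b) (FO \<Phi> (a, b)) (FO \<Phi>' (FO J a, FO K b))" using prof_iso_bij[OF \<beta>] ad by blast
      then show "bij_betw (map_prod id (\<beta> a b)) (FO ?F (b, c)) (FO ?G (FO K b, FO K c))"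
        unfolding bij_betw_def by (simp add: prof_comp_int_def \<Psi>O map_prod_inj_on map_prod_surj_on)
    qed
    have app: "\<forall>b\<in>Obj B. \<forall>c\<in>Obj B. \<forall>b'\<in>Obj B. \<forall>c'\<in>Obj B. \<forall>u\<in>Hom B b' b. \<forall>v\<in>Hom B c c'. \<forall>p\<in>FO ?F (b, c).
      FM ?F (b, c) (b', c') (u, v) p \<in> FO ?F (b', c')"
      using ad ids by (auto simp: prof_comp_int_def intro!: profunctor_app[OF \<Phi>] profunctor_app[OF \<Psi>])
    have n: "\<forall>b\<in>Obj B. \<forall>c\<in>Obj B. \<forall>b'\<in>Obj B. \<forall>c'\<in>Obj B. \<forall>u\<in>Hom B b' b. \<forall>v\<in>Hom B c c'. \<forall>p\<in>FO ?F (b, c).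
      map_prod id (\<beta> a b') (FM ?F (b, c) (b', c') (u, v) p) =
        FM ?G (FO K b, FO K c) (FO K b', FO K c') (FM K b' b u, FM K c c' v) (map_prod id (\<beta> a b) p)"
      using ad ids prof_iso_nat[OF \<beta>] \<beta>in by (auto simp: prof_comp_int_def \<Psi>O \<Psi>M functor_id[OF J])
    have \<sigma>: "(\<lambda>(b, y, x). (FO K b, y, \<beta> a b x)) (c, p) = (FO K c, map_prod id (\<beta> a c) p)" for c p
      by (cases p) simp
    note cm = coend_map_iso[where \<sigma> = "\<lambda>(b, y, x). (FO K b, y, \<beta> a b x)", OF cat(2) K b app n \<sigma>]
    have el: "\<alpha> a d (prof_comp_el A B D \<Psi> \<Phi> (a, d) b y x) =
      prof_comp_el A' B' D \<Psi>' \<Phi>' (FO J a, d) (FO K b) y (\<beta> a b x)" for b y x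
      unfolding \<alpha>_def prof_comp_el_def using cm(3)[of "(b, y, x)"] by simp
    have "bij_betw (\<alpha> a d) (FO (prof_comp A B D \<Psi> \<Phi>) (a, d)) (FO (prof_comp A' B' D \<Psi>' \<Phi>') (FO J a, d))"
      unfolding \<alpha>_def using cm(4) by (simp add: prof_comp_def)
    note el this
  } note el = this(1) and bij' = this(2)
  show "a \<in> Obj A \<Longrightarrow> d \<in> Obj D \<Longrightarrow>
      \<alpha> a d (prof_comp_el A B D \<Psi> \<Phi> (a, d) b y x) =
      prof_comp_el A' B' D \<Psi>' \<Phi>' (FO J a, d) (FO K b) y (\<beta> a b x)"
    by (rule el)
  show "prof_iso A D (prof_comp A B D \<Psi> \<Phi>) (prof_comp A' B' D \<Psi>' \<Phi>') J id_ftr \<alpha>"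
    unfolding prof_iso_def id_ftr_sel
  proof (intro conjI ballI)
    fix a d assume "a \<in> Obj A" "d \<in> Obj D"
    then show "bij_betw (\<alpha> a d) (FO (prof_comp A B D \<Psi> \<Phi>) (a, d)) (FO (prof_comp A' B' D \<Psi>' \<Phi>') (FO J a, d))"
      by (rule bij')
  next
    fix a d a' d' f g w
    assume *: "a \<in> Obj A" "d \<in> Obj D" "a' \<in> Obj A" "d' \<in> Obj D" "f \<in> Hom A a a'" "g \<in> Hom D d' d"
      "w \<in> FO (prof_comp A B D \<Psi> \<Phi>) (a, d)"
    from *(7) obtain b y x where w: "b \<in> Obj B" "y \<in> FO \<Psi> (b, d)" "x \<in> FO \<Phi> (a, b)"
      "w = prof_comp_el A B D \<Psi> \<Phi> (a, d) b y x"
      by (rule prof_compE)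
    show "\<alpha> a' d' (FM (prof_comp A B D \<Psi> \<Phi>) (a, d) (a', d') (f, g) w) =
        FM (prof_comp A' B' D \<Psi>' \<Phi>') (FO J a, d) (FO J a', d') (FM J a a' f, g) (\<alpha> a d w)"
    proof -
      have x': "\<beta> a b x \<in> FO \<Phi>' (FO J a, FO K b)" and y': "y \<in> FO \<Psi>' (FO K b, d)"
        using \<beta>in w *(1) \<Psi>O by auto
      have b': "FO K b \<in> Obj B'" and ob: "FO J a \<in> Obj A'" "FO J a' \<in> Obj A'"
        and f': "FM J a a' f \<in> Hom A' (FO J a) (FO J a')"
        using w * by (auto intro: functor_ob[OF J] functor_ob[OF KF] functor_mor[OF J])
      have "\<beta> a' b (FM \<Phi> (a, b) (a', b) (f, Idn B b) x) =
          FM \<Phi>' (FO J a, FO K b) (FO J a', FO K b) (FM J a a' f, Idn B' (FO K b)) (\<beta> a b x)"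
        using prof_iso_nat[OF \<beta>, of a b a' b f "Idn B b" x] * w cat by (simp add: category_id functor_id[OF KF])
      moreover have "FM \<Psi> (b, d) (b, d') (Idn B b, g) y = FM \<Psi>' (FO K b, d) (FO K b, d') (Idn B' (FO K b), g) y"
        using w by (simp add: \<Psi>M functor_id[OF KF])
      ultimately show ?thesis
        unfolding w(4) el[OF *(1,2)] prof_comp_FM[OF cat(1,2,3) \<Phi> \<Psi> *(1-6) w(1-3)] el[OF *(3,4)]
          prof_comp_FM[OF cat(4,5,3) \<Phi>' \<Psi>' ob(1) *(2) ob(2) *(4) f' *(6) b' y' x'] by simp
    qed
  qed
qed

section \<open>Concatenation and blocks of indices\<close>

abbreviation off :: "nat list \<Rightarrow> nat \<Rightarrow> nat" where
  "off ns i \<equiv> sum_list (take i ns)"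

lemma off_mono: "i \<le> j \<Longrightarrow> off ns i \<le> off ns j"
  by (metis le_add_diff_inverse le_add1 sum_list.append take_add)

lemma off_less:
  assumes "i < j" "i < length ns" "l < ns ! i"
  shows "off ns i + l < off ns j"
proof -
  have "off ns i + l < off ns (Suc i)" using assms by (simp add: take_Suc_conv_app_nth)
  also have "\<dots> \<le> off ns j" using assms by (intro off_mono) simp
  finally show ?thesis .
qed

lemma off_bound: "j < length ns \<Longrightarrow> l < ns ! j \<Longrightarrow> off ns j + l < sum_list ns"
  using off_less[of j "length ns" ns l] by simp

lemma off_index:
  "t < sum_list ns \<Longrightarrow> \<exists>j<length ns. \<exists>l<ns ! j. t = off ns j + l"
proof (induction ns arbitrary: t)
  case (Cons n ns)
  show ?case
  proof (cases "t < n")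
    case True
    then show ?thesis by (intro exI[of _ 0]) auto
  next
    case False
    then have "t - n < sum_list ns" using Cons.prems by auto
    then obtain j l where "j < length ns" "l < ns ! j" "t - n = off ns j + l"
      using Cons.IH by blast
    with False show ?thesis by (intro exI[of _ "Suc j"]) auto
  qed
qed simp

lemma off_inj:
  assumes "off ns j + l = off ns j' + l'" "j < length ns" "l < ns ! j" "j' < length ns" "l' < ns ! j'"
  shows "j = j'" "l = l'"
proof -
  show "j = j'"
    using assms off_less[of j j' ns l] off_less[of j' j ns l'] by (cases j j' rule: linorder_cases) auto
  with assms show "l = l'" by simp
qed

lemma off_le:
  assumes "off ns j + l \<le> off ns j' + l'" "j < length ns" "l < ns ! j" "j' < length ns" "l' < ns ! j'"
  shows "j < j' \<or> j = j' \<and> l \<le> l'"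
  using assms off_less[of j' j ns l'] by (cases j j' rule: linorder_cases) auto

lemma concat_nth_off:
  "j < length xss \<Longrightarrow> l < length (xss ! j) \<Longrightarrow> concat xss ! (off (map length xss) j + l) = xss ! j ! l"
  by (induction xss arbitrary: j) (auto simp: nth_append less_Suc_eq_0_disj add.assoc)

lemma length_concat_take: "length (concat (take i xss)) = off (map length xss) i"
  by (simp add: length_concat take_map)

lemma concat_index:
  assumes "t < length (concat xss)"
  shows "\<exists>j<length xss. \<exists>l<length (xss ! j). t = off (map length xss) j + l"
proof -
  have "t < sum_list (map length xss)" using assms by (simp add: length_concat)
  from off_index[OF this] obtain j l where
    "j < length xss" "l < map length xss ! j" "t = off (map length xss) j + l" by auto
  then show ?thesis by auto
qed

lemma concat_nth_eqI:
  assumes "length ts = sum_list ns" "length ts' = sum_list ns"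
    and "\<And>j l. j < length ns \<Longrightarrow> l < ns ! j \<Longrightarrow> ts ! (off ns j + l) = ts' ! (off ns j + l)"
  shows "ts = ts'"
  using assms off_index[of _ ns] by (intro nth_equalityI) (simp, metis)


section \<open>The classes of functions\<close>

lemma cls_less: "f \<in> cls X m n \<Longrightarrow> i < m \<Longrightarrow> f i < n"
  by (auto simp: cls_def)

lemma cls_cong:
  assumes "\<And>i. i < m \<Longrightarrow> f i = g i"
  shows "f \<in> cls X m n \<longleftrightarrow> g \<in> cls X m n"
proof -
  have "f \<in> {..<m} \<rightarrow> {..<n} \<longleftrightarrow> g \<in> {..<m} \<rightarrow> {..<n}" "(\<forall>i<m. f i = i) \<longleftrightarrow> (\<forall>i<m. g i = i)"
    using assms by (auto simp: Pi_iff)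
  moreover have "mono_on {..<m} f \<longleftrightarrow> mono_on {..<m} g"
    using assms by (auto simp: monotone_on_def)
  moreover have "inj_on f {..<m} \<longleftrightarrow> inj_on g {..<m}" "bij_betw f {..<m} {..<n} \<longleftrightarrow> bij_betw g {..<m} {..<n}"
    "f ` {..<m} = g ` {..<m}"
    using assms by (auto intro!: inj_on_cong bij_betw_cong image_cong)
  ultimately show ?thesis unfolding cls_def by simp
qed

lemma cls_id: "(\<And>i. i < m \<Longrightarrow> f i = i) \<Longrightarrow> f \<in> cls X m m"
  by (subst cls_cong[of m f "\<lambda>i. i"]) (auto simp: cls_def monotone_on_def bij_betw_def)

lemma cls_comp:
  assumes "f \<in> cls X m n" "g \<in> cls X l m"
  shows "(\<lambda>i. f (g i)) \<in> cls X l n"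
proof -
  have g: "g \<in> {..<l} \<rightarrow> {..<m}" "f \<in> {..<m} \<rightarrow> {..<n}" using assms by (auto simp: cls_def)
  have "mono_on {..<l} (\<lambda>i. f (g i))" if "mono_on {..<m} f" "mono_on {..<l} g"
    using that g unfolding monotone_on_def by (auto simp: Pi_iff)
  moreover have "inj_on (\<lambda>i. f (g i)) {..<l}" if "inj_on f {..<m}" "inj_on g {..<l}"
    using that g unfolding inj_on_def by (auto simp: Pi_iff)
  moreover have "bij_betw (\<lambda>i. f (g i)) {..<l} {..<n}" if "bij_betw f {..<m} {..<n}" "bij_betw g {..<l} {..<m}"
    using bij_betw_trans[OF that(2,1)] by (simp add: comp_def)
  moreover have "(\<lambda>i. f (g i)) ` {..<l} = {..<n}" if "f ` {..<m} = {..<n}" "g ` {..<l} = {..<m}"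
    using that by (auto simp: image_image[symmetric])
  ultimately show ?thesis using assms g unfolding cls_def by (auto simp: Pi_iff)
qed

text \<open>
  The reason is that distinct blocks are disjoint and ordered like their indices, so that injectivity and
  monotonicity can be checked on pairs of blocks.  Monotonicity of the glued function also needs that
  \<open>f\<close> is injective, as it is in the class for \<open>X = {\<epsilon>}\<close>.
\<close>

lemma cls_block:
  assumes f: "f \<in> cls X (length ms) (length ns)"
    and g: "\<And>j. j < length ms \<Longrightarrow> g j \<in> cls X (ms ! j) (ns ! f j)"
    and F: "\<And>j l. j < length ms \<Longrightarrow> l < ms ! j \<Longrightarrow> F (off ms j + l) = off ns (f j) + g j l"
  shows "F \<in> cls X (sum_list ms) (sum_list ns)"
proof -
  have fl: "f j < length ns" if "j < length ms" for j using cls_less[OF f] that .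
  have gl: "g j l < ns ! f j" if "j < length ms" "l < ms ! j" for j l using cls_less[OF g] that .
  have Pi: "F \<in> {..<sum_list ms} \<rightarrow> {..<sum_list ns}"
  proof
    fix t assume "t \<in> {..<sum_list ms}"
    then obtain j l where "j < length ms" "l < ms ! j" "t = off ms j + l" using off_index by blast
    then show "F t \<in> {..<sum_list ns}" using off_bound[of "f j" ns "g j l"] fl gl by (simp add: F)
  qed
  have inj: "inj_on F {..<sum_list ms}"
    if fi: "inj_on f {..<length ms}" and gi: "\<And>j. j < length ms \<Longrightarrow> inj_on (g j) {..<ms ! j}"
  proof (rule inj_onI)
    fix t t' assume *: "t \<in> {..<sum_list ms}" "t' \<in> {..<sum_list ms}" "F t = F t'"
    obtain j l where t: "j < length ms" "l < ms ! j" "t = off ms j + l" using * off_index by blast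
    obtain j' l' where t': "j' < length ms" "l' < ms ! j'" "t' = off ms j' + l'" using * off_index by blast
    have e: "off ns (f j) + g j l = off ns (f j') + g j' l'" using * t t' by (simp add: F)
    have "f j = f j'" "g j l = g j' l'"
      using off_inj[OF e fl[OF t(1)] gl[OF t(1,2)] fl[OF t'(1)] gl[OF t'(1,2)]] by simp_all
    moreover from this(1) have "j = j'" using fi t t' by (auto dest: inj_onD)
    ultimately show "t = t'" using gi[of j] t t' by (auto dest: inj_onD)
  qed
  have mono: "mono_on {..<sum_list ms} F"
    if fi: "inj_on f {..<length ms}" and fm: "mono_on {..<length ms} f"
      and gm: "\<And>j. j < length ms \<Longrightarrow> mono_on {..<ms ! j} (g j)"
  proof (rule monotone_onI)
    fix t t' assume *: "t \<in> {..<sum_list ms}" "t' \<in> {..<sum_list ms}" "t \<le> t'"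
    obtain j l where t: "j < length ms" "l < ms ! j" "t = off ms j + l" using * off_index by blast
    obtain j' l' where t': "j' < length ms" "l' < ms ! j'" "t' = off ms j' + l'" using * off_index by blast
    consider "j < j'" | "j = j'" "l \<le> l'" using off_le[of j ms l j' l'] * t t' by blast
    then show "F t \<le> F t'"
    proof cases
      case 1
      have "f j \<le> f j'" using fm 1 t t' by (simp add: monotone_on_def)
      moreover have "f j \<noteq> f j'" using fi 1 t t' by (auto dest: inj_onD)
      ultimately show ?thesis using off_less[of "f j" "f j'" ns "g j l"] t t' fl gl by (simp add: F)
    next
      case 2
      then show ?thesis using gm[of j] t t' by (simp add: F monotone_on_def)
    qed
  qed
  have surj: "F ` {..<sum_list ms} = {..<sum_list ns}"
    if fs: "f ` {..<length ms} = {..<length ns}"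
      and gs: "\<And>j. j < length ms \<Longrightarrow> g j ` {..<ms ! j} = {..<ns ! f j}"
  proof
    show "F ` {..<sum_list ms} \<subseteq> {..<sum_list ns}" using Pi by auto
    show "{..<sum_list ns} \<subseteq> F ` {..<sum_list ms}"
    proof
      fix s assume "s \<in> {..<sum_list ns}"
      then obtain i k where s: "i < length ns" "k < ns ! i" "s = off ns i + k" using off_index by blast
      then have "i \<in> f ` {..<length ms}" using fs by simp
      then obtain j where j: "j < length ms" "i = f j" by auto
      then have "k \<in> g j ` {..<ms ! j}" using s gs by simp
      then obtain l where l: "l < ms ! j" "k = g j l" by auto
      show "s \<in> F ` {..<sum_list ms}"
        by (rule image_eqI[of _ _ "off ms j + l"]) (use s j l in \<open>simp_all add: F off_bound\<close>)
    qed
  qed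
  have id: "sum_list ms = sum_list ns \<and> (\<forall>t<sum_list ms. F t = t)"
    if "length ms = length ns" "\<forall>j<length ms. f j = j"
      and gi: "\<And>j. j < length ms \<Longrightarrow> ms ! j = ns ! f j \<and> (\<forall>l<ms ! j. g j l = l)"
  proof -
    have "ms = ns" using that by (auto intro: nth_equalityI)
    moreover have "F t = t" if "t < sum_list ms" for t
    proof -
      obtain j l where "j < length ms" "l < ms ! j" "t = off ms j + l" using off_index[OF \<open>t < _\<close>] by blast
      then show ?thesis using \<open>ms = ns\<close> \<open>\<forall>j<length ms. f j = j\<close> gi F[of j l] by simp
    qed
    ultimately show ?thesis by simp
  qed
  note f' = f[unfolded cls_def, simplified] and g' = g[unfolded cls_def, simplified]
  show ?thesis
    unfolding cls_def
  proof (intro CollectI conjI impI)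
    assume "X = {}"
    then have "sum_list ms = sum_list ns \<and> (\<forall>t<sum_list ms. F t = t)"
      using f' g' by (intro id) auto
    then show "sum_list ms = sum_list ns" "\<forall>t<sum_list ms. F t = t" by auto
  next
    assume "X = {CEpsilon}"
    then show "mono_on {..<sum_list ms} F" "inj_on F {..<sum_list ms}" using f' g' by (auto intro!: mono inj)
  next
    assume "X = {CSigma}"
    then show "bij_betw F {..<sum_list ms} {..<sum_list ns}"
      using f' g' inj surj by (auto simp: bij_betw_def)
  next
    assume "X = {CSigma, CDelta}"
    then show "F ` {..<sum_list ms} = {..<sum_list ns}" using f' g' by (intro surj) auto
  next
    assume "X = {CSigma, CEpsilon}"
    then show "inj_on F {..<sum_list ms}" using f' g' by (auto intro!: inj)
  qed (rule Pi)
qed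


section \<open>The monad !\<close>

lemma bang_Obj [simp]: "Obj (bang X C) = lists (Obj C)"
  by (simp add: bang_def)

lemma bang_Hom_iff:
  "h \<in> Hom (bang X C) cs ds \<longleftrightarrow> length h = length ds \<and>
     (\<lambda>j. fst (h ! j)) \<in> cls X (length ds) (length cs) \<and>
     (\<forall>j<length ds. snd (h ! j) \<in> Hom C (cs ! fst (h ! j)) (ds ! j))"
  by (simp add: bang_def)

lemma bang_Hom_less: "h \<in> Hom (bang X C) cs ds \<Longrightarrow> j < length ds \<Longrightarrow> fst (h ! j) < length cs"
  by (auto simp: bang_Hom_iff dest: cls_less)

lemma bang_Hom_length: "h \<in> Hom (bang X C) cs ds \<Longrightarrow> length h = length ds"
  by (simp add: bang_Hom_iff)

lemma bang_Hom_snd: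
  "h \<in> Hom (bang X C) cs ds \<Longrightarrow> j < length ds \<Longrightarrow> snd (h ! j) \<in> Hom C (cs ! fst (h ! j)) (ds ! j)"
  by (simp add: bang_Hom_iff)

lemma bang_Idn_length [simp]: "length (Idn (bang X C) cs) = length cs"
  by (simp add: bang_def)

lemma bang_Idn_nth [simp]: "i < length cs \<Longrightarrow> Idn (bang X C) cs ! i = (i, Idn C (cs ! i))"
  by (simp add: bang_def)

lemma bang_Cmp_length [simp]: "length (Cmp (bang X C) cs ds es k h) = length es"
  by (simp add: bang_def)

lemma bang_Cmp_nth [simp]:
  "l < length es \<Longrightarrow> Cmp (bang X C) cs ds es k h ! l =
     (fst (h ! fst (k ! l)),
      Cmp C (cs ! fst (h ! fst (k ! l))) (ds ! fst (k ! l)) (es ! l) (snd (k ! l)) (snd (h ! fst (k ! l))))"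
  by (simp add: bang_def Let_def split: prod.split)

lemma nth_Obj: "cs \<in> lists A \<Longrightarrow> i < length cs \<Longrightarrow> cs ! i \<in> A"
  by (metis in_lists_conv_set nth_mem)

lemma category_bang:
  assumes C: "category C"
  shows "category (bang X C)"
proof (rule categoryI)
  fix a assume a: "a \<in> Obj (bang X C)"
  have "(\<lambda>j. fst (Idn (bang X C) a ! j)) \<in> cls X (length a) (length a)"
    by (rule cls_id) simp
  then show "Idn (bang X C) a \<in> Hom (bang X C) a a"
    using a by (auto simp: bang_Hom_iff nth_Obj category_id[OF C])
next
  fix a b c f g assume *: "a \<in> Obj (bang X C)" "b \<in> Obj (bang X C)" "c \<in> Obj (bang X C)"
    "f \<in> Hom (bang X C) a b" "g \<in> Hom (bang X C) b c"
  have "(\<lambda>j. fst (f ! fst (g ! j))) \<in> cls X (length c) (length a)"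
    using cls_comp[of "\<lambda>j. fst (f ! j)" X "length b" "length a" "\<lambda>j. fst (g ! j)"] * by (simp add: bang_Hom_iff)
  then have "(\<lambda>j. fst (Cmp (bang X C) a b c g f ! j)) \<in> cls X (length c) (length a)"
    by (subst cls_cong[of _ _ "\<lambda>j. fst (f ! fst (g ! j))"]) simp_all
  moreover have "Cmp C (a ! fst (f ! fst (g ! j))) (b ! fst (g ! j)) (c ! j) (snd (g ! j)) (snd (f ! fst (g ! j)))
      \<in> Hom C (a ! fst (f ! fst (g ! j))) (c ! j)" if "j < length c" for j
    using * that by (intro category_comp[OF C])
      (simp_all add: nth_Obj bang_Hom_less[of _ X C] bang_Hom_snd[of _ X C])
  ultimately show "Cmp (bang X C) a b c g f \<in> Hom (bang X C) a c"
    by (simp add: bang_Hom_iff)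
next
  fix a b f assume *: "a \<in> Obj (bang X C)" "b \<in> Obj (bang X C)" "f \<in> Hom (bang X C) a b"
  show "Cmp (bang X C) a a b f (Idn (bang X C) a) = f"
    using * by (intro nth_equalityI)
      (auto simp: bang_Hom_length[of f X C a b] bang_Hom_less[of f X C a b] nth_Obj prod_eq_iff intro!: category_idr[OF C] bang_Hom_snd)
  show "Cmp (bang X C) a b b (Idn (bang X C) b) f = f"
    using * by (intro nth_equalityI)
      (auto simp: bang_Hom_length[of f X C a b] bang_Hom_less[of f X C a b] nth_Obj prod_eq_iff intro!: category_idl[OF C] bang_Hom_snd)
next
  fix a b c d f g h assume *: "a \<in> Obj (bang X C)" "b \<in> Obj (bang X C)" "c \<in> Obj (bang X C)" "d \<in> Obj (bang X C)"
    "f \<in> Hom (bang X C) a b" "g \<in> Hom (bang X C) b c" "h \<in> Hom (bang X C) c d"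
  show "Cmp (bang X C) a c d h (Cmp (bang X C) a b c g f) = Cmp (bang X C) a b d (Cmp (bang X C) b c d h g) f"
  proof (intro nth_equalityI, simp, goal_cases)
    case (1 i)
    note less = bang_Hom_less[OF *(5)] bang_Hom_less[OF *(6)] bang_Hom_less[OF *(7)]
    show ?case using 1 * by (auto simp: less nth_Obj intro!: category_assoc[OF C] bang_Hom_snd less)
  qed
qed

lemma category_quest: "category C \<Longrightarrow> category (quest X C)"
  by (simp add: quest_def category_op category_bang)

lemma bang_mult_FO [simp]: "FO bang_mult = concat"
  by (simp add: bang_mult_def)

lemma bang_mult_blocks:
  assumes "h \<in> Hom (bang X (bang X C)) css dss"
  shows "FM bang_mult css dss h =
      concat (map (\<lambda>j. map (\<lambda>l. (off (map length css) (fst (h ! j)) + fst (snd (h ! j) ! l), snd (snd (h ! j) ! l)))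
        [0..<length (dss ! j)]) [0..<length dss])"
proof -
  have "map (\<lambda>(i, G). map (\<lambda>(k, g). (length (concat (take i css)) + k, g)) G) h =
    map (\<lambda>j. map (\<lambda>l. (off (map length css) (fst (h ! j)) + fst (snd (h ! j) ! l), snd (snd (h ! j) ! l)))
        [0..<length (dss ! j)]) [0..<length dss]"
    using assms
    by (intro nth_equalityI) (auto simp: bang_Hom_iff length_concat_take split: prod.split intro!: nth_equalityI)
  then show ?thesis by (simp add: bang_mult_def)
qed

lemma bang_mult_length:
  assumes "h \<in> Hom (bang X (bang X C)) css dss"
  shows "length (FM bang_mult css dss h) = sum_list (map length dss)"
proof -
  have "map (\<lambda>j. length (dss ! j)) [0..<length dss] = map length dss" by (auto intro: nth_equalityI)
  then show ?thesis by (simp add: bang_mult_blocks[OF assms] length_concat comp_def)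
qed

text \<open>
  Positions in a concatenation are written as offset of a block plus index in the block.  In these
  coordinates the flattened morphism has a closed form, and equations between flattened morphisms
  are checked block by block (\<open>concat_nth_eqI\<close>).
\<close>

lemma bang_mult_nth:
  assumes "h \<in> Hom (bang X (bang X C)) css dss" "j < length dss" "l < length (dss ! j)"
  shows "FM bang_mult css dss h ! (off (map length dss) j + l) =
    (off (map length css) (fst (h ! j)) + fst (snd (h ! j) ! l), snd (snd (h ! j) ! l))"
proof -
  let ?b = "map (\<lambda>j. map (\<lambda>l. (off (map length css) (fst (h ! j)) + fst (snd (h ! j) ! l), snd (snd (h ! j) ! l)))
        [0..<length (dss ! j)]) [0..<length dss]"
  have "map length ?b = map length dss" by (auto intro!: nth_equalityI)
  then show ?thesis
    using concat_nth_off[of j ?b l] assms by (simp add: bang_mult_blocks[OF assms(1)])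
qed

lemma functor_bang_mult:
  assumes C: "category C"
  shows "is_functor (bang X (bang X C)) (bang X C) bang_mult"
proof (rule functorI)
  fix a assume "a \<in> Obj (bang X (bang X C))"
  then show "FO bang_mult a \<in> Obj (bang X C)" by (force simp: in_lists_conv_set)
next
  fix css dss h
  assume *: "css \<in> Obj (bang X (bang X C))" "dss \<in> Obj (bang X (bang X C))" and h: "h \<in> Hom (bang X (bang X C)) css dss"
  let ?m = "FM bang_mult css dss h"
  have hj: "snd (h ! j) \<in> Hom (bang X C) (css ! fst (h ! j)) (dss ! j)" "fst (h ! j) < length css" if "j < length dss" for j
    using that bang_Hom_snd[OF h] bang_Hom_less[OF h] by auto
  have "(\<lambda>t. fst (?m ! t)) \<in> cls X (sum_list (map length dss)) (sum_list (map length css))"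
    by (rule cls_block[where f = "\<lambda>j. fst (h ! j)" and g = "\<lambda>j l. fst (snd (h ! j) ! l)"])
      (use h hj in \<open>auto simp: bang_Hom_iff bang_mult_nth[OF h]\<close>)
  moreover have "snd (?m ! t) \<in> Hom C (concat css ! fst (?m ! t)) (concat dss ! t)" if "t < length (concat dss)" for t
  proof -
    obtain j l where t: "j < length dss" "l < length (dss ! j)" "t = off (map length dss) j + l"
      using concat_index \<open>t < _\<close> by blast
    then show ?thesis
      using bang_Hom_snd[OF hj(1), of j l] bang_Hom_less[OF hj(1), of j l] hj(2)[of j]
      by (simp add: bang_mult_nth[OF h] concat_nth_off)
  qed
  ultimately show "?m \<in> Hom (bang X C) (FO bang_mult css) (FO bang_mult dss)"
    by (simp add: bang_Hom_iff bang_mult_length[OF h] length_concat)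
next
  fix a assume a: "a \<in> Obj (bang X (bang X C))"
  have id: "Idn (bang X (bang X C)) a \<in> Hom (bang X (bang X C)) a a"
    using a by (intro category_id category_bang C)
  show "FM bang_mult a a (Idn (bang X (bang X C)) a) = Idn (bang X C) (FO bang_mult a)"
    by (rule concat_nth_eqI[of _ "map length a"])
      (use off_bound[of _ "map length a"] in \<open>simp_all add: bang_mult_length[OF id] bang_mult_nth[OF id] length_concat concat_nth_off\<close>)
next
  fix a b c f g
  assume *: "a \<in> Obj (bang X (bang X C))" "b \<in> Obj (bang X (bang X C))" "c \<in> Obj (bang X (bang X C))"
    and f: "f \<in> Hom (bang X (bang X C)) a b" and g: "g \<in> Hom (bang X (bang X C)) b c"
  have gf: "Cmp (bang X (bang X C)) a b c g f \<in> Hom (bang X (bang X C)) a c"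
    using * f g by (intro category_comp category_bang C)
  show "FM bang_mult a c (Cmp (bang X (bang X C)) a b c g f) =
    Cmp (bang X C) (FO bang_mult a) (FO bang_mult b) (FO bang_mult c) (FM bang_mult b c g) (FM bang_mult a b f)"
  proof (rule concat_nth_eqI[of _ "map length c"], goal_cases)
    case (3 j l)
    then have jl: "j < length c" "l < length (c ! j)" by auto
    define i where "i = fst (g ! j)"
    have i: "i < length b" using bang_Hom_less[OF g jl(1)] by (simp add: i_def)
    have G: "snd (g ! j) \<in> Hom (bang X C) (b ! i) (c ! j)" using bang_Hom_snd[OF g jl(1)] by (simp add: i_def)
    define k where "k = fst (snd (g ! j) ! l)"
    have k: "k < length (b ! i)" using bang_Hom_less[OF G jl(2)] by (simp add: k_def)
    have ai: "fst (f ! i) < length a" using bang_Hom_less[OF f i] .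
    have F: "snd (f ! i) \<in> Hom (bang X C) (a ! fst (f ! i)) (b ! i)" using bang_Hom_snd[OF f i] .
    have ak: "fst (snd (f ! i) ! k) < length (a ! fst (f ! i))" using bang_Hom_less[OF F k] .
    have "off (map length c) j + l < length (concat c)"
      using off_bound[of j "map length c" l] jl by (simp add: length_concat)
    then show ?case using jl i k ai ak
      by (simp add: bang_mult_nth[OF gf] bang_mult_nth[OF g] bang_mult_nth[OF f] concat_nth_off
          i_def[symmetric] k_def[symmetric])
  qed (simp_all add: bang_mult_length[OF gf] length_concat)
qed

lemma pow_cat_sel [simp]:
  "as \<in> Obj (pow_cat n C) \<longleftrightarrow> length as = n \<and> as \<in> lists (Obj C)"
  "fs \<in> Hom (pow_cat n C) as bs \<longleftrightarrow> length fs = n \<and> (\<forall>i<n. fs ! i \<in> Hom C (as ! i) (bs ! i))"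
  "Idn (pow_cat n C) = map (Idn C)"
  by (auto simp: pow_cat_def)

lemma pow_cat_Cmp:
  "Cmp (pow_cat n C) as bs cs gs fs = map (\<lambda>i. Cmp C (as ! i) (bs ! i) (cs ! i) (gs ! i) (fs ! i)) [0..<n]"
  by (simp add: pow_cat_def)

lemma category_pow:
  assumes C: "category C"
  shows "category (pow_cat n C)"
proof (rule categoryI, goal_cases)
  case (1 a)
  then show ?case by (simp add: category_id[OF C] nth_Obj)
next
  case (2 a b c f g)
  then show ?case by (simp add: pow_cat_Cmp category_comp[OF C] nth_Obj)
next
  case (3 a b f)
  then show ?case by (intro nth_equalityI) (simp_all add: pow_cat_Cmp category_idr[OF C] nth_Obj)
next
  case (4 a b f)
  then show ?case by (intro nth_equalityI) (simp_all add: pow_cat_Cmp category_idl[OF C] nth_Obj)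
next
  case (5 a b c d f g h)
  then show ?case by (simp add: pow_cat_Cmp category_assoc[OF C] nth_Obj)
qed

lemma enumerate_Hom:
  "length as = length bs \<Longrightarrow> u \<in> Hom (pow_cat (length bs) C) as bs \<Longrightarrow> enumerate 0 u \<in> Hom (bang X C) as bs"
  by (auto simp: bang_Hom_iff nth_enumerate_eq intro!: cls_id)

lemma enumerate_Idn: "enumerate 0 (map (Idn C) cs) = Idn (bang X C) cs"
  by (rule nth_equalityI) (auto simp: nth_enumerate_eq)

abbreviation along :: "'a list \<Rightarrow> (nat \<times> 'm) list \<Rightarrow> 'a list" where
  "along ds h \<equiv> map (\<lambda>(i, _). ds ! i) h"

lemma along_nth: "j < length h \<Longrightarrow> along ds h ! j = ds ! fst (h ! j)"
  by (simp add: split_def)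

lemma along_lists:
  "h \<in> Hom (bang X C) cs es \<Longrightarrow> length ds = length cs \<Longrightarrow> ds \<in> lists A \<Longrightarrow> along ds h \<in> lists A"
  unfolding in_lists_conv_set
  by (auto simp: in_set_conv_nth split_def bang_Hom_length) (metis bang_Hom_less fst_conv nth_mem)

lemma along_Idn: "length ds = length cs \<Longrightarrow> along ds (Idn (bang X C) cs) = ds"
  by (auto intro: nth_equalityI simp: along_nth)

lemma along_Cmp:
  "k \<in> Hom (bang X C) cs' cs'' \<Longrightarrow> h \<in> Hom (bang X C) cs cs' \<Longrightarrow>
   along ds (Cmp (bang X C) cs cs' cs'' k h) = along (along ds h) k"
  by (rule nth_equalityI) (simp_all add: along_nth bang_Hom_length bang_Hom_less del: nth_map)

lemma reindex_length [simp]: "length (reindex C ds h) = length h"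
  by (simp add: reindex_def)

lemma reindex_nth [simp]: "j < length h \<Longrightarrow> reindex C ds h ! j = (fst (h ! j), Idn C (ds ! fst (h ! j)))"
  by (simp add: reindex_def split_def)

lemma reindex_Hom:
  assumes C: "category C" and h: "h \<in> Hom (bang X C') cs cs'" and ds: "length ds = length cs" "ds \<in> lists (Obj C)"
  shows "reindex C ds h \<in> Hom (bang X C) ds (along ds h)"
proof -
  have "(\<lambda>j. fst (reindex C ds h ! j)) \<in> cls X (length cs') (length cs)"
    using h by (subst cls_cong[of _ _ "\<lambda>j. fst (h ! j)"]) (simp_all add: bang_Hom_iff)
  then show ?thesis
    using h ds by (auto simp: bang_Hom_iff[of "reindex C ds h"] bang_Hom_length bang_Hom_less[OF h] along_nth
        intro!: category_id[OF C] simp del: nth_map)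
qed

lemma reindex_Idn: "length ds = length cs \<Longrightarrow> reindex C ds (Idn (bang X C') cs) = Idn (bang X C) ds"
  by (rule nth_equalityI) simp_all

lemma reindex_Cmp:
  assumes C: "category C" and "k \<in> Hom (bang X C') cs' cs''" "h \<in> Hom (bang X C') cs cs'"
    and ds: "length ds = length cs" "ds \<in> lists (Obj C)"
  shows "reindex C ds (Cmp (bang X C') cs cs' cs'' k h) =
    Cmp (bang X C) ds (along ds h) (along (along ds h) k) (reindex C (along ds h) k) (reindex C ds h)"
proof (rule nth_equalityI)
  note l = bang_Hom_length[OF assms(2)] bang_Hom_length[OF assms(3)] bang_Hom_less[OF assms(2)] bang_Hom_less[OF assms(3)]
  fix i assume "i < length (reindex C ds (Cmp (bang X C') cs cs' cs'' k h))"
  then have i: "i < length cs''" by simp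
  have "ds ! fst (h ! fst (k ! i)) \<in> Obj C" using i ds by (simp add: nth_Obj l)
  then have "Cmp C (ds ! fst (h ! fst (k ! i))) (ds ! fst (h ! fst (k ! i))) (ds ! fst (h ! fst (k ! i)))
     (Idn C (ds ! fst (h ! fst (k ! i)))) (Idn C (ds ! fst (h ! fst (k ! i)))) = Idn C (ds ! fst (h ! fst (k ! i)))"
    by (simp add: category_idl[OF C] category_id[OF C])
  then show "reindex C ds (Cmp (bang X C') cs cs' cs'' k h) ! i =
    Cmp (bang X C) ds (along ds h) (along (along ds h) k) (reindex C (along ds h) k) (reindex C ds h) ! i"
    using i l by (simp add: along_nth del: nth_map)
qed (use assms(2) in \<open>simp add: bang_Hom_length\<close>)

lemma along_pow_Hom:
  assumes h: "h \<in> Hom (bang X C') cs cs'" and u: "u \<in> Hom (pow_cat (length cs) C) ds es"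
  shows "along u h \<in> Hom (pow_cat (length cs') C) (along ds h) (along es h)"
  using u bang_Hom_length[OF h] bang_Hom_less[OF h] by (simp add: along_nth del: nth_map)

text \<open>
  This naturality square makes the actions of \<open>bang_prof\<close> and \<open>kernel\<close> on representatives compatible with
  the generating pairs of the coends.
\<close>

lemma reindex_enumerate:
  assumes C: "category C" and h: "h \<in> Hom (bang X C') cs cs'"
    and ds: "length ds = length cs" "ds \<in> lists (Obj C)" and es: "length es = length cs" "es \<in> lists (Obj C)"
    and u: "u \<in> Hom (pow_cat (length cs) C) ds es"
  shows "Cmp (bang X C) ds es (along es h) (reindex C es h) (enumerate 0 u) =
    Cmp (bang X C) ds (along ds h) (along es h) (enumerate 0 (along u h)) (reindex C ds h)"
  using u ds es bang_Hom_less[OF h] bang_Hom_length[OF h]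
  by (intro nth_equalityI)
    (auto simp: along_nth nth_enumerate_eq category_idl[OF C] category_idr[OF C] nth_Obj simp del: nth_map)

lemma in_listset: "xs \<in> listset As \<longleftrightarrow> length xs = length As \<and> (\<forall>i<length As. xs ! i \<in> As ! i)"
proof (induction As arbitrary: xs)
  case (Cons A As)
  then show ?case by (cases xs) (auto simp: set_Cons_def less_Suc_eq_0_disj)
qed simp

section \<open>The extension of ! to profunctors\<close>

lemma profunctor_rep_prof:
  assumes A: "category A" and B: "category B" and F: "is_functor B A F"
  shows "profunctor A B (rep_prof A F)"
proof (rule profunctorI)
  fix a b x assume *: "a \<in> Obj A" "b \<in> Obj B" "x \<in> FO (rep_prof A F) (a, b)"
  then show "FM (rep_prof A F) (a, b) (a, b) (Idn A a, Idn B b) x = x"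
    by (simp add: rep_prof_def functor_id[OF F] functor_ob[OF F] category_idl[OF A] category_idr[OF A])
next
  fix a b a' b' a'' b'' f g f' g' x
  assume *: "a \<in> Obj A" "b \<in> Obj B" "a' \<in> Obj A" "b' \<in> Obj B" "a'' \<in> Obj A" "b'' \<in> Obj B"
    "f \<in> Hom A a a'" "g \<in> Hom B b' b" "f' \<in> Hom A a' a''" "g' \<in> Hom B b'' b'" "x \<in> FO (rep_prof A F) (a, b)"
  let ?b = "FO F b" and ?b' = "FO F b'" and ?b'' = "FO F b''" and ?g = "FM F b' b g" and ?g' = "FM F b'' b' g'"
  have o: "?b \<in> Obj A" "?b' \<in> Obj A" "?b'' \<in> Obj A" "?g \<in> Hom A ?b' ?b" "?g' \<in> Hom A ?b'' ?b'"
    using * by (auto intro: functor_ob[OF F] functor_mor[OF F])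
  have x: "x \<in> Hom A ?b a" using * by (simp add: rep_prof_def)
  have "Cmp A ?b'' a a'' (Cmp A a a' a'' f' f) (Cmp A ?b'' ?b a x (Cmp A ?b'' ?b' ?b ?g ?g')) =
    Cmp A ?b'' a' a'' f' (Cmp A ?b'' ?b' a' (Cmp A ?b' a a' f (Cmp A ?b' ?b a x ?g)) ?g')"
    using o x * by (simp add: category_assoc[OF A, symmetric] category_comp[OF A])
  then show "FM (rep_prof A F) (a, b) (a'', b'') (Cmp A a a' a'' f' f, Cmp B b'' b' b g g') x =
    FM (rep_prof A F) (a', b') (a'', b'') (f', g') (FM (rep_prof A F) (a, b) (a', b') (f, g) x)"
    using * o x by (simp add: rep_prof_def functor_comp[OF F] category_comp[OF A])
qed (use A B F in \<open>auto simp: rep_prof_def intro!: category_comp[OF A] functor_ob[OF F] functor_mor[OF F]\<close>)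


lemma bang_prof_int_dom:
  "(ds, xs, k) \<in> coend_dom (pow_cat (length as) B) (bang_prof_int X A B \<Phi> (as, bs)) \<longleftrightarrow>
     length ds = length as \<and> ds \<in> lists (Obj B) \<and>
     length xs = length as \<and> (\<forall>i<length as. xs ! i \<in> FO \<Phi> (as ! i, ds ! i)) \<and> k \<in> Hom (bang X B) bs ds"
  by (auto simp: bang_prof_int_def in_listset simp del: pow_cat_sel(2,3))

lemma bang_prof_gen:
  assumes A: "category A" and B: "category B" and \<Phi>: "profunctor A B \<Phi>"
    and as: "as \<in> lists (Obj A)" and bs: "bs \<in> lists (Obj B)"
  shows "coend_gen (pow_cat (length as) B) (bang_prof_int X A B \<Phi> (as, bs)) =
    {((ds, map (\<lambda>i. FM \<Phi> (as ! i, es ! i) (as ! i, ds ! i) (Idn A (as ! i), u ! i) (xs ! i)) [0..<length as], k),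
      (es, xs, Cmp (bang X B) bs ds es (enumerate 0 u) k)) | ds es u xs k.
      length ds = length as \<and> ds \<in> lists (Obj B) \<and> length es = length as \<and> es \<in> lists (Obj B) \<and>
      u \<in> Hom (pow_cat (length as) B) ds es \<and>
      length xs = length as \<and> (\<forall>i<length as. xs ! i \<in> FO \<Phi> (as ! i, es ! i)) \<and> k \<in> Hom (bang X B) bs ds}"
proof -
  have id: "map (\<lambda>i. FM \<Phi> (as ! i, es ! i) (as ! i, es ! i) (Idn A (as ! i), map (Idn B) es ! i) (xs ! i)) [0..<length as] = xs"
    if "length es = length as" "es \<in> lists (Obj B)" "length xs = length as" "\<forall>i<length as. xs ! i \<in> FO \<Phi> (as ! i, es ! i)" for es xs
    using that as by (intro nth_equalityI) (simp_all add: profunctor_id[OF \<Phi>] nth_Obj)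
  have idk: "Cmp (bang X B) bs ds ds (enumerate 0 (map (Idn B) ds)) k = k"
    if "ds \<in> lists (Obj B)" "k \<in> Hom (bang X B) bs ds" for ds k
    using that bs by (simp add: enumerate_Idn[where X = X] category_idl category_bang B)
  show ?thesis (is "?L = {?P ds es u xs k | ds es u xs k. ?Q ds es u xs k}")
  proof (intro equalityI subsetI)
    fix r assume "r \<in> ?L"
    then obtain ds es u x where r: "r = ((ds, FM (bang_prof_int X A B \<Phi> (as, bs)) (es, ds) (ds, ds) (u, map (Idn B) ds) x),
        (es, FM (bang_prof_int X A B \<Phi> (as, bs)) (es, ds) (es, es) (map (Idn B) es, u) x))"
      "ds \<in> Obj (pow_cat (length as) B)" "es \<in> Obj (pow_cat (length as) B)" "u \<in> Hom (pow_cat (length as) B) ds es"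
      "x \<in> FO (bang_prof_int X A B \<Phi> (as, bs)) (es, ds)"
      unfolding coend_gen_def pow_cat_sel(3) by blast
    obtain xs k where x: "x = (xs, k)" by force
    have Q: "?Q ds es u xs k"
      using r by (simp add: x bang_prof_int_def in_listset)
    moreover have "r = ?P ds es u xs k"
      using r(5) Q by (simp add: r(1) x bang_prof_int_def id idk)
    ultimately show "r \<in> {?P ds es u xs k | ds es u xs k. ?Q ds es u xs k}" by blast
  next
    fix r assume "r \<in> {?P ds es u xs k | ds es u xs k. ?Q ds es u xs k}"
    then obtain ds es u xs k where r: "r = ?P ds es u xs k" and Q: "?Q ds es u xs k" by blast
    have x: "(xs, k) \<in> FO (bang_prof_int X A B \<Phi> (as, bs)) (es, ds)"
      using Q by (simp add: bang_prof_int_def in_listset)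
    have "r = ((ds, FM (bang_prof_int X A B \<Phi> (as, bs)) (es, ds) (ds, ds) (u, map (Idn B) ds) (xs, k)),
        (es, FM (bang_prof_int X A B \<Phi> (as, bs)) (es, ds) (es, es) (map (Idn B) es, u) (xs, k)))"
      using x Q unfolding r by (simp add: bang_prof_int_def id idk)
    moreover have "ds \<in> Obj (pow_cat (length as) B)" "es \<in> Obj (pow_cat (length as) B)"
      "u \<in> Hom (pow_cat (length as) B) ds es" using Q by auto
    ultimately show "r \<in> ?L" using x unfolding coend_gen_def pow_cat_sel(3) by blast
  qed
qed

definition bang_prof_el ::
  "comb set \<Rightarrow> ('o, 'm) cat \<Rightarrow> ('p, 'n) cat \<Rightarrow> ('o, 'm, 'p, 'n, 'x) prof \<Rightarrow> 'o list \<Rightarrow> 'p list \<Rightarrow>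
   'p list \<Rightarrow> 'x list \<Rightarrow> (nat \<times> 'n) list \<Rightarrow> ('p list \<times> 'x list \<times> (nat \<times> 'n) list) set" where
  "bang_prof_el X A B \<Phi> as bs ds xs k =
     coend_cls (pow_cat (length as) B) (bang_prof_int X A B \<Phi> (as, bs)) (ds, xs, k)"

lemma bang_prof_balance:
  assumes "category A" "category B" "profunctor A B \<Phi>" "as \<in> lists (Obj A)" "bs \<in> lists (Obj B)"
    and "length ds = length as" "ds \<in> lists (Obj B)" "length es = length as" "es \<in> lists (Obj B)"
    and "u \<in> Hom (pow_cat (length as) B) ds es"
    and "length xs = length as" "\<forall>i<length as. xs ! i \<in> FO \<Phi> (as ! i, es ! i)" "k \<in> Hom (bang X B) bs ds"
  shows "bang_prof_el X A B \<Phi> as bs ds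
      (map (\<lambda>i. FM \<Phi> (as ! i, es ! i) (as ! i, ds ! i) (Idn A (as ! i), u ! i) (xs ! i)) [0..<length as]) k =
    bang_prof_el X A B \<Phi> as bs es xs (Cmp (bang X B) bs ds es (enumerate 0 u) k)"
  unfolding bang_prof_el_def
  by (rule coend_cls_gen, subst bang_prof_gen[OF assms(1-5)]) (use assms in blast)

lemma bang_prof_el_in:
  assumes "length ds = length as" "ds \<in> lists (Obj B)"
    "length xs = length as" "\<forall>i<length as. xs ! i \<in> FO \<Phi> (as ! i, ds ! i)" "k \<in> Hom (bang X B) bs ds"
  shows "bang_prof_el X A B \<Phi> as bs ds xs k \<in> FO (bang_prof X A B \<Phi>) (as, bs)"
  using coend_cls_in[OF bang_prof_int_dom[THEN iffD2], of ds as B xs \<Phi> k X bs A] assms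
  by (simp add: bang_prof_def bang_prof_el_def)

lemma bang_profE:
  assumes "w \<in> FO (bang_prof X A B \<Phi>) (as, bs)"
  obtains ds xs k where "length ds = length as" "ds \<in> lists (Obj B)"
    "length xs = length as" "\<forall>i<length as. xs ! i \<in> FO \<Phi> (as ! i, ds ! i)" "k \<in> Hom (bang X B) bs ds"
    "w = bang_prof_el X A B \<Phi> as bs ds xs k"
proof -
  have "w \<in> coend (pow_cat (length as) B) (bang_prof_int X A B \<Phi> (as, bs))"
    using assms by (simp add: bang_prof_def)
  then obtain p where p: "p \<in> coend_dom (pow_cat (length as) B) (bang_prof_int X A B \<Phi> (as, bs))"
    "w = coend_cls (pow_cat (length as) B) (bang_prof_int X A B \<Phi> (as, bs)) p"
    by (rule coendE)
  obtain ds xs k where "p = (ds, xs, k)" by (metis prod_cases3)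
  with p show thesis using bang_prof_int_dom[of ds xs k as B X A \<Phi> bs] that[of ds xs k]
    by (simp add: bang_prof_el_def del: mem_Sigma_iff)
qed

text \<open>
  The action on representatives is compatible with the generating pairs: a pair given by \<open>u\<close> is sent to the
  pair given by the reindexed family \<open>along u h\<close>.
\<close>

lemma bang_prof_FM:
  assumes A: "category A" and B: "category B" and \<Phi>: "profunctor A B \<Phi>"
    and as: "as \<in> lists (Obj A)" and bs: "bs \<in> lists (Obj B)"
    and as': "as' \<in> lists (Obj A)" and bs': "bs' \<in> lists (Obj B)"
    and h: "h \<in> Hom (bang X A) as as'" and w: "w \<in> Hom (bang X B) bs' bs"
    and el: "length ds = length as" "ds \<in> lists (Obj B)"
    "length xs = length as" "\<forall>i<length as. xs ! i \<in> FO \<Phi> (as ! i, ds ! i)" "k \<in> Hom (bang X B) bs ds"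
  shows "FM (bang_prof X A B \<Phi>) (as, bs) (as', bs') (h, w) (bang_prof_el X A B \<Phi> as bs ds xs k) =
    bang_prof_el X A B \<Phi> as' bs' (along ds h)
      (map (\<lambda>j. FM \<Phi> (as ! fst (h ! j), ds ! fst (h ! j)) (as' ! j, ds ! fst (h ! j))
         (snd (h ! j), Idn B (ds ! fst (h ! j))) (xs ! fst (h ! j))) [0..<length as'])
      (Cmp (bang X B) bs' ds (along ds h) (reindex B ds h) (Cmp (bang X B) bs' bs ds k w))"
proof -
  let ?xs = "\<lambda>ds xs. map (\<lambda>j. FM \<Phi> (as ! fst (h ! j), ds ! fst (h ! j)) (as' ! j, ds ! fst (h ! j))
         (snd (h ! j), Idn B (ds ! fst (h ! j))) (xs ! fst (h ! j))) [0..<length as']"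
  let ?\<tau> = "\<lambda>(ds, xs, k). (along ds h, ?xs ds xs,
      Cmp (bang X B) bs' ds (along ds h) (reindex B ds h) (Cmp (bang X B) bs' bs ds k w))"
  let ?\<tau>' = "\<lambda>(ds, xs, k). let ds' = along ds h
     in (ds', map (\<lambda>j. let (i, g) = h ! j
                        in FM \<Phi> (as ! i, ds ! i) (as' ! j, ds ! i) (g, Idn B (ds ! i)) (xs ! i)) [0..<length h],
         Cmp (bang X B) bs' ds ds' (reindex B ds h) (Cmp (bang X B) bs' bs ds k w))"
  have \<tau>: "?\<tau>' = ?\<tau>"
    by (intro ext) (simp add: split_def Let_def bang_Hom_length[OF h])
  note BB = category_bang[OF B, of X]
  note hl = bang_Hom_length[OF h] bang_Hom_less[OF h]
  let ?F = "bang_prof_int X A B \<Phi> (as, bs)" and ?G = "bang_prof_int X A B \<Phi> (as', bs')"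
  have "coend_map (pow_cat (length as') B) ?G ?\<tau> (coend_cls (pow_cat (length as) B) ?F (ds, xs, k)) =
      coend_cls (pow_cat (length as') B) ?G (?\<tau> (ds, xs, k))"
  proof (rule coend_map_cls)
    fix p q assume "(p, q) \<in> coend_gen (pow_cat (length as) B) ?F"
    then obtain ds es u xs k where pq:
      "p = (ds, map (\<lambda>i. FM \<Phi> (as ! i, es ! i) (as ! i, ds ! i) (Idn A (as ! i), u ! i) (xs ! i)) [0..<length as], k)"
      "q = (es, xs, Cmp (bang X B) bs ds es (enumerate 0 u) k)"
      and ds: "length ds = length as" "ds \<in> lists (Obj B)" and es: "length es = length as" "es \<in> lists (Obj B)"
      and u: "u \<in> Hom (pow_cat (length as) B) ds es"
      and xs: "length xs = length as" "\<forall>i<length as. xs ! i \<in> FO \<Phi> (as ! i, es ! i)" and k: "k \<in> Hom (bang X B) bs ds"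
      unfolding bang_prof_gen[OF A B \<Phi> as bs] by blast
    define k' where "k' = Cmp (bang X B) bs' ds (along ds h) (reindex B ds h) (Cmp (bang X B) bs' bs ds k w)"
    have al: "along ds h \<in> lists (Obj B)" "along es h \<in> lists (Obj B)"
      "length (along ds h) = length as'" "length (along es h) = length as'"
      using ds es hl along_lists[OF h ds] along_lists[OF h es] by auto
    have rx: "reindex B ds h \<in> Hom (bang X B) ds (along ds h)" "reindex B es h \<in> Hom (bang X B) es (along es h)"
      using reindex_Hom[OF B h] ds es by auto
    have eu: "enumerate 0 u \<in> Hom (bang X B) ds es" using enumerate_Hom[of ds es u B X] u ds es by simp
    have uh: "along u h \<in> Hom (pow_cat (length as') B) (along ds h) (along es h)"
      using along_pow_Hom[OF h u] .
    have euh: "enumerate 0 (along u h) \<in> Hom (bang X B) (along ds h) (along es h)"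
      by (rule enumerate_Hom) (use uh al in \<open>simp_all only:\<close>)
    have k': "k' \<in> Hom (bang X B) bs' (along ds h)"
      unfolding k'_def using bs bs' ds al k w rx by (intro category_comp[OF BB]) auto
    have 1: "?\<tau> p = (along ds h, map (\<lambda>i. FM \<Phi> (as' ! i, along es h ! i) (as' ! i, along ds h ! i)
        (Idn A (as' ! i), along u h ! i) (?xs es xs ! i)) [0..<length as'], k')"
      unfolding pq k'_def
      using hl as as' ds es xs u bang_Hom_snd[OF h]
      by (auto intro!: nth_equalityI simp: along_nth nth_Obj profunctor_comp[OF \<Phi>] category_id A B
          category_idl[OF A] category_idl[OF B] category_idr[OF A] category_idr[OF B] simp add: split_def)
    have "Cmp (bang X B) bs' es (along es h) (reindex B es h)
        (Cmp (bang X B) bs' bs es (Cmp (bang X B) bs ds es (enumerate 0 u) k) w) =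
       Cmp (bang X B) bs' ds (along es h)
        (Cmp (bang X B) ds es (along es h) (reindex B es h) (enumerate 0 u)) (Cmp (bang X B) bs' bs ds k w)"
      using bs bs' ds es al k w rx eu
      by (simp add: category_assoc[OF BB, symmetric] category_comp[OF BB])
    also have "\<dots> = Cmp (bang X B) bs' (along ds h) (along es h) (enumerate 0 (along u h)) k'"
      unfolding k'_def using bs bs' ds es al k w rx euh
      by (simp add: reindex_enumerate[OF B h ds es u] category_assoc[OF BB] category_comp[OF BB])
    finally have 2: "?\<tau> q = (along es h, ?xs es xs,
        Cmp (bang X B) bs' (along ds h) (along es h) (enumerate 0 (along u h)) k')"
      unfolding pq by simp
    have "\<forall>i<length as'. ?xs es xs ! i \<in> FO \<Phi> (as' ! i, along es h ! i)"
      using as as' es xs hl bang_Hom_snd[OF h]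
      by (auto simp: along_nth nth_Obj category_id B simp add: split_def intro!: profunctor_app[OF \<Phi>])
    then show "coend_cls (pow_cat (length as') B) ?G (?\<tau> p) = coend_cls (pow_cat (length as') B) ?G (?\<tau> q)"
      unfolding 1 2 using bang_prof_balance[OF A B \<Phi> as' bs' al(3,1,4,2) uh _ _ k', of "?xs es xs"]
      by (simp add: bang_prof_el_def)
  qed
  moreover have "FM (bang_prof X A B \<Phi>) (as, bs) (as', bs') (h, w) =
      (\<lambda>z\<in>FO (bang_prof X A B \<Phi>) (as, bs). coend_map (pow_cat (length as') B) ?G ?\<tau>' z)"
    by (simp only: bang_prof_def ftr.select_convs prod.case)
  ultimately show ?thesis
    using bang_prof_el_in[OF el, where A = A] unfolding \<tau> by (simp add: bang_prof_el_def)
qed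

lemma bang_prof_FM_right:
  assumes A: "category A" and B: "category B" and \<Phi>: "profunctor A B \<Phi>"
    and as: "as \<in> lists (Obj A)" and bs: "bs \<in> lists (Obj B)" and bs': "bs' \<in> lists (Obj B)"
    and w: "w \<in> Hom (bang X B) bs' bs"
    and el: "length ds = length as" "ds \<in> lists (Obj B)"
    "length xs = length as" "\<forall>i<length as. xs ! i \<in> FO \<Phi> (as ! i, ds ! i)" "k \<in> Hom (bang X B) bs ds"
  shows "FM (bang_prof X A B \<Phi>) (as, bs) (as, bs') (Idn (bang X A) as, w) (bang_prof_el X A B \<Phi> as bs ds xs k) =
    bang_prof_el X A B \<Phi> as bs' ds xs (Cmp (bang X B) bs' bs ds k w)"
proof -
  have h: "Idn (bang X A) as \<in> Hom (bang X A) as as" using as by (auto intro!: category_id category_bang A)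
  have "map (\<lambda>j. FM \<Phi> (as ! fst (Idn (bang X A) as ! j), ds ! fst (Idn (bang X A) as ! j)) (as ! j, ds ! fst (Idn (bang X A) as ! j))
     (snd (Idn (bang X A) as ! j), Idn B (ds ! fst (Idn (bang X A) as ! j))) (xs ! fst (Idn (bang X A) as ! j))) [0..<length as] = xs"
    using el as by (auto intro!: nth_equalityI simp: profunctor_id[OF \<Phi>] nth_Obj)
  moreover have "Cmp (bang X B) bs' bs ds k w \<in> Hom (bang X B) bs' ds"
    using category_comp[OF category_bang[OF B], of bs' X bs ds w k] el w bs bs' by simp
  ultimately show ?thesis
    using category_idl[OF category_bang[OF B], of bs' X ds] bs' el(2)
    unfolding bang_prof_FM[OF A B \<Phi> as bs as bs' h w el] by (simp add: along_Idn reindex_Idn el(1))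
qed

lemma profunctor_bang_prof:
  assumes A: "category A" and B: "category B" and \<Phi>: "profunctor A B \<Phi>"
  shows "profunctor (bang X A) (bang X B) (bang_prof X A B \<Phi>)"
proof (rule profunctorI)
  note BB = category_bang[OF B, of X]
  {
    fix as bs as' bs' h w
    assume *: "as \<in> Obj (bang X A)" "bs \<in> Obj (bang X B)" "as' \<in> Obj (bang X A)" "bs' \<in> Obj (bang X B)"
      and h: "h \<in> Hom (bang X A) as as'" and w: "w \<in> Hom (bang X B) bs' bs"
    note o = *[unfolded bang_Obj]
    have "FM (bang_prof X A B \<Phi>) (as, bs) (as', bs') (h, w) z \<in> FO (bang_prof X A B \<Phi>) (as', bs')"
      if "z \<in> FO (bang_prof X A B \<Phi>) (as, bs)" for z
      using that
    proof (rule bang_profE)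
      fix ds xs k assume el: "length ds = length as" "ds \<in> lists (Obj B)"
        "length xs = length as" "\<forall>i<length as. xs ! i \<in> FO \<Phi> (as ! i, ds ! i)" "k \<in> Hom (bang X B) bs ds"
        and z: "z = bang_prof_el X A B \<Phi> as bs ds xs k"
      have al: "along ds h \<in> lists (Obj B)" "length (along ds h) = length as'"
        using along_lists[OF h el(1,2)] bang_Hom_length[OF h] by auto
      have "Cmp (bang X B) bs' ds (along ds h) (reindex B ds h) (Cmp (bang X B) bs' bs ds k w) \<in> Hom (bang X B) bs' (along ds h)"
        using * el w al reindex_Hom[OF B h el(1,2)] by (intro category_comp[OF BB]) auto
      then show ?thesis
        unfolding z bang_prof_FM[OF A B \<Phi> o h w el]
        using al o el bang_Hom_less[OF h] bang_Hom_length[OF h] bang_Hom_snd[OF h]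
        by (intro bang_prof_el_in)
          (auto simp: along_nth nth_Obj category_id B simp add: split_def intro!: profunctor_app[OF \<Phi>])
    qed
    moreover have "FM (bang_prof X A B \<Phi>) (as, bs) (as', bs') (h, w) \<in> extensional (FO (bang_prof X A B \<Phi>) (as, bs))"
      by (simp add: bang_prof_def)
    ultimately show "FM (bang_prof X A B \<Phi>) (as, bs) (as', bs') (h, w) \<in>
        FO (bang_prof X A B \<Phi>) (as, bs) \<rightarrow>\<^sub>E FO (bang_prof X A B \<Phi>) (as', bs')"
      by (auto simp: PiE_def)
  note this
  }
  {
    fix as bs z
    assume *: "as \<in> Obj (bang X A)" "bs \<in> Obj (bang X B)" "z \<in> FO (bang_prof X A B \<Phi>) (as, bs)"
    note o = *(1,2)[unfolded bang_Obj]
    have w: "Idn (bang X B) bs \<in> Hom (bang X B) bs bs" using *(2) by (intro category_id BB)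
    from *(3) show "FM (bang_prof X A B \<Phi>) (as, bs) (as, bs) (Idn (bang X A) as, Idn (bang X B) bs) z = z"
      by (rule bang_profE)
        (use * w in \<open>simp add: bang_prof_FM_right[OF A B \<Phi> o(1,2,2) w] category_idr[OF BB] del: in_lists_conv_set\<close>)
  }
  {
    fix as bs as' bs' as'' bs'' h w h' w' z
    assume *: "as \<in> Obj (bang X A)" "bs \<in> Obj (bang X B)" "as' \<in> Obj (bang X A)" "bs' \<in> Obj (bang X B)"
      "as'' \<in> Obj (bang X A)" "bs'' \<in> Obj (bang X B)"
      and h: "h \<in> Hom (bang X A) as as'" and w: "w \<in> Hom (bang X B) bs' bs"
      and h': "h' \<in> Hom (bang X A) as' as''" and w': "w' \<in> Hom (bang X B) bs'' bs'"
      and z: "z \<in> FO (bang_prof X A B \<Phi>) (as, bs)"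
    note o = *[unfolded bang_Obj]
    let ?h = "Cmp (bang X A) as as' as'' h' h" and ?w = "Cmp (bang X B) bs'' bs' bs w w'"
    have hh: "?h \<in> Hom (bang X A) as as''" and ww: "?w \<in> Hom (bang X B) bs'' bs"
      using * h w h' w' by (auto intro!: category_comp[OF category_bang] A B)
    note hl = bang_Hom_less[OF h] bang_Hom_less[OF h'] bang_Hom_length[OF h] bang_Hom_length[OF h']
    from z show "FM (bang_prof X A B \<Phi>) (as, bs) (as'', bs'') (?h, ?w) z =
        FM (bang_prof X A B \<Phi>) (as', bs') (as'', bs'') (h', w') (FM (bang_prof X A B \<Phi>) (as, bs) (as', bs') (h, w) z)"
    proof (rule bang_profE)
      fix ds xs k assume el: "length ds = length as" "ds \<in> lists (Obj B)"
        "length xs = length as" "\<forall>i<length as. xs ! i \<in> FO \<Phi> (as ! i, ds ! i)" "k \<in> Hom (bang X B) bs ds"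
        and z: "z = bang_prof_el X A B \<Phi> as bs ds xs k"
      define ds' where "ds' = along ds h"
      define xs' where "xs' = map (\<lambda>j. FM \<Phi> (as ! fst (h ! j), ds ! fst (h ! j)) (as' ! j, ds ! fst (h ! j))
         (snd (h ! j), Idn B (ds ! fst (h ! j))) (xs ! fst (h ! j))) [0..<length as']"
      define k' where "k' = Cmp (bang X B) bs' ds ds' (reindex B ds h) (Cmp (bang X B) bs' bs ds k w)"
      have rx: "reindex B ds h \<in> Hom (bang X B) ds ds'" unfolding ds'_def by (rule reindex_Hom[OF B h el(1,2)])
      have el': "length ds' = length as'" "ds' \<in> lists (Obj B)" "length xs' = length as'"
        using el hl along_lists[OF h el(1,2)] unfolding ds'_def xs'_def by auto
      have xs': "\<forall>i<length as'. xs' ! i \<in> FO \<Phi> (as' ! i, ds' ! i)"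
        using o el hl bang_Hom_snd[OF h] unfolding ds'_def xs'_def
        by (auto simp: along_nth nth_Obj category_id B simp add: split_def intro!: profunctor_app[OF \<Phi>])
      have k': "k' \<in> Hom (bang X B) bs' ds'"
        unfolding k'_def using * el el' w rx by (intro category_comp[OF BB]) auto
      have rx': "reindex B ds' h' \<in> Hom (bang X B) ds' (along ds' h')" by (rule reindex_Hom[OF B h' el'(1,2)])
      have al: "along ds' h' \<in> lists (Obj B)" using along_lists[OF h' el'(1,2)] .
      have 1: "along ds ?h = along ds' h'" unfolding ds'_def by (rule along_Cmp[OF h' h])
      have 2: "map (\<lambda>j. FM \<Phi> (as ! fst (?h ! j), ds ! fst (?h ! j)) (as'' ! j, ds ! fst (?h ! j))
         (snd (?h ! j), Idn B (ds ! fst (?h ! j))) (xs ! fst (?h ! j))) [0..<length as''] =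
        map (\<lambda>j. FM \<Phi> (as' ! fst (h' ! j), ds' ! fst (h' ! j)) (as'' ! j, ds' ! fst (h' ! j))
         (snd (h' ! j), Idn B (ds' ! fst (h' ! j))) (xs' ! fst (h' ! j))) [0..<length as'']"
        using o el hl bang_Hom_snd[OF h] bang_Hom_snd[OF h'] unfolding ds'_def xs'_def
        by (intro nth_equalityI) (auto simp: along_nth nth_Obj category_id A B profunctor_comp[OF \<Phi>] category_idl[OF B] 
             simp add: split_def)
      have 3: "Cmp (bang X B) bs'' ds (along ds' h') (reindex B ds ?h) (Cmp (bang X B) bs'' bs ds k ?w) =
        Cmp (bang X B) bs'' ds' (along ds' h') (reindex B ds' h') (Cmp (bang X B) bs'' bs' ds' k' w')"
        using * el el' w w' rx rx' al unfolding k'_def reindex_Cmp[OF B h' h el(1,2)] ds'_def[symmetric]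
        by (simp add: category_assoc[OF BB, symmetric] category_comp[OF BB])
      show ?thesis
        unfolding z bang_prof_FM[OF A B \<Phi> o(1,2,5,6) hh ww el] bang_prof_FM[OF A B \<Phi> o(1,2,3,4) h w el]
          1 2 3 ds'_def[symmetric] xs'_def[symmetric] k'_def[symmetric]
        by (rule bang_prof_FM[OF A B \<Phi> o(3-6) h' w' el'(1-3) xs' k', symmetric])
    qed
  }
qed (use A B in \<open>auto intro: category_bang\<close>)

section \<open>The kernel and the extension of a profunctor from ?A\<close>

lemma quest_sel [simp]:
  "Obj (quest X C) = lists (Obj C)" "Hom (quest X C) a b = Hom (bang X (op_cat C)) b a"
  "Idn (quest X C) = Idn (bang X (op_cat C))"
  "Cmp (quest X C) a b c g f = Cmp (bang X (op_cat C)) c b a f g"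
  by (simp_all add: quest_def)

lemma op_quest [simp]: "op_cat (quest X C) = bang X (op_cat C)"
  by (simp add: quest_def)

definition kernel_el where
  "kernel_el X A B \<Phi> as bs ds xs k =
     coend_cls (pow_cat (length bs) (quest X A)) (kernel_int X A B \<Phi> (as, bs)) (ds, xs, k)"

definition quest_ext_el where
  "quest_ext_el X A B \<Phi> as bs dss ess xs h k =
     prof_comp_el (quest X A) (quest X (quest X A)) (quest X B) (quest_prof X (quest X A) B \<Phi>) (comult X A) (as, bs) dss
       (bang_prof_el X (op_cat B) (bang X (op_cat A)) (prof_op \<Phi>) bs dss ess xs h) k"

text \<open>
  The effect of \<open>kernel_of\<close> on the inner class, for a fixed representative of the outer one.
\<close>

definition kernel_of_inner where
  "kernel_of_inner X A B \<Phi> as bs dss k =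
     coend_map (pow_cat (length bs) (quest X A)) (kernel_int X A B \<Phi> (as, bs))
       (\<lambda>(ess, xs, h). (ess, xs, Cmp (bang X (op_cat A)) as (concat dss) (concat ess) (FM bang_mult dss ess h) k))"

text \<open>The map \<open>[dss, [ess, xs, h], k] \<mapsto> [ess, xs, concat h \<circ> k]\<close> and its inverse.\<close>

definition kernel_of where
  "kernel_of X A B \<Phi> as bs w = (\<Union>(dss, c, k)\<in>w. kernel_of_inner X A B \<Phi> as bs dss k c)"

definition ext_of where
  "ext_of X A B \<Phi> as bs c =
     (\<Union>(ess, xs, k)\<in>c. quest_ext_el X A B \<Phi> as bs ess ess xs (Idn (bang X (bang X (op_cat A))) ess) k)"

abbreviation qop :: "comb set \<Rightarrow> ('o, 'm) cat \<Rightarrow> ('o list, (nat \<times> 'm) list) cat" where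
  "qop X C \<equiv> bang X (op_cat C)"

context
  fixes X :: "comb set" and A :: "('o, 'm) cat" and B :: "('p, 'n) cat"
    and \<Phi> :: "('o list, (nat \<times> 'm) list, 'p, 'n, 'x) prof"
  assumes A: "category A" and B: "category B" and \<Phi>: "profunctor (quest X A) B \<Phi>"
begin

lemma cat_bang: "category (qop X A)" and cat_bang_bang: "category (bang X (qop X A))" and cat_bang_B: "category (qop X B)"
  by (simp_all add: category_bang category_op A B)

lemma cat_quest: "category (quest X A)" "category (quest X (quest X A))" "category (quest X B)"
  by (simp_all add: category_quest A B)

lemma mult_Hom:
  "ess \<in> lists (lists (Obj A)) \<Longrightarrow> dss \<in> lists (lists (Obj A)) \<Longrightarrow> h \<in> Hom (bang X (qop X A)) ess dss \<Longrightarrow>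
   FM bang_mult ess dss h \<in> Hom (qop X A) (concat ess) (concat dss)"
  using functor_mor[OF functor_bang_mult[OF category_op[OF A]], of ess X dss h] by simp

lemma mult_Idn:
  "ess \<in> lists (lists (Obj A)) \<Longrightarrow> FM bang_mult ess ess (Idn (bang X (qop X A)) ess) = Idn (qop X A) (concat ess)"
  using functor_id[OF functor_bang_mult[OF category_op[OF A]], of ess X] by simp

lemma mult_Cmp:
  "ess \<in> lists (lists (Obj A)) \<Longrightarrow> dss \<in> lists (lists (Obj A)) \<Longrightarrow> css \<in> lists (lists (Obj A)) \<Longrightarrow>
   f \<in> Hom (bang X (qop X A)) ess dss \<Longrightarrow> g \<in> Hom (bang X (qop X A)) dss css \<Longrightarrow>
   FM bang_mult ess css (Cmp (bang X (qop X A)) ess dss css g f) =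
   Cmp (qop X A) (concat ess) (concat dss) (concat css) (FM bang_mult dss css g) (FM bang_mult ess dss f)"
  using functor_comp[OF functor_bang_mult[OF category_op[OF A]], of ess X dss css f g] by simp

lemma concat_Obj: "dss \<in> lists (lists (Obj A)) \<Longrightarrow> concat dss \<in> lists (Obj A)"
  by (force simp: in_lists_conv_set)

lemma prof_op_\<Phi>: "profunctor (op_cat B) (qop X A) (prof_op \<Phi>)"
  using profunctor_op[OF cat_quest(1) B \<Phi>] by simp

lemma kernel_int_dom:
  "(ds, xs, k) \<in> coend_dom (pow_cat (length bs) (quest X A)) (kernel_int X A B \<Phi> (as, bs)) \<longleftrightarrow>
     length ds = length bs \<and> ds \<in> lists (lists (Obj A)) \<and>
     length xs = length bs \<and> (\<forall>i<length bs. xs ! i \<in> FO \<Phi> (ds ! i, bs ! i)) \<and> k \<in> Hom (qop X A) as (concat ds)"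
  by (auto simp: kernel_int_def in_listset simp del: pow_cat_sel(2,3))

lemma kernel_gen:
  assumes as: "as \<in> lists (Obj A)" and bs: "bs \<in> lists (Obj B)"
  shows "coend_gen (pow_cat (length bs) (quest X A)) (kernel_int X A B \<Phi> (as, bs)) =
    {((ds, xs, Cmp (qop X A) as (concat es) (concat ds) (FM bang_mult es ds (enumerate 0 u)) k),
      (es, map (\<lambda>i. FM \<Phi> (ds ! i, bs ! i) (es ! i, bs ! i) (u ! i, Idn B (bs ! i)) (xs ! i)) [0..<length bs], k))
      | ds es u xs k.
      length ds = length bs \<and> ds \<in> lists (lists (Obj A)) \<and> length es = length bs \<and> es \<in> lists (lists (Obj A)) \<and>
      u \<in> Hom (pow_cat (length bs) (qop X A)) es ds \<and>
      length xs = length bs \<and> (\<forall>i<length bs. xs ! i \<in> FO \<Phi> (ds ! i, bs ! i)) \<and> k \<in> Hom (qop X A) as (concat es)}"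
proof -
  have id: "map (\<lambda>i. FM \<Phi> (es ! i, bs ! i) (es ! i, bs ! i) (map (Idn (qop X A)) es ! i, Idn B (bs ! i)) (xs ! i)) [0..<length bs] = xs"
    if "length es = length bs" "es \<in> lists (lists (Obj A))" "length xs = length bs" "\<forall>i<length bs. xs ! i \<in> FO \<Phi> (es ! i, bs ! i)" for es xs
  proof (rule nth_equalityI, simp add: that)
    fix i assume "i < length (map (\<lambda>i. FM \<Phi> (es ! i, bs ! i) (es ! i, bs ! i) (map (Idn (qop X A)) es ! i, Idn B (bs ! i)) (xs ! i)) [0..<length bs])"
    then have i: "i < length bs" by simp
    then have "FM \<Phi> (es ! i, bs ! i) (es ! i, bs ! i) (Idn (qop X A) (es ! i), Idn B (bs ! i)) (xs ! i) = xs ! i"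
      using profunctor_id[OF \<Phi>, of "es ! i" "bs ! i" "xs ! i"] nth_Obj[OF that(2), of i] nth_Obj[OF bs, of i] that by simp
    then show "map (\<lambda>i. FM \<Phi> (es ! i, bs ! i) (es ! i, bs ! i) (map (Idn (qop X A)) es ! i, Idn B (bs ! i)) (xs ! i)) [0..<length bs] ! i = xs ! i"
      using i that(1) by simp
  qed
  have idk: "Cmp (qop X A) as (concat ds) (concat ds) (FM bang_mult ds ds (enumerate 0 (map (Idn (qop X A)) ds))) k = k"
    if "ds \<in> lists (lists (Obj A))" "k \<in> Hom (qop X A) as (concat ds)" for ds k
    using that as concat_Obj[OF that(1)] category_idl[OF cat_bang, of as "concat ds" k]
    by (simp add: enumerate_Idn[where X = X] mult_Idn)
  let ?K = "kernel_int X A B \<Phi> (as, bs)" and ?C = "pow_cat (length bs) (quest X A)"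
  show ?thesis (is "?L = {?P ds es u xs k | ds es u xs k. ?Q ds es u xs k}")
  proof (intro equalityI subsetI)
    fix r assume "r \<in> ?L"
    then obtain ds es u x where r: "r = ((ds, FM ?K (es, ds) (ds, ds) (u, map (Idn (qop X A)) ds) x),
        (es, FM ?K (es, ds) (es, es) (map (Idn (qop X A)) es, u) x))"
      "ds \<in> Obj ?C" "es \<in> Obj ?C" "u \<in> Hom ?C ds es" "x \<in> FO ?K (es, ds)"
      unfolding coend_gen_def pow_cat_sel(3) quest_sel(3) by blast
    obtain xs k where x: "x = (xs, k)" by force
    have Q: "?Q ds es u xs k"
      using r by (simp add: x kernel_int_def in_listset)
    moreover have "r = ?P ds es u xs k"
      using r(5) Q by (simp add: r(1) x kernel_int_def id idk)
    ultimately show "r \<in> {?P ds es u xs k | ds es u xs k. ?Q ds es u xs k}" by blast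
  next
    fix r assume "r \<in> {?P ds es u xs k | ds es u xs k. ?Q ds es u xs k}"
    then obtain ds es u xs k where r: "r = ?P ds es u xs k" and Q: "?Q ds es u xs k" by blast
    have x: "(xs, k) \<in> FO ?K (es, ds)"
      using Q by (simp add: kernel_int_def in_listset)
    have "r = ((ds, FM ?K (es, ds) (ds, ds) (u, map (Idn (qop X A)) ds) (xs, k)),
        (es, FM ?K (es, ds) (es, es) (map (Idn (qop X A)) es, u) (xs, k)))"
      using x Q unfolding r by (simp add: kernel_int_def id idk)
    moreover have "ds \<in> Obj ?C" "es \<in> Obj ?C" "u \<in> Hom ?C ds es" using Q by auto
    ultimately show "r \<in> ?L" using x unfolding coend_gen_def pow_cat_sel(3) quest_sel(3) by blast
  qed
qed

lemma kernel_balance: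
  assumes "as \<in> lists (Obj A)" "bs \<in> lists (Obj B)"
    and "length ds = length bs" "ds \<in> lists (lists (Obj A))" "length es = length bs" "es \<in> lists (lists (Obj A))"
    and "u \<in> Hom (pow_cat (length bs) (qop X A)) es ds"
    and "length xs = length bs" "\<forall>i<length bs. xs ! i \<in> FO \<Phi> (ds ! i, bs ! i)" "k \<in> Hom (qop X A) as (concat es)"
  shows "kernel_el X A B \<Phi> as bs ds xs (Cmp (qop X A) as (concat es) (concat ds) (FM bang_mult es ds (enumerate 0 u)) k) =
    kernel_el X A B \<Phi> as bs es
      (map (\<lambda>i. FM \<Phi> (ds ! i, bs ! i) (es ! i, bs ! i) (u ! i, Idn B (bs ! i)) (xs ! i)) [0..<length bs]) k"
  unfolding kernel_el_def
  by (rule coend_cls_gen, subst kernel_gen[OF assms(1,2)]) (use assms in blast)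

lemma kernel_el_in:
  assumes "length ds = length bs" "ds \<in> lists (lists (Obj A))"
    "length xs = length bs" "\<forall>i<length bs. xs ! i \<in> FO \<Phi> (ds ! i, bs ! i)" "k \<in> Hom (qop X A) as (concat ds)"
  shows "kernel_el X A B \<Phi> as bs ds xs k \<in> FO (kernel X A B \<Phi>) (as, bs)"
  using coend_cls_in[OF kernel_int_dom[THEN iffD2], of ds bs xs k as] assms
  by (simp add: kernel_def kernel_el_def)

lemma kernelE:
  assumes "w \<in> FO (kernel X A B \<Phi>) (as, bs)"
  obtains ds xs k where "length ds = length bs" "ds \<in> lists (lists (Obj A))"
    "length xs = length bs" "\<forall>i<length bs. xs ! i \<in> FO \<Phi> (ds ! i, bs ! i)" "k \<in> Hom (qop X A) as (concat ds)"
    "w = kernel_el X A B \<Phi> as bs ds xs k"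
proof -
  have "w \<in> coend (pow_cat (length bs) (quest X A)) (kernel_int X A B \<Phi> (as, bs))"
    using assms by (simp add: kernel_def)
  then obtain p where p: "p \<in> coend_dom (pow_cat (length bs) (quest X A)) (kernel_int X A B \<Phi> (as, bs))"
    "w = coend_cls (pow_cat (length bs) (quest X A)) (kernel_int X A B \<Phi> (as, bs)) p"
    by (rule coendE)
  obtain ds xs k where "p = (ds, xs, k)" by (metis prod_cases3)
  with p show thesis using kernel_int_dom[of ds xs k bs as] that[of ds xs k]
    by (simp add: kernel_el_def del: mem_Sigma_iff)
qed

text \<open>
  As for \<open>bang_prof\<close>, the generating pair of \<open>u\<close> is sent to that of \<open>along u h\<close>; here the naturality of
  reindexing is used under the functor that concatenates.
\<close>

lemma kernel_FM:
  assumes as: "as \<in> lists (Obj A)" and bs: "bs \<in> lists (Obj B)"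
    and as': "as' \<in> lists (Obj A)" and bs': "bs' \<in> lists (Obj B)"
    and w: "w \<in> Hom (qop X A) as' as" and h: "h \<in> Hom (qop X B) bs bs'"
    and el: "length ds = length bs" "ds \<in> lists (lists (Obj A))"
    "length xs = length bs" "\<forall>i<length bs. xs ! i \<in> FO \<Phi> (ds ! i, bs ! i)" "k \<in> Hom (qop X A) as (concat ds)"
  shows "FM (kernel X A B \<Phi>) (as, bs) (as', bs') (w, h) (kernel_el X A B \<Phi> as bs ds xs k) =
    kernel_el X A B \<Phi> as' bs' (along ds h)
      (map (\<lambda>j. FM \<Phi> (ds ! fst (h ! j), bs ! fst (h ! j)) (ds ! fst (h ! j), bs' ! j)
         (Idn (qop X A) (ds ! fst (h ! j)), snd (h ! j)) (xs ! fst (h ! j))) [0..<length bs'])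
      (Cmp (qop X A) as' (concat ds) (concat (along ds h)) (FM bang_mult ds (along ds h) (reindex (qop X A) ds h))
        (Cmp (qop X A) as' as (concat ds) k w))"
proof -
  let ?xs = "\<lambda>ds xs. map (\<lambda>j. FM \<Phi> (ds ! fst (h ! j), bs ! fst (h ! j)) (ds ! fst (h ! j), bs' ! j)
         (Idn (qop X A) (ds ! fst (h ! j)), snd (h ! j)) (xs ! fst (h ! j))) [0..<length bs']"
  let ?m = "\<lambda>ds. FM bang_mult ds (along ds h) (reindex (qop X A) ds h)"
  let ?\<tau> = "\<lambda>(ds, xs, k). (along ds h, ?xs ds xs,
      Cmp (qop X A) as' as (concat (along ds h)) (Cmp (qop X A) as (concat ds) (concat (along ds h)) (?m ds) k) w)"
  let ?\<tau>' = "\<lambda>(dss, xs, k). let dss' = map (\<lambda>(i, _). dss ! i) h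
     in (dss',
         map (\<lambda>j. let (i, g) = h ! j
                   in FM \<Phi> (dss ! i, bs ! i) (dss ! i, bs' ! j)
                        (Idn (quest X A) (dss ! i), g) (xs ! i)) [0..<length h],
         Cmp (quest X A) (concat dss') as as' w
           (Cmp (quest X A) (concat dss') (concat dss) as k
             (FM (op_ftr bang_mult) dss' dss (reindex (quest X A) dss h))))"
  have rQ: "reindex (quest X A) ds h = reindex (qop X A) ds h" for ds
    by (simp add: reindex_def)
  have \<tau>: "?\<tau>' = ?\<tau>"
    by (intro ext) (simp add: split_def Let_def bang_Hom_length[OF h] rQ)
  note hl = bang_Hom_length[OF h] bang_Hom_less[OF h]
  note cc = concat_Obj
  let ?F = "kernel_int X A B \<Phi> (as, bs)" and ?G = "kernel_int X A B \<Phi> (as', bs')"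
  let ?C = "pow_cat (length bs) (quest X A)" and ?C' = "pow_cat (length bs') (quest X A)"
  have "coend_map ?C' ?G ?\<tau> (coend_cls ?C ?F (ds, xs, k)) = coend_cls ?C' ?G (?\<tau> (ds, xs, k))"
  proof (rule coend_map_cls)
    fix p q assume "(p, q) \<in> coend_gen ?C ?F"
    then obtain ds es u xs k where pq:
      "p = (ds, xs, Cmp (qop X A) as (concat es) (concat ds) (FM bang_mult es ds (enumerate 0 u)) k)"
      "q = (es, map (\<lambda>i. FM \<Phi> (ds ! i, bs ! i) (es ! i, bs ! i) (u ! i, Idn B (bs ! i)) (xs ! i)) [0..<length bs], k)"
      and ds: "length ds = length bs" "ds \<in> lists (lists (Obj A))" and es: "length es = length bs" "es \<in> lists (lists (Obj A))"
      and u: "u \<in> Hom (pow_cat (length bs) (qop X A)) es ds"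
      and xs: "length xs = length bs" "\<forall>i<length bs. xs ! i \<in> FO \<Phi> (ds ! i, bs ! i)" and k: "k \<in> Hom (qop X A) as (concat es)"
      unfolding kernel_gen[OF as bs] by blast
    have al: "along ds h \<in> lists (lists (Obj A))" "along es h \<in> lists (lists (Obj A))"
      "length (along ds h) = length bs'" "length (along es h) = length bs'"
      using ds es hl along_lists[OF h ds] along_lists[OF h es] by auto
    have rx: "reindex (qop X A) ds h \<in> Hom (bang X (qop X A)) ds (along ds h)" "reindex (qop X A) es h \<in> Hom (bang X (qop X A)) es (along es h)"
      using reindex_Hom[OF cat_bang h] ds es by auto
    have eu: "enumerate 0 u \<in> Hom (bang X (qop X A)) es ds" using enumerate_Hom[of es ds u "qop X A" X] u ds es by simp
    have uh: "along u h \<in> Hom (pow_cat (length bs') (qop X A)) (along es h) (along ds h)"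
      using along_pow_Hom[OF h u] .
    have euh: "enumerate 0 (along u h) \<in> Hom (bang X (qop X A)) (along es h) (along ds h)"
      by (rule enumerate_Hom) (use uh al in \<open>simp_all only:\<close>)
    note mh = mult_Hom[OF ds(2) al(1) rx(1)] mult_Hom[OF es(2) al(2) rx(2)] mult_Hom[OF es(2) ds(2) eu]
      mult_Hom[OF al(2,1) euh]
    define k' where "k' = Cmp (qop X A) as' as (concat (along es h)) (Cmp (qop X A) as (concat es) (concat (along es h)) (?m es) k) w"
    note o = as as' ds es al(1,2) cc[OF ds(2)] cc[OF es(2)] cc[OF al(1)] cc[OF al(2)]
    have k': "k' \<in> Hom (qop X A) as' (concat (along es h))"
      unfolding k'_def using o k w mh by (intro category_comp[OF cat_bang]) (simp_all only: bang_Obj op_cat_sel)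
    have "Cmp (qop X A) (concat es) (concat ds) (concat (along ds h)) (?m ds) (FM bang_mult es ds (enumerate 0 u)) =
        Cmp (qop X A) (concat es) (concat (along es h)) (concat (along ds h)) (FM bang_mult (along es h) (along ds h) (enumerate 0 (along u h))) (?m es)"
      using mult_Cmp[OF es(2) ds(2) al(1) eu rx(1)] mult_Cmp[OF es(2) al(2,1) rx(2) euh]
        reindex_enumerate[OF cat_bang h es(1) _ ds(1) _ u] ds es by simp
    then have "Cmp (qop X A) as (concat ds) (concat (along ds h)) (?m ds) (Cmp (qop X A) as (concat es) (concat ds) (FM bang_mult es ds (enumerate 0 u)) k) =
        Cmp (qop X A) as (concat (along es h)) (concat (along ds h)) (FM bang_mult (along es h) (along ds h) (enumerate 0 (along u h)))
          (Cmp (qop X A) as (concat es) (concat (along es h)) (?m es) k)"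
      using o k mh by (simp add: category_assoc[OF cat_bang])
    then have 1: "?\<tau> p = (along ds h, ?xs ds xs, Cmp (qop X A) as' (concat (along es h)) (concat (along ds h))
        (FM bang_mult (along es h) (along ds h) (enumerate 0 (along u h))) k')"
      unfolding pq k'_def using o k w mh by (simp add: category_assoc[OF cat_bang, symmetric] category_comp[OF cat_bang])
    have 2: "?\<tau> q = (along es h, map (\<lambda>i. FM \<Phi> (along ds h ! i, bs' ! i) (along es h ! i, bs' ! i)
        (along u h ! i, Idn B (bs' ! i)) (?xs ds xs ! i)) [0..<length bs'], k')"
      unfolding pq k'_def
      using hl bs bs' ds es xs u bang_Hom_snd[OF h] profunctor_comp[OF \<Phi>, simplified]
       category_idl[OF cat_bang] category_idr[OF cat_bang]  category_id[OF cat_bang]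
      by (auto intro!: nth_equalityI simp: nth_Obj[of ds "lists (Obj A)", simplified] nth_Obj[of es "lists (Obj A)", simplified] category_id B
          category_idl[OF B] category_idr[OF B] split_def)
    have "\<forall>i<length bs'. ?xs ds xs ! i \<in> FO \<Phi> (along ds h ! i, bs' ! i)"
      using bs bs' ds xs hl bang_Hom_snd[OF h] category_id[OF cat_bang]
      by (auto simp: nth_Obj[of ds "lists (Obj A)", simplified] split_def intro!: profunctor_app[OF \<Phi>])
    then show "coend_cls ?C' ?G (?\<tau> p) = coend_cls ?C' ?G (?\<tau> q)"
      unfolding 1 2 using kernel_balance[OF as' bs' al(3,1,4,2) uh _ _ k', of "?xs ds xs"]
      by (simp add: kernel_el_def)
  qed
  moreover have "FM (kernel X A B \<Phi>) (as, bs) (as', bs') (w, h) =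
      (\<lambda>z\<in>FO (kernel X A B \<Phi>) (as, bs). coend_map ?C' ?G ?\<tau>' z)"
    by (simp only: kernel_def ftr.select_convs prod.case)
  moreover have "Cmp (qop X A) as' as (concat (along ds h)) (Cmp (qop X A) as (concat ds) (concat (along ds h)) (?m ds) k) w =
      Cmp (qop X A) as' (concat ds) (concat (along ds h)) (?m ds) (Cmp (qop X A) as' as (concat ds) k w)"
  proof -
    have al: "along ds h \<in> lists (lists (Obj A))" using along_lists[OF h el(1,2)] .
    have "reindex (qop X A) ds h \<in> Hom (bang X (qop X A)) ds (along ds h)" using reindex_Hom[OF cat_bang h el(1)] el by auto
    note mh = mult_Hom[OF el(2) al this]
    show ?thesis
      by (rule category_assoc[OF cat_bang, symmetric]) (use as as' w el mh cc[OF el(2)] cc[OF al] in \<open>simp_all only: bang_Obj op_cat_sel\<close>)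
  qed
  ultimately show ?thesis
    using kernel_el_in[OF el] unfolding \<tau> by (simp add: kernel_el_def)
qed

lemma kernel_int_app:
  assumes as: "as \<in> lists (Obj A)" and bs: "bs \<in> lists (Obj B)"
    and C: "C = pow_cat (length bs) (quest X A)"
    and o: "ds \<in> Obj C" "es \<in> Obj C" "ds' \<in> Obj C" "es' \<in> Obj C" "u \<in> Hom C ds' ds" "v \<in> Hom C es es'"
    and x: "x \<in> FO (kernel_int X A B \<Phi> (as, bs)) (ds, es)"
  shows "FM (kernel_int X A B \<Phi> (as, bs)) (ds, es) (ds', es') (u, v) x \<in> FO (kernel_int X A B \<Phi> (as, bs)) (ds', es')"
proof -
  obtain xs k where e: "x = (xs, k)" by force
  have ds: "ds \<in> lists (lists (Obj A))" "ds' \<in> lists (lists (Obj A))" "length ds = length bs" "length ds' = length bs"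
    and es: "length es = length bs" "length es' = length bs"
    using o by (simp_all add: C)
  have k: "k \<in> Hom (qop X A) as (concat ds)" and xs: "\<forall>i<length bs. xs ! i \<in> FO \<Phi> (es ! i, bs ! i)"
    using x es by (simp_all add: e kernel_int_def in_listset)
  have eu: "enumerate 0 u \<in> Hom (bang X (qop X A)) ds ds'" using enumerate_Hom[of ds ds' u "qop X A" X] o by (simp add: C)
  have "Cmp (qop X A) as (concat ds) (concat ds') (FM bang_mult ds ds' (enumerate 0 u)) k \<in> Hom (qop X A) as (concat ds')"
    by (rule category_comp[OF cat_bang])
      (use as concat_Obj[OF ds(1)] concat_Obj[OF ds(2)] mult_Hom[OF ds(1,2) eu] k
        in \<open>simp_all only: bang_Obj op_cat_sel\<close>)
  moreover have "FM \<Phi> (es ! i, bs ! i) (es' ! i, bs ! i) (v ! i, Idn B (bs ! i)) (xs ! i) \<in> FO \<Phi> (es' ! i, bs ! i)" if "i < length bs" for i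
    by (rule profunctor_app[OF \<Phi>])
      (use that o xs nth_Obj[of es "lists (Obj A)" i] nth_Obj[of es' "lists (Obj A)" i] nth_Obj[OF bs, of i] category_id[OF B]
        in \<open>simp_all add: C\<close>)
  ultimately show ?thesis using x es by (simp add: e kernel_int_def in_listset)
qed

lemma quest_prof_FO: "FO (quest_prof X (quest X A) B \<Phi>) (dss, bs) = FO (bang_prof X (op_cat B) (qop X A) (prof_op \<Phi>)) (bs, dss)"
  by (simp add: quest_prof_def prof_op_def)

lemma quest_prof_FM: "FM (quest_prof X (quest X A) B \<Phi>) (dss, bs) (dss', bs') (u, v) =
    FM (bang_prof X (op_cat B) (qop X A) (prof_op \<Phi>)) (bs, dss) (bs', dss') (v, u)"
proof -
  have "FM (prof_op \<Theta>) (dss, bs) (dss', bs') (u, v) = FM \<Theta> (bs, dss) (bs', dss') (v, u)" for \<Theta> :: "('a, 'b, 'c, 'd, 'e) prof"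
    and dss bs dss' bs' u v
    by (simp add: prof_op_def)
  then show ?thesis by (simp add: quest_prof_def)
qed

lemma profunctor_quest_prof: "profunctor (quest X (quest X A)) (quest X B) (quest_prof X (quest X A) B \<Phi>)"
  using profunctor_op[OF cat_bang_B cat_bang_bang profunctor_bang_prof[OF category_op[OF B] cat_bang prof_op_\<Phi>]]
  by (simp add: quest_prof_def quest_def)

lemma comult_FO: "FO (comult X A) (as, dss) = Hom (qop X A) as (concat dss)"
  by (simp add: comult_def rep_prof_def)

lemma comult_FM:
  assumes "k \<in> Hom (qop X A) as (concat dss)"
  shows "FM (comult X A) (as, dss) (as', dss') (w, u) k =
    Cmp (qop X A) as' as (concat dss') (Cmp (qop X A) as (concat dss) (concat dss') (FM bang_mult dss dss' u) k) w"
  using assms by (simp add: comult_def rep_prof_def)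

lemma profunctor_comult: "profunctor (quest X A) (quest X (quest X A)) (comult X A)"
proof -
  have "is_functor (quest X (quest X A)) (quest X A) (op_ftr bang_mult)"
    using functor_op[OF functor_bang_mult[OF category_op[OF A], of X]] by (simp add: quest_def)
  then show ?thesis unfolding comult_def by (intro profunctor_rep_prof cat_quest)
qed

lemmas comp_facts = cat_quest(1,2,3) profunctor_comult profunctor_quest_prof

lemma profunctor_quest_ext: "profunctor (quest X A) (quest X B) (quest_ext X A B \<Phi>)"
  unfolding quest_ext_def by (intro profunctor_prof_comp comp_facts)

definition admissible where
  "admissible bs ess xs \<longleftrightarrow> bs \<in> lists (Obj B) \<and> length ess = length bs \<and> ess \<in> lists (lists (Obj A)) \<and>
     length xs = length bs \<and> (\<forall>i<length bs. xs ! i \<in> FO \<Phi> (ess ! i, bs ! i))"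

lemma inner_in:
  assumes "admissible bs ess xs" "dss \<in> lists (lists (Obj A))" "h \<in> Hom (bang X (qop X A)) dss ess"
  shows "bang_prof_el X (op_cat B) (qop X A) (prof_op \<Phi>) bs dss ess xs h \<in> FO (quest_prof X (quest X A) B \<Phi>) (dss, bs)"
  unfolding quest_prof_FO using assms by (intro bang_prof_el_in) (auto simp: admissible_def prof_op_def)

lemma inner_FM_right:
  assumes "admissible bs ess xs" "dss \<in> lists (lists (Obj A))" "h \<in> Hom (bang X (qop X A)) dss ess"
    and "dss' \<in> lists (lists (Obj A))" "u \<in> Hom (bang X (qop X A)) dss' dss"
  shows "FM (quest_prof X (quest X A) B \<Phi>) (dss, bs) (dss', bs) (u, Idn (qop X B) bs)
      (bang_prof_el X (op_cat B) (qop X A) (prof_op \<Phi>) bs dss ess xs h) =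
    bang_prof_el X (op_cat B) (qop X A) (prof_op \<Phi>) bs dss' ess xs (Cmp (bang X (qop X A)) dss' dss ess h u)"
  unfolding quest_prof_FM
  by (rule bang_prof_FM_right[OF category_op[OF B] cat_bang prof_op_\<Phi>])
    (use assms in \<open>auto simp: admissible_def prof_op_def\<close>)

text \<open>
  The inner coends are indexed by opposite categories, but have the same generating pairs up to
  concatenation, because concatenation sends \<open>enumerate 0 u \<circ> h\<close> to a composite.
\<close>

lemma kernel_of_inner_el:
  assumes as: "as \<in> lists (Obj A)" and bs: "bs \<in> lists (Obj B)" and dss: "dss \<in> lists (lists (Obj A))"
    and k: "k \<in> Hom (qop X A) as (concat dss)"
  shows "kernel_of_inner X A B \<Phi> as bs dss k (bang_prof_el X (op_cat B) (qop X A) (prof_op \<Phi>) bs dss ess xs h) =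
    kernel_el X A B \<Phi> as bs ess xs (Cmp (qop X A) as (concat dss) (concat ess) (FM bang_mult dss ess h) k)"
proof -
  let ?\<tau> = "\<lambda>(ess, xs, h). (ess, xs, Cmp (qop X A) as (concat dss) (concat ess) (FM bang_mult dss ess h) k)"
  let ?G = "coend_cls (pow_cat (length bs) (quest X A)) (kernel_int X A B \<Phi> (as, bs))"
  have "coend_map (pow_cat (length bs) (quest X A)) (kernel_int X A B \<Phi> (as, bs)) ?\<tau>
      (coend_cls (pow_cat (length bs) (qop X A)) (bang_prof_int X (op_cat B) (qop X A) (prof_op \<Phi>) (bs, dss)) (ess, xs, h)) =
    ?G (?\<tau> (ess, xs, h))"
  proof (rule coend_map_cls)
    fix p q assume "(p, q) \<in> coend_gen (pow_cat (length bs) (qop X A)) (bang_prof_int X (op_cat B) (qop X A) (prof_op \<Phi>) (bs, dss))"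
    moreover have "bs \<in> lists (Obj (op_cat B))" "dss \<in> lists (Obj (qop X A))" using bs dss by simp_all
    ultimately obtain ds es u xs h where pq:
      "p = (ds, map (\<lambda>i. FM (prof_op \<Phi>) (bs ! i, es ! i) (bs ! i, ds ! i) (Idn (op_cat B) (bs ! i), u ! i) (xs ! i)) [0..<length bs], h)"
      "q = (es, xs, Cmp (bang X (qop X A)) dss ds es (enumerate 0 u) h)"
      and ds: "length ds = length bs" "ds \<in> lists (Obj (qop X A))" and es: "length es = length bs" "es \<in> lists (Obj (qop X A))"
      and u: "u \<in> Hom (pow_cat (length bs) (qop X A)) ds es"
      and xs: "length xs = length bs" "\<forall>i<length bs. xs ! i \<in> FO (prof_op \<Phi>) (bs ! i, es ! i)"
      and h: "h \<in> Hom (bang X (qop X A)) dss ds"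
      unfolding bang_prof_gen[OF category_op[OF B] cat_bang prof_op_\<Phi>
          \<open>bs \<in> lists (Obj (op_cat B))\<close> \<open>dss \<in> lists (Obj (qop X A))\<close>] by blast
    note ds = ds[unfolded bang_Obj op_cat_sel] and es = es[unfolded bang_Obj op_cat_sel]
    have eu: "enumerate 0 u \<in> Hom (bang X (qop X A)) ds es" using enumerate_Hom[of ds es u "qop X A" X] u ds es by simp
    define k' where "k' = Cmp (qop X A) as (concat dss) (concat ds) (FM bang_mult dss ds h) k"
    note mh = mult_Hom[OF dss ds(2) h] mult_Hom[OF ds(2) es(2) eu]
    note cc = concat_Obj[OF dss] concat_Obj[OF ds(2)] concat_Obj[OF es(2)]
    have k': "k' \<in> Hom (qop X A) as (concat ds)"
      unfolding k'_def by (rule category_comp[OF cat_bang]) (use as cc mh k in \<open>simp_all only: bang_Obj op_cat_sel\<close>)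
    have "?\<tau> q = (es, xs, Cmp (qop X A) as (concat ds) (concat es) (FM bang_mult ds es (enumerate 0 u)) k')"
      unfolding pq k'_def using as cc mh k by (simp add: mult_Cmp[OF dss ds(2) es(2) h eu] category_assoc[OF cat_bang])
    moreover have "?\<tau> p = (ds, map (\<lambda>i. FM \<Phi> (es ! i, bs ! i) (ds ! i, bs ! i) (u ! i, Idn B (bs ! i)) (xs ! i)) [0..<length bs], k')"
      unfolding pq k'_def by (simp add: prof_op_def)
    ultimately show "?G (?\<tau> p) = ?G (?\<tau> q)"
      using kernel_balance[OF as bs es ds u xs(1) _ k'] xs(2) by (simp add: kernel_el_def prof_op_def)
  qed
  then show ?thesis by (simp add: kernel_of_inner_def bang_prof_el_def kernel_el_def)
qed

lemma bang_prof_elE: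
  assumes "c \<in> FO (quest_prof X (quest X A) B \<Phi>) (dss, bs)" "bs \<in> lists (Obj B)"
  obtains ess xs h where "admissible bs ess xs" "h \<in> Hom (bang X (qop X A)) dss ess"
    "c = bang_prof_el X (op_cat B) (qop X A) (prof_op \<Phi>) bs dss ess xs h"
  using assms(1) unfolding quest_prof_FO
  by (rule bang_profE) (use assms(2) that in \<open>auto simp: admissible_def prof_op_def\<close>)

text \<open>
  Both sides of a generating pair of the outer coend, given by \<open>u\<close>, have the value
  \<open>[ess, xs, k \<circ> concat u \<circ> concat h] = [ess, xs, k \<circ> concat (u \<circ> h)]\<close>, composed as in \<open>?A\<close>.
\<close>

lemma kernel_of_el:
  assumes as: "as \<in> lists (Obj A)" and bs: "bs \<in> lists (Obj B)" and dss: "dss \<in> lists (lists (Obj A))"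
    and k: "k \<in> Hom (qop X A) as (concat dss)"
  shows "kernel_of X A B \<Phi> as bs (quest_ext_el X A B \<Phi> as bs dss ess xs h k) =
    kernel_el X A B \<Phi> as bs ess xs (Cmp (qop X A) as (concat dss) (concat ess) (FM bang_mult dss ess h) k)"
proof -
  let ?T = "\<lambda>(dss, c, k). kernel_of_inner X A B \<Phi> as bs dss k c"
  let ?F = "prof_comp_int (quest X A) (quest X B) (quest_prof X (quest X A) B \<Phi>) (comult X A) (as, bs)"
  let ?c = "bang_prof_el X (op_cat B) (qop X A) (prof_op \<Phi>) bs dss ess xs h"
  have "(\<Union>p\<in>coend_cls (quest X (quest X A)) ?F (dss, ?c, k). ?T p) = ?T (dss, ?c, k)"
  proof (rule coend_lift)
    fix p q assume "(p, q) \<in> coend_gen (quest X (quest X A)) ?F"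
    moreover have "as \<in> Obj (quest X A)" "bs \<in> Obj (quest X B)" using as bs by simp_all
    ultimately obtain dss dss' u c k where pq:
      "p = (dss, c, FM (comult X A) (as, dss') (as, dss) (Idn (quest X A) as, u) k)"
      "q = (dss', FM (quest_prof X (quest X A) B \<Phi>) (dss, bs) (dss', bs) (u, Idn (quest X B) bs) c, k)"
      and **: "dss \<in> Obj (quest X (quest X A))" "dss' \<in> Obj (quest X (quest X A))" "u \<in> Hom (quest X (quest X A)) dss dss'"
        "c \<in> FO (quest_prof X (quest X A) B \<Phi>) (dss, bs)" "k \<in> FO (comult X A) (as, dss')"
      unfolding prof_comp_gen[OF comp_facts \<open>as \<in> Obj (quest X A)\<close> \<open>bs \<in> Obj (quest X B)\<close>] by blast
    note pq = pq[unfolded quest_sel] and * = **[unfolded quest_sel op_quest]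
    have k: "k \<in> Hom (qop X A) as (concat dss')" using *(5) by (simp add: comult_FO)
    obtain ess xs h where c: "admissible bs ess xs" and h: "h \<in> Hom (bang X (qop X A)) dss ess"
      "c = bang_prof_el X (op_cat B) (qop X A) (prof_op \<Phi>) bs dss ess xs h"
      by (rule bang_prof_elE[OF *(4) bs])
    have ess: "ess \<in> lists (lists (Obj A))" using c by (simp add: admissible_def)
    note mh = mult_Hom[OF *(2,1,3)] mult_Hom[OF *(1) ess h(1)]
    note cc = concat_Obj[OF *(1)] concat_Obj[OF *(2)] concat_Obj[OF ess]
    define k' where "k' = Cmp (qop X A) as (concat dss') (concat dss) (FM bang_mult dss' dss u) k"
    have k': "k' \<in> Hom (qop X A) as (concat dss)"
      unfolding k'_def by (rule category_comp[OF cat_bang]) (use as cc mh k in \<open>simp_all only: bang_Obj op_cat_sel\<close>)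
    have "p = (dss, c, k')"
      unfolding pq using k k' as cc by (simp add: comult_FM k'_def[symmetric] category_idr[OF cat_bang])
    then have "?T p = kernel_el X A B \<Phi> as bs ess xs (Cmp (qop X A) as (concat dss) (concat ess) (FM bang_mult dss ess h) k')"
      unfolding h by (simp add: kernel_of_inner_el[OF as bs *(1) k'])
    also have "Cmp (qop X A) as (concat dss) (concat ess) (FM bang_mult dss ess h) k' =
        Cmp (qop X A) as (concat dss') (concat ess) (FM bang_mult dss' ess (Cmp (bang X (qop X A)) dss' dss ess h u)) k"
      unfolding k'_def using as cc mh k by (simp add: mult_Cmp[OF *(2,1) ess *(3) h(1)] category_assoc[OF cat_bang])
    also have "kernel_el X A B \<Phi> as bs ess xs \<dots> = ?T q"
      unfolding pq h inner_FM_right[OF c *(1) h(1) *(2,3)] by (simp add: kernel_of_inner_el[OF as bs *(2) k])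
    finally show "?T p = ?T q" .
  qed
  then show ?thesis
    unfolding kernel_of_def quest_ext_el_def prof_comp_el_def
    by (simp add: kernel_of_inner_el[OF as bs dss k])
qed

lemma quest_ext_el_in:
  assumes "admissible bs ess xs" "dss \<in> lists (lists (Obj A))" "h \<in> Hom (bang X (qop X A)) dss ess"
    "k \<in> Hom (qop X A) as (concat dss)"
  shows "quest_ext_el X A B \<Phi> as bs dss ess xs h k \<in> FO (quest_ext X A B \<Phi>) (as, bs)"
  unfolding quest_ext_el_def quest_ext_def
  by (rule prof_comp_el_in) (use assms inner_in in \<open>auto simp: comult_FO\<close>)

lemma quest_extE:
  assumes "w \<in> FO (quest_ext X A B \<Phi>) (as, bs)" "bs \<in> lists (Obj B)"
  obtains dss ess xs h k where "admissible bs ess xs" "dss \<in> lists (lists (Obj A))" "h \<in> Hom (bang X (qop X A)) dss ess"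
    "k \<in> Hom (qop X A) as (concat dss)" "w = quest_ext_el X A B \<Phi> as bs dss ess xs h k"
proof -
  from assms(1) obtain dss c k where *: "dss \<in> Obj (quest X (quest X A))" "c \<in> FO (quest_prof X (quest X A) B \<Phi>) (dss, bs)"
    "k \<in> FO (comult X A) (as, dss)"
    "w = prof_comp_el (quest X A) (quest X (quest X A)) (quest X B) (quest_prof X (quest X A) B \<Phi>) (comult X A) (as, bs) dss c k"
    unfolding quest_ext_def by (rule prof_compE)
  obtain ess xs h where "admissible bs ess xs" "h \<in> Hom (bang X (qop X A)) dss ess"
    "c = bang_prof_el X (op_cat B) (qop X A) (prof_op \<Phi>) bs dss ess xs h"
    by (rule bang_prof_elE[OF *(2) assms(2)])
  with * show thesis by (intro that[of ess xs dss h k]) (auto simp: quest_ext_el_def comult_FO)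
qed

text \<open>
  The co-Yoneda lemma: for \<open>h\<close> the identity, the equation read from right to left yields a representative with
  \<open>dss = ess\<close> and the identity as the morphism between them.
\<close>

lemma quest_ext_slide:
  assumes as: "as \<in> lists (Obj A)" and ad: "admissible bs ess xs"
    and dss: "dss \<in> lists (lists (Obj A))" and dss': "dss' \<in> lists (lists (Obj A))"
    and h: "h \<in> Hom (bang X (qop X A)) dss ess" and u: "u \<in> Hom (bang X (qop X A)) dss' dss"
    and k: "k \<in> Hom (qop X A) as (concat dss')"
  shows "quest_ext_el X A B \<Phi> as bs dss ess xs h (Cmp (qop X A) as (concat dss') (concat dss) (FM bang_mult dss' dss u) k) =
    quest_ext_el X A B \<Phi> as bs dss' ess xs (Cmp (bang X (qop X A)) dss' dss ess h u) k"
proof -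
  have bs: "bs \<in> lists (Obj B)" using ad by (simp add: admissible_def)
  define k' where "k' = Cmp (qop X A) as (concat dss') (concat dss) (FM bang_mult dss' dss u) k"
  have k': "k' \<in> Hom (qop X A) as (concat dss)"
    unfolding k'_def
    by (rule category_comp[OF cat_bang])
      (use as concat_Obj[OF dss] concat_Obj[OF dss'] mult_Hom[OF dss' dss u] k in \<open>simp_all only: bang_Obj op_cat_sel\<close>)
  have e: "FM (comult X A) (as, dss') (as, dss) (Idn (qop X A) as, u) k = k'"
    using k k' as concat_Obj[OF dss] by (simp add: comult_FM k'_def[symmetric] category_idr[OF cat_bang])
  show ?thesis
    using prof_comp_balance[OF comp_facts, of as bs dss dss' u "bang_prof_el X (op_cat B) (qop X A) (prof_op \<Phi>) bs dss ess xs h" k]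
      as bs dss dss' u inner_in[OF ad dss h] k
    unfolding quest_ext_el_def k'_def[symmetric] by (simp add: comult_FO e inner_FM_right[OF ad dss h dss' u])
qed

text \<open>
  A generating pair of the kernel is resolved in two steps: \<open>enumerate 0 u\<close> slides across the outer
  coend, and is then absorbed in the inner one.
\<close>

lemma ext_of_el:
  assumes as: "as \<in> lists (Obj A)" and bs: "bs \<in> lists (Obj B)"
  shows "ext_of X A B \<Phi> as bs (kernel_el X A B \<Phi> as bs ess xs k) =
    quest_ext_el X A B \<Phi> as bs ess ess xs (Idn (bang X (qop X A)) ess) k"
proof -
  let ?T = "\<lambda>(ess, xs, k). quest_ext_el X A B \<Phi> as bs ess ess xs (Idn (bang X (qop X A)) ess) k"
  have "(\<Union>p\<in>coend_cls (pow_cat (length bs) (quest X A)) (kernel_int X A B \<Phi> (as, bs)) (ess, xs, k). ?T p) = ?T (ess, xs, k)"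
  proof (rule coend_lift)
    fix p q assume "(p, q) \<in> coend_gen (pow_cat (length bs) (quest X A)) (kernel_int X A B \<Phi> (as, bs))"
    then obtain ds es u xs k where pq:
      "p = (ds, xs, Cmp (qop X A) as (concat es) (concat ds) (FM bang_mult es ds (enumerate 0 u)) k)"
      "q = (es, map (\<lambda>i. FM \<Phi> (ds ! i, bs ! i) (es ! i, bs ! i) (u ! i, Idn B (bs ! i)) (xs ! i)) [0..<length bs], k)"
      and ds: "length ds = length bs" "ds \<in> lists (lists (Obj A))" and es: "length es = length bs" "es \<in> lists (lists (Obj A))"
      and u: "u \<in> Hom (pow_cat (length bs) (qop X A)) es ds"
      and xs: "length xs = length bs" "\<forall>i<length bs. xs ! i \<in> FO \<Phi> (ds ! i, bs ! i)" and k: "k \<in> Hom (qop X A) as (concat es)"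
      unfolding kernel_gen[OF as bs] by blast
    have eu: "enumerate 0 u \<in> Hom (bang X (qop X A)) es ds" using enumerate_Hom[of es ds u "qop X A" X] u ds es by simp
    have ad: "admissible bs ds xs" using bs ds xs by (simp add: admissible_def)
    have id: "Idn (bang X (qop X A)) ds \<in> Hom (bang X (qop X A)) ds ds" "Idn (bang X (qop X A)) es \<in> Hom (bang X (qop X A)) es es"
      using ds es by (simp_all add: category_id[OF cat_bang_bang])
    have "?T p = quest_ext_el X A B \<Phi> as bs es ds xs (enumerate 0 u) k"
      unfolding pq using quest_ext_slide[OF as ad ds(2) es(2) id(1) eu k] category_idl[OF cat_bang_bang _ _ eu] ds es by simp
    also have "bang_prof_el X (op_cat B) (qop X A) (prof_op \<Phi>) bs es ds xs (enumerate 0 u) =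
      bang_prof_el X (op_cat B) (qop X A) (prof_op \<Phi>) bs es es
        (map (\<lambda>i. FM (prof_op \<Phi>) (bs ! i, ds ! i) (bs ! i, es ! i) (Idn (op_cat B) (bs ! i), u ! i) (xs ! i)) [0..<length bs])
        (Idn (bang X (qop X A)) es)"
      using bang_prof_balance[OF category_op[OF B] cat_bang prof_op_\<Phi>, of bs es es ds u xs "Idn (bang X (qop X A)) es" X]
        bs ds es u xs id category_idr[OF cat_bang_bang _ _ eu] by (simp add: prof_op_def)
    then have "quest_ext_el X A B \<Phi> as bs es ds xs (enumerate 0 u) k = ?T q"
      unfolding pq quest_ext_el_def by (simp add: prof_op_def)
    finally show "?T p = ?T q" .
  qed
  then show ?thesis unfolding ext_of_def kernel_el_def by simp
qed

lemma kernel_of_bij: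
  assumes as: "as \<in> lists (Obj A)" and bs: "bs \<in> lists (Obj B)"
  shows "bij_betw (kernel_of X A B \<Phi> as bs) (FO (quest_ext X A B \<Phi>) (as, bs)) (FO (kernel X A B \<Phi>) (as, bs))"
proof (rule bij_betwI[where g = "ext_of X A B \<Phi> as bs"])
  show "kernel_of X A B \<Phi> as bs \<in> FO (quest_ext X A B \<Phi>) (as, bs) \<rightarrow> FO (kernel X A B \<Phi>) (as, bs)"
  proof
    fix w assume "w \<in> FO (quest_ext X A B \<Phi>) (as, bs)"
    then obtain dss ess xs h k where *: "admissible bs ess xs" "dss \<in> lists (lists (Obj A))"
      "h \<in> Hom (bang X (qop X A)) dss ess" "k \<in> Hom (qop X A) as (concat dss)" "w = quest_ext_el X A B \<Phi> as bs dss ess xs h k"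
      using bs by (rule quest_extE)
    have ess: "ess \<in> lists (lists (Obj A))" using * by (simp add: admissible_def)
    have "Cmp (qop X A) as (concat dss) (concat ess) (FM bang_mult dss ess h) k \<in> Hom (qop X A) as (concat ess)"
      by (rule category_comp[OF cat_bang])
       (use as concat_Obj[OF ess] concat_Obj[OF *(2)] mult_Hom[OF *(2) ess *(3)] *(4) in \<open>simp_all only: bang_Obj op_cat_sel\<close>)
    then show "kernel_of X A B \<Phi> as bs w \<in> FO (kernel X A B \<Phi>) (as, bs)"
      unfolding *(5) kernel_of_el[OF as bs *(2,4)]
      using * by (intro kernel_el_in) (auto simp: admissible_def)
  qed
  show "ext_of X A B \<Phi> as bs \<in> FO (kernel X A B \<Phi>) (as, bs) \<rightarrow> FO (quest_ext X A B \<Phi>) (as, bs)"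
  proof
    fix c assume "c \<in> FO (kernel X A B \<Phi>) (as, bs)"
    then obtain ess xs k where *: "length ess = length bs" "ess \<in> lists (lists (Obj A))"
      "length xs = length bs" "\<forall>i<length bs. xs ! i \<in> FO \<Phi> (ess ! i, bs ! i)" "k \<in> Hom (qop X A) as (concat ess)"
      "c = kernel_el X A B \<Phi> as bs ess xs k"
      by (rule kernelE)
    then show "ext_of X A B \<Phi> as bs c \<in> FO (quest_ext X A B \<Phi>) (as, bs)"
      using bs by (simp add: ext_of_el[OF as bs] quest_ext_el_in admissible_def category_id[OF cat_bang_bang])
  qed
  show "ext_of X A B \<Phi> as bs (kernel_of X A B \<Phi> as bs w) = w" if w: "w \<in> FO (quest_ext X A B \<Phi>) (as, bs)" for w
  proof -
    obtain dss ess xs h k where *: "admissible bs ess xs" "dss \<in> lists (lists (Obj A))"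
      "h \<in> Hom (bang X (qop X A)) dss ess" "k \<in> Hom (qop X A) as (concat dss)" "w = quest_ext_el X A B \<Phi> as bs dss ess xs h k"
      by (rule quest_extE[OF w bs])
    have ess: "ess \<in> lists (lists (Obj A))" using * by (simp add: admissible_def)
    have id: "Idn (bang X (qop X A)) ess \<in> Hom (bang X (qop X A)) ess ess"
      using ess by (simp add: category_id[OF cat_bang_bang])
    show ?thesis
      unfolding *(5) kernel_of_el[OF as bs *(2,4)] ext_of_el[OF as bs] quest_ext_slide[OF as *(1) ess *(2) id *(3,4)]
      using category_idl[OF cat_bang_bang _ _ *(3)] *(2) ess by simp
  qed
  show "kernel_of X A B \<Phi> as bs (ext_of X A B \<Phi> as bs c) = c" if c: "c \<in> FO (kernel X A B \<Phi>) (as, bs)" for c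
  proof -
    obtain ess xs k where *: "length ess = length bs" "ess \<in> lists (lists (Obj A))"
      "length xs = length bs" "\<forall>i<length bs. xs ! i \<in> FO \<Phi> (ess ! i, bs ! i)" "k \<in> Hom (qop X A) as (concat ess)"
      "c = kernel_el X A B \<Phi> as bs ess xs k"
      using c by (rule kernelE)
    show ?thesis
      unfolding *(6) ext_of_el[OF as bs] kernel_of_el[OF as bs *(2,5)] mult_Idn[OF *(2)]
      using category_idl[OF cat_bang _ _ *(5)] as concat_Obj[OF *(2)] by simp
  qed
qed

lemma kernel_of_natural:
  assumes as: "as \<in> lists (Obj A)" and bs: "bs \<in> lists (Obj B)"
    and as': "as' \<in> lists (Obj A)" and bs': "bs' \<in> lists (Obj B)"
    and w: "w \<in> Hom (qop X A) as' as" and v: "v \<in> Hom (qop X B) bs bs'"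
    and z: "z \<in> FO (quest_ext X A B \<Phi>) (as, bs)"
  shows "kernel_of X A B \<Phi> as' bs' (FM (quest_ext X A B \<Phi>) (as, bs) (as', bs') (w, v) z) =
    FM (kernel X A B \<Phi>) (as, bs) (as', bs') (w, v) (kernel_of X A B \<Phi> as bs z)"
proof -
  obtain dss ess xs h k where ad: "admissible bs ess xs" and dss: "dss \<in> lists (lists (Obj A))"
    and h: "h \<in> Hom (bang X (qop X A)) dss ess" and k: "k \<in> Hom (qop X A) as (concat dss)"
    and z': "z = quest_ext_el X A B \<Phi> as bs dss ess xs h k"
    by (rule quest_extE[OF z bs])
  have ess: "ess \<in> lists (lists (Obj A))" "length ess = length bs" and
    xs: "length xs = length bs" "\<forall>i<length bs. xs ! i \<in> FO \<Phi> (ess ! i, bs ! i)"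
    using ad by (simp_all add: admissible_def)
  have al: "along ess v \<in> lists (lists (Obj A))" using along_lists[OF v ess(2,1)] .
  have rx: "reindex (qop X A) ess v \<in> Hom (bang X (qop X A)) ess (along ess v)"
    using reindex_Hom[OF cat_bang v ess(2)] ess by simp
  define xs' where "xs' = map (\<lambda>j. FM \<Phi> (ess ! fst (v ! j), bs ! fst (v ! j)) (ess ! fst (v ! j), bs' ! j)
         (Idn (qop X A) (ess ! fst (v ! j)), snd (v ! j)) (xs ! fst (v ! j))) [0..<length bs']"
  have id: "Idn (bang X (qop X A)) dss \<in> Hom (bang X (qop X A)) dss dss"
    using dss by (simp add: category_id[OF cat_bang_bang])
  have hi: "Cmp (bang X (qop X A)) dss dss ess h (Idn (bang X (qop X A)) dss) = h"
    using category_idr[OF cat_bang_bang _ _ h] dss ess by simp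
  define h' where "h' = Cmp (bang X (qop X A)) dss ess (along ess v) (reindex (qop X A) ess v) h"
  have inner: "FM (quest_prof X (quest X A) B \<Phi>) (dss, bs) (dss, bs') (Idn (bang X (qop X A)) dss, v)
      (bang_prof_el X (op_cat B) (qop X A) (prof_op \<Phi>) bs dss ess xs h) =
    bang_prof_el X (op_cat B) (qop X A) (prof_op \<Phi>) bs' dss (along ess v) xs' h'"
    unfolding quest_prof_FM xs'_def h'_def
    using bang_prof_FM[OF category_op[OF B] cat_bang prof_op_\<Phi>, of bs dss bs' dss v X "Idn (bang X (qop X A)) dss" ess xs h]
      bs bs' dss v id ess xs h by (simp add: prof_op_def hi)
  define k' where "k' = Cmp (qop X A) as' as (concat dss) k w"
  have k': "k' \<in> Hom (qop X A) as' (concat dss)"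
    unfolding k'_def by (rule category_comp[OF cat_bang])
      (use as as' concat_Obj[OF dss] k w in \<open>simp_all only: bang_Obj op_cat_sel\<close>)
  have "FM (comult X A) (as, dss) (as', dss) (w, Idn (bang X (qop X A)) dss) k = k'"
    using k as concat_Obj[OF dss] by (simp add: comult_FM k'_def mult_Idn[OF dss] category_idl[OF cat_bang])
  then have "FM (quest_ext X A B \<Phi>) (as, bs) (as', bs') (w, v) z = quest_ext_el X A B \<Phi> as' bs' dss (along ess v) xs' h' k'"
    unfolding z' quest_ext_def quest_ext_el_def
    using prof_comp_FM[OF comp_facts, of as bs as' bs' w v dss "bang_prof_el X (op_cat B) (qop X A) (prof_op \<Phi>) bs dss ess xs h" k]
      as as' bs bs' dss w v inner_in[OF ad dss h] k inner by (simp add: comult_FO)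
  then have "kernel_of X A B \<Phi> as' bs' (FM (quest_ext X A B \<Phi>) (as, bs) (as', bs') (w, v) z) =
      kernel_el X A B \<Phi> as' bs' (along ess v) xs' (Cmp (qop X A) as' (concat dss) (concat (along ess v)) (FM bang_mult dss (along ess v) h') k')"
    by (simp add: kernel_of_el[OF as' bs' dss k'])
  also have "Cmp (qop X A) as' (concat dss) (concat (along ess v)) (FM bang_mult dss (along ess v) h') k' =
      Cmp (qop X A) as' (concat ess) (concat (along ess v)) (FM bang_mult ess (along ess v) (reindex (qop X A) ess v))
        (Cmp (qop X A) as' as (concat ess) (Cmp (qop X A) as (concat dss) (concat ess) (FM bang_mult dss ess h) k) w)"
    unfolding h'_def k'_def mult_Cmp[OF dss ess(1) al h rx]
    using mult_Hom[OF dss ess(1) h] mult_Hom[OF ess(1) al rx] concat_Obj[OF dss] concat_Obj[OF ess(1)] concat_Obj[OF al] as as' k w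
    by (simp add: category_assoc[OF cat_bang, symmetric] category_comp[OF cat_bang])
  also have "kernel_el X A B \<Phi> as' bs' (along ess v) xs' \<dots> =
      FM (kernel X A B \<Phi>) (as, bs) (as', bs') (w, v) (kernel_el X A B \<Phi> as bs ess xs
        (Cmp (qop X A) as (concat dss) (concat ess) (FM bang_mult dss ess h) k))"
    unfolding xs'_def
  proof (rule kernel_FM[OF as bs as' bs' w v ess(2,1) xs, symmetric])
    show "Cmp (qop X A) as (concat dss) (concat ess) (FM bang_mult dss ess h) k \<in> Hom (qop X A) as (concat ess)"
      by (rule category_comp[OF cat_bang])
        (use as concat_Obj[OF dss] concat_Obj[OF ess(1)] k mult_Hom[OF dss ess(1) h] in \<open>simp_all only: bang_Obj op_cat_sel\<close>)
  qed
  finally show ?thesis unfolding z' kernel_of_el[OF as bs dss k] .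
qed

lemma kernel_of_iso: "prof_iso (quest X A) (quest X B) (quest_ext X A B \<Phi>) (kernel X A B \<Phi>) id_ftr id_ftr (kernel_of X A B \<Phi>)"
  unfolding prof_iso_def by (simp add: kernel_of_bij kernel_of_natural del: in_lists_conv_set)

lemma profunctor_kernel: "profunctor (quest X A) (quest X B) (kernel X A B \<Phi>)"
  by (rule profunctor_transport[OF cat_quest(1,3,1,3) profunctor_quest_ext cat_iso_id cat_iso_id kernel_of_iso])
    (simp add: kernel_def)

end

text \<open>
  All three parts of the theorem are instances of this statement, which composes \<open>kernel_of\<close> with a
  further natural bijection \<open>\<beta>\<close> out of the kernel.
\<close>

lemma cokl_comp_iso:
  fixes \<Phi> :: "('o list, (nat \<times> 'm) list, 'p, 'n, 'x) prof" and \<Psi> :: "('p list, (nat \<times> 'n) list, 'q, 'k, 'y) prof"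
    and \<Psi>' :: "('p1, 'n1, 'q, 'k, 'y) prof"
  assumes A: "category A" and B: "category B" and D: "category D" and A': "category A'" and B': "category B'"
    and \<Phi>: "profunctor (quest X A) B \<Phi>" and \<Psi>: "profunctor (quest X B) D \<Psi>"
    and \<Phi>': "profunctor A' B' \<Phi>'" and \<Psi>': "profunctor B' D \<Psi>'"
    and J: "is_functor (quest X A) A' J" and K: "cat_iso (quest X B) B' K"
    and \<beta>: "prof_iso (quest X A) (quest X B) (kernel X A B \<Phi>) \<Phi>' J K \<beta>"
    and \<Psi>O: "\<And>b d. FO \<Psi> (b, d) = FO \<Psi>' (FO K b, d)"
    and \<Psi>M: "\<And>b d b' d' u v. FM \<Psi> (b, d) (b', d') (u, v) = FM \<Psi>' (FO K b, d) (FO K b', d') (FM K b b' u, v)"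
  obtains \<alpha> where "prof_iso (quest X A) D (cokl_comp X A B D \<Psi> \<Phi>) (prof_comp A' B' D \<Psi>' \<Phi>') J id_ftr \<alpha>"
    and "\<And>as d bs y dss ess xs h k. as \<in> lists (Obj A) \<Longrightarrow> d \<in> Obj D \<Longrightarrow> cokl_rep X A B D \<Psi> \<Phi> as d bs y dss ess xs h k \<Longrightarrow>
      \<alpha> as d (cokl_comp_el X A B D \<Psi> \<Phi> as d bs y dss ess xs h k) =
      prof_comp_el A' B' D \<Psi>' \<Phi>' (FO J as, d) (FO K bs) y (\<beta> as bs (kernel_el X A B \<Phi> as bs ess xs (cokl_rep_mor X A as dss ess h k)))"
proof -
  let ?\<beta> = "\<lambda>as bs z. \<beta> as bs (kernel_of X A B \<Phi> as bs z)"
  note \<beta>' = prof_iso_trans[OF kernel_of_iso[OF A B \<Phi>] \<beta>]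
  define \<alpha> where "\<alpha> a d = coend_map B' (prof_comp_int A' D \<Psi>' \<Phi>' (FO J a, d)) (\<lambda>(b, y, x). (FO K b, y, ?\<beta> a b x))" for a d
  note iso = prof_comp_iso[OF cat_quest(1,3)[OF A B \<Phi>] D A' B' profunctor_quest_ext[OF A B \<Phi>] \<Psi> \<Phi>' \<Psi>' J K \<beta>' \<Psi>O \<Psi>M \<alpha>_def,
    folded cokl_comp_def]
  have el: "\<alpha> as d (cokl_comp_el X A B D \<Psi> \<Phi> as d bs y dss ess xs h k) =
      prof_comp_el A' B' D \<Psi>' \<Phi>' (FO J as, d) (FO K bs) y (\<beta> as bs (kernel_el X A B \<Phi> as bs ess xs (cokl_rep_mor X A as dss ess h k)))"
    if "as \<in> lists (Obj A)" "d \<in> Obj D" "cokl_rep X A B D \<Psi> \<Phi> as d bs y dss ess xs h k" for as d bs y dss ess xs h k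
  proof -
    have "kernel_of X A B \<Phi> as bs (quest_ext_el X A B \<Phi> as bs dss ess xs h k) =
      kernel_el X A B \<Phi> as bs ess xs (Cmp (qop X A) as (concat dss) (concat ess) (FM bang_mult dss ess h) k)"
      by (rule kernel_of_el[OF A B \<Phi>]) (use that in \<open>simp_all add: cokl_rep_def\<close>)
    then show ?thesis
      using that iso(1)[of as d bs y "quest_ext_el X A B \<Phi> as bs dss ess xs h k"]
      by (simp add: cokl_comp_el_def cokl_rep_mor_def quest_ext_el_def bang_prof_el_def)
  qed
  show thesis by (rule that[OF iso(2)]) (rule el)
qed

lemma cokl_comp_formula:
  fixes \<Phi> :: "('o list, (nat \<times> 'm) list, 'p, 'n, 'x) prof" and \<Psi> :: "('p list, (nat \<times> 'n) list, 'q, 'k, 'y) prof"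
  assumes A: "category A" and B: "category B" and D: "category D"
    and \<Phi>: "profunctor (quest X A) B \<Phi>" and \<Psi>: "profunctor (quest X B) D \<Psi>"
  shows "\<exists>\<alpha>. nat_iso (prod_cat (quest X A) (op_cat D)) (cokl_comp X A B D \<Psi> \<Phi>) (formula X A B D \<Psi> \<Phi>) \<alpha> \<and>
    (\<forall>as\<in>Obj (quest X A). \<forall>d\<in>Obj D. \<forall>bs y dss ess xs h k.
       cokl_rep X A B D \<Psi> \<Phi> as d bs y dss ess xs h k \<longrightarrow>
       \<alpha> (as, d) (cokl_comp_el X A B D \<Psi> \<Phi> as d bs y dss ess xs h k) =
       formula_el X A B D \<Psi> \<Phi> as d bs y ess xs (cokl_rep_mor X A as dss ess h k))"
proof (rule cokl_comp_iso[OF A B D cat_quest(1,3)[OF A B \<Phi>] \<Phi> \<Psi> profunctor_kernel[OF A B \<Phi>] \<Psi> _ cat_iso_id prof_iso_id])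
  show "is_functor (quest X A) (quest X A) id_ftr" using cat_iso_id[of "quest X A"] by (simp add: cat_iso_def)
  fix \<alpha>
  assume iso: "prof_iso (quest X A) D (cokl_comp X A B D \<Psi> \<Phi>) (prof_comp (quest X A) (quest X B) D \<Psi> (kernel X A B \<Phi>)) id_ftr id_ftr \<alpha>"
    and el: "\<And>as d bs y dss ess xs h k. as \<in> lists (Obj A) \<Longrightarrow> d \<in> Obj D \<Longrightarrow> cokl_rep X A B D \<Psi> \<Phi> as d bs y dss ess xs h k \<Longrightarrow>
      \<alpha> as d (cokl_comp_el X A B D \<Psi> \<Phi> as d bs y dss ess xs h k) =
      prof_comp_el (quest X A) (quest X B) D \<Psi> (kernel X A B \<Phi>) (FO id_ftr as, d) (FO id_ftr bs) y
        (kernel_el X A B \<Phi> as bs ess xs (cokl_rep_mor X A as dss ess h k))"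
  have "nat_iso (prod_cat (quest X A) (op_cat D)) (cokl_comp X A B D \<Psi> \<Phi>) (formula X A B D \<Psi> \<Phi>) (\<lambda>(as, d). \<alpha> as d)"
    unfolding formula_def
    by (rule nat_isoI_prof[OF _ _ iso])
      ((unfold cokl_comp_def)?, intro profunctor_prof_comp cat_quest[OF A B \<Phi>] D \<Psi> profunctor_quest_ext[OF A B \<Phi>] profunctor_kernel[OF A B \<Phi>])+
  then show ?thesis
    using el by (intro exI[of _ "\<lambda>(as, d). \<alpha> as d"]) (simp add: formula_el_def kernel_el_def del: in_lists_conv_set)
qed simp_all


section \<open>The category ?1\<close>

lemma nats_sel [simp]:
  "Obj (nats X) = UNIV" "Hom (nats X) m n = ({..<m} \<rightarrow>\<^sub>E {..<n}) \<inter> cls X m n" "Idn (nats X) m = (\<lambda>i\<in>{..<m}. i)"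
  "Cmp (nats X) l m n g f = compose {..<l} g f"
  by (simp_all add: nats_def)

lemma category_nats: "category (nats X)"
proof (rule categoryI, goal_cases)
  case (1 m)
  then show ?case by (auto intro: cls_id)
next
  case (2 l m n f g)
  then have "(\<lambda>i. g (f i)) \<in> cls X l n" by (auto intro: cls_comp)
  then have "compose {..<l} g f \<in> cls X l n" by (subst cls_cong[of _ _ "\<lambda>i. g (f i)"]) (simp_all add: compose_eq)
  then show ?case using 2 by (auto simp: compose_def)
next
  case (5 a b c d f g h)
  then show ?case by (auto simp: fun_eq_iff compose_def)
qed (auto simp: fun_eq_iff compose_def PiE_iff extensional_def)

lemma lists_unit [simp]: "lists {()} = UNIV"
  by auto

lemma len_FO [simp]: "FO len = length"
  by (simp add: len_def)

lemma len_FM: "FM len ls ms h = (\<lambda>i\<in>{..<length ls}. fst (h ! i))"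
  by (simp add: len_def)

lemma unit_list_eq: "length ls = length (ms :: unit list) \<Longrightarrow> ls = ms"
  by (simp add: list_eq_iff_nth_eq)

definition len_inv :: "nat \<Rightarrow> (nat \<Rightarrow> nat) \<Rightarrow> (nat \<times> unit) list" where
  "len_inv m f = map (\<lambda>i. (f i, ())) [0..<m]"

lemma bang_one_Hom_iff:
  "h \<in> Hom (bang X one_cat) ms ls \<longleftrightarrow> length h = length ls \<and> (\<lambda>j. fst (h ! j)) \<in> cls X (length ls) (length ms)"
  by (auto simp: bang_Hom_iff)

lemma len_inv_Hom:
  assumes "f \<in> Hom (nats X) (length ls) (length ms)"
  shows "len_inv (length ls) f \<in> Hom (bang X one_cat) ms ls" and "FM len ls ms (len_inv (length ls) f) = f"
proof -
  have "(\<lambda>j. fst (len_inv (length ls) f ! j)) \<in> cls X (length ls) (length ms)"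
    using assms by (subst cls_cong[of _ _ f]) (simp_all add: len_inv_def)
  then show "len_inv (length ls) f \<in> Hom (bang X one_cat) ms ls"
    by (simp add: bang_one_Hom_iff len_inv_def)
  show "FM len ls ms (len_inv (length ls) f) = f"
    using assms by (auto simp: len_FM len_inv_def fun_eq_iff PiE_iff extensional_def)
qed

lemma functor_len: "is_functor (quest X one_cat) (nats X) len"
proof (rule functorI)
  fix a b f assume "f \<in> Hom (quest X one_cat) a b"
  then have f: "f \<in> Hom (bang X one_cat) b a" by simp
  have "FM len a b f \<in> cls X (length a) (length b)"
    using f by (subst cls_cong[of _ _ "\<lambda>i. fst (f ! i)"]) (simp_all add: len_FM bang_one_Hom_iff)
  then show "FM len a b f \<in> Hom (nats X) (FO len a) (FO len b)"
    using bang_Hom_less[OF f] by (auto simp: len_FM)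
next
  fix a b c f g assume "f \<in> Hom (quest X one_cat) a b" "g \<in> Hom (quest X one_cat) b c"
  then have f: "f \<in> Hom (bang X one_cat) b a" and g: "g \<in> Hom (bang X one_cat) c b" by simp_all
  show "FM len a c (Cmp (quest X one_cat) a b c g f) =
      Cmp (nats X) (FO len a) (FO len b) (FO len c) (FM len b c g) (FM len a b f)"
    using bang_Hom_less[OF f] by (auto simp: len_FM compose_def fun_eq_iff)
qed (auto simp: len_FM)

lemma len_inj:
  assumes "h \<in> Hom (bang X one_cat) ms ls" "h' \<in> Hom (bang X one_cat) ms ls" "FM len ls ms h = FM len ls ms h'"
  shows "h = h'"
proof (rule nth_equalityI)
  show "length h = length h'" using assms by (simp add: bang_one_Hom_iff)
  fix i assume "i < length h"
  then show "h ! i = h' ! i" using assms(1) fun_cong[OF assms(3), of i] by (simp add: len_FM bang_one_Hom_iff prod_eq_iff)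
qed

lemma cat_iso_len: "cat_iso (quest X one_cat) (nats X) len"
  unfolding cat_iso_def
proof (intro conjI ballI)
  show "bij_betw (FO len) (Obj (quest X one_cat)) (Obj (nats X))"
    by (rule bij_betwI[where g = "\<lambda>n. replicate n ()"]) (auto intro: unit_list_eq)
  fix a b :: "unit list"
  show "bij_betw (FM len a b) (Hom (quest X one_cat) a b) (Hom (nats X) (FO len a) (FO len b))"
    unfolding bij_betw_def
  proof
    show "inj_on (FM len a b) (Hom (quest X one_cat) a b)"
      by (rule inj_onI, rule len_inj) simp_all
    show "FM len a b ` Hom (quest X one_cat) a b = Hom (nats X) (FO len a) (FO len b)"
    proof
      show "FM len a b ` Hom (quest X one_cat) a b \<subseteq> Hom (nats X) (FO len a) (FO len b)"
        using functor_mor[OF functor_len, of a X b] by auto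
      show "Hom (nats X) (FO len a) (FO len b) \<subseteq> FM len a b ` Hom (quest X one_cat) a b"
      proof
        fix f assume "f \<in> Hom (nats X) (FO len a) (FO len b)"
        then have f: "f \<in> Hom (nats X) (length a) (length b)" by simp
        show "f \<in> FM len a b ` Hom (quest X one_cat) a b"
          using len_inv_Hom[OF f] by (intro image_eqI[where x = "len_inv (length a) f"]) simp_all
      qed
    qed
  qed
qed (rule functor_len)


section \<open>Substitution\<close>

definition pow_ftr :: "nat \<Rightarrow> ('o, 'm, 'p, 'n) ftr \<Rightarrow> ('o list, 'm list, 'p list, 'n list) ftr" where
  "pow_ftr n K = \<lparr>FO = map (FO K), FM = (\<lambda>as bs us. map (\<lambda>i. FM K (as ! i) (bs ! i) (us ! i)) [0..<n])\<rparr>"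

lemma pow_ftr_sel [simp]:
  "FO (pow_ftr n K) = map (FO K)"
  "FM (pow_ftr n K) as bs us = map (\<lambda>i. FM K (as ! i) (bs ! i) (us ! i)) [0..<n]"
  by (simp_all add: pow_ftr_def)

lemma cat_iso_pow:
  assumes K: "cat_iso C C' K"
  shows "cat_iso (pow_cat n C) (pow_cat n C') (pow_ftr n K)"
proof -
  have KF: "is_functor C C' K" and KO: "bij_betw (FO K) (Obj C) (Obj C')"
    and KM: "\<And>a b. a \<in> Obj C \<Longrightarrow> b \<in> Obj C \<Longrightarrow> bij_betw (FM K a b) (Hom C a b) (Hom C' (FO K a) (FO K b))"
    using K by (auto simp: cat_iso_def)
  have "is_functor (pow_cat n C) (pow_cat n C') (pow_ftr n K)"
  proof (rule functorI, goal_cases)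
    case (1 as)
    then show ?case by (auto simp: functor_ob[OF KF])
  next
    case (2 as bs us)
    then show ?case by (simp add: functor_mor[OF KF] nth_Obj)
  next
    case (3 as)
    then show ?case by (intro nth_equalityI) (simp_all add: functor_id[OF KF] nth_Obj)
  next
    case (4 as bs cs us vs)
    then show ?case by (simp add: pow_cat_Cmp functor_comp[OF KF] nth_Obj)
  qed
  moreover have "bij_betw (FO (pow_ftr n K)) (Obj (pow_cat n C)) (Obj (pow_cat n C'))"
    unfolding bij_betw_def
  proof
    show "inj_on (FO (pow_ftr n K)) (Obj (pow_cat n C))"
      unfolding pow_ftr_sel by (intro inj_on_mapI inj_on_subset[OF bij_betw_imp_inj_on[OF KO]]) auto
    show "FO (pow_ftr n K) ` Obj (pow_cat n C) = Obj (pow_cat n C')"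
    proof (intro equalityI subsetI)
      fix bs assume "bs \<in> Obj (pow_cat n C')"
      moreover define as where "as = map (inv_into (Obj C) (FO K)) bs"
      ultimately have "as \<in> Obj (pow_cat n C)" "bs = FO (pow_ftr n K) as"
        using bij_betw_apply[OF bij_betw_inv_into[OF KO]] bij_betw_inv_into_right[OF KO]
        by (auto simp: comp_def intro!: map_idI[symmetric])
      then show "bs \<in> FO (pow_ftr n K) ` Obj (pow_cat n C)" by blast
    qed (use bij_betw_apply[OF KO] in auto)
  qed
  moreover have "bij_betw (FM (pow_ftr n K) as bs) (Hom (pow_cat n C) as bs) (Hom (pow_cat n C') (FO (pow_ftr n K) as) (FO (pow_ftr n K) bs))"
    if o: "as \<in> Obj (pow_cat n C)" "bs \<in> Obj (pow_cat n C)" for as bs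
  proof -
    have b: "bij_betw (FM K (as ! i) (bs ! i)) (Hom C (as ! i) (bs ! i)) (Hom C' (FO K (as ! i)) (FO K (bs ! i)))" if "i < n" for i
      using KM o that by (simp add: nth_Obj)
    have l: "length as = n" "length bs = n" using o by simp_all
    show ?thesis
      by (rule bij_betwI[where g = "\<lambda>us. map (\<lambda>i. inv_into (Hom C (as ! i) (bs ! i)) (FM K (as ! i) (bs ! i)) (us ! i)) [0..<n]"])
        (use bij_betw_apply[OF b] bij_betw_apply[OF bij_betw_inv_into[OF b]] bij_betw_inv_into_left[OF b] bij_betw_inv_into_right[OF b] l
          in \<open>auto intro!: nth_equalityI\<close>)
  qed
  ultimately show ?thesis unfolding cat_iso_def by blast
qed

lemma block_map_nth:
  assumes "length fs = length ns" "j < length ns" "l < ns ! j"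
  shows "block_map ns ns' fs (off ns j + l) = off ns' (fst (fs ! j)) + snd (fs ! j) l"
proof -
  let ?b = "map2 (\<lambda>n (i, g). map (\<lambda>s. sum_list (take i ns') + g s) [0..<n]) ns fs"
  have "map length ?b = ns" using assms(1) by (auto intro!: nth_equalityI simp: split_def)
  then have "concat ?b ! (off ns j + l) = ?b ! j ! l"
    using concat_nth_off[of j ?b l] assms by (simp add: split_def)
  then show ?thesis using assms off_bound[of j ns l] by (simp add: block_map_def split_def)
qed

lemma block_map_eqI:
  assumes "length fs = length ns" "F \<in> extensional {..<sum_list ns}"
    and "\<And>j l. j < length ns \<Longrightarrow> l < ns ! j \<Longrightarrow> F (off ns j + l) = off ns' (fst (fs ! j)) + snd (fs ! j) l"
  shows "block_map ns ns' fs = F"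
proof (rule extensionalityI)
  show "block_map ns ns' fs \<in> extensional {..<sum_list ns}" by (simp add: block_map_def)
  fix t assume "t \<in> {..<sum_list ns}"
  then obtain j l where "j < length ns" "l < ns ! j" "t = off ns j + l" using off_index by blast
  then show "block_map ns ns' fs t = F t" using assms by (simp add: block_map_nth)
qed fact

text \<open>\<open>block_map\<close> is what the multiplication of the monad becomes under the identification \<open>len\<close>.\<close>

lemma len_mult:
  assumes h: "h \<in> Hom (bang X (bang X one_cat)) es ds"
    and fs: "length fs = length ds" "\<And>j. j < length ds \<Longrightarrow> fst (fs ! j) = fst (h ! j)"
      "\<And>j l. j < length ds \<Longrightarrow> l < length (ds ! j) \<Longrightarrow> snd (fs ! j) l = fst (snd (h ! j) ! l)"
  shows "FM len (concat ds) (concat es) (FM bang_mult es ds h) = block_map (map length ds) (map length es) fs"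
proof (rule block_map_eqI[symmetric])
  fix j l assume jl: "j < length (map length ds)" "l < map length ds ! j"
  have "off (map length ds) j + l < length (concat ds)"
    using off_bound[OF jl] by (simp add: length_concat)
  then show "FM len (concat ds) (concat es) (FM bang_mult es ds h) (off (map length ds) j + l) =
      off (map length es) (fst (fs ! j)) + snd (fs ! j) l"
    using jl fs by (simp add: len_FM bang_mult_nth[OF h])
qed (simp_all add: fs(1) len_FM length_concat)

lemma prof_of_sel [simp]:
  "FO (prof_of F) (a, b) = FO F a" "FM (prof_of F) (a, b) (a', b') (f, g) = FM F a a' f"
  by (simp_all add: prof_of_def)

lemma profunctor_prof_of: "category C \<Longrightarrow> is_functor C set_cat F \<Longrightarrow> profunctor C one_cat (prof_of F)"
  by (rule profunctorI)
    (simp_all add: category_one set_functor_id set_functor_comp set_functor_mor del: PiE_iff)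

lemma functor_ftr_of:
  assumes C: "category C" and \<Phi>: "profunctor C one_cat \<Phi>"
  shows "is_functor C set_cat (ftr_of \<Phi>)"
proof (rule set_functorI[OF C])
  fix a b f assume "a \<in> Obj C" "b \<in> Obj C" "f \<in> Hom C a b"
  then show "FM (ftr_of \<Phi>) a b f \<in> FO (ftr_of \<Phi>) a \<rightarrow>\<^sub>E FO (ftr_of \<Phi>) b"
    using profunctor_mor[OF \<Phi>, of a "()" b "()" f "()"] by (simp add: ftr_of_def)
next
  fix a x assume "a \<in> Obj C" "x \<in> FO (ftr_of \<Phi>) a"
  then show "FM (ftr_of \<Phi>) a a (Idn C a) x = x"
    using profunctor_id[OF \<Phi>, of a "()" x] by (simp add: ftr_of_def)
next
  fix a b c f g x assume "a \<in> Obj C" "b \<in> Obj C" "c \<in> Obj C" "f \<in> Hom C a b" "g \<in> Hom C b c" "x \<in> FO (ftr_of \<Phi>) a"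
  then show "FM (ftr_of \<Phi>) a c (Cmp C a b c g f) x = FM (ftr_of \<Phi>) b c g (FM (ftr_of \<Phi>) a b f x)"
    using profunctor_comp[OF \<Phi>, of a "()" b "()" c "()" f "()" g "()" x] by (simp add: ftr_of_def)
qed

definition subst_of where
  "subst_of X Z ps bs = coend_map (pow_cat (length bs) (nats X)) (subst_int X Z (length ps, length bs))
     (\<lambda>(ess, xs, k). (map length ess, xs, FM len (concat ess) ps k))"

context
  fixes X :: "comb set" and Z :: "(nat, nat \<Rightarrow> nat, 'z) sftr"
  assumes Z: "is_functor (nats X) set_cat Z"
begin

lemma profunctor_Z: "profunctor (quest X one_cat) one_cat (prof_of (ftr_comp Z len))"
  by (intro profunctor_prof_of category_quest category_one functor_ftr_comp[OF functor_len Z])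

lemmas kernel_facts = category_one category_one profunctor_Z

lemma quest_one_Cmp_len:
  "f \<in> Hom (bang X one_cat) b a \<Longrightarrow> g \<in> Hom (bang X one_cat) c b \<Longrightarrow>
   FM len a c (Cmp (bang X one_cat) c b a f g) = Cmp (nats X) (length a) (length b) (length c) (FM len b c g) (FM len a b f)"
  using functor_comp[OF functor_len, of a X b c f g] by simp

lemma subst_of_bij:
  fixes ps bs :: "unit list"
  shows "subst_of X Z ps bs (kernel_el X one_cat one_cat (prof_of (ftr_comp Z len)) ps bs ess xs k) =
      coend_cls (pow_cat (length bs) (nats X)) (subst_int X Z (length ps, length bs)) (map length ess, xs, FM len (concat ess) ps k)"
    and "bij_betw (subst_of X Z ps bs) (FO (kernel X one_cat one_cat (prof_of (ftr_comp Z len))) (ps, bs)) (FO (subst_kernel X Z) (length ps, length bs))"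
    and "coend_gen (pow_cat (length bs) (quest X one_cat)) (kernel_int X one_cat one_cat (prof_of (ftr_comp Z len)) (ps, bs)) \<subseteq>
      coend_dom (pow_cat (length bs) (quest X one_cat)) (kernel_int X one_cat one_cat (prof_of (ftr_comp Z len)) (ps, bs)) \<times>
      coend_dom (pow_cat (length bs) (quest X one_cat)) (kernel_int X one_cat one_cat (prof_of (ftr_comp Z len)) (ps, bs))"
    and "coend_gen (pow_cat (length bs) (nats X)) (subst_int X Z (length ps, length bs)) =
      map_prod (\<lambda>(ess, xs, k). (map length ess, xs, FM len (concat ess) ps k)) (\<lambda>(ess, xs, k). (map length ess, xs, FM len (concat ess) ps k)) `
        coend_gen (pow_cat (length bs) (quest X one_cat)) (kernel_int X one_cat one_cat (prof_of (ftr_comp Z len)) (ps, bs))"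
proof -
  let ?m = "length bs"
  let ?\<sigma> = "\<lambda>(ess, xs, k). (map length ess, xs, FM len (concat ess) ps k)"
  let ?F = "kernel_int X one_cat one_cat (prof_of (ftr_comp Z len)) (ps, bs)" and ?G = "subst_int X Z (length ps, length bs)"
  let ?C = "pow_cat ?m (quest X one_cat)" and ?C' = "pow_cat ?m (nats X)"
  have o: "ps \<in> lists (Obj one_cat)" "bs \<in> lists (Obj one_cat)" by simp_all
  have len_in: "FM len a b h \<in> Hom (nats X) (length a) (length b)" if "h \<in> Hom (bang X one_cat) b a" for a b h
    using functor_mor[OF functor_len, of a X b h] that by simp
  let ?s = "\<lambda>ds es. map_prod id (FM len (concat ds) ps)"
  have sum: "sum_list (map length ds) = length (concat ds)" for ds :: "unit list list" by (simp add: length_concat)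
  have FOF: "FO ?F (ds, es) = listset (map (\<lambda>e. FO Z (length e)) es) \<times> Hom (quest X one_cat) (concat ds) ps"
    if "length es = ?m" for ds es
  proof -
    have "map2 (\<lambda>b e. FO (prof_of (ftr_comp Z len)) (e, b)) bs es = map (\<lambda>e. FO Z (length e)) es"
      using that by (auto intro!: nth_equalityI)
    then show ?thesis by (simp add: kernel_int_def)
  qed
  have FOG: "FO ?G (map length ds, map length es) = listset (map (\<lambda>e. FO Z (length e)) es) \<times> Hom (nats X) (length (concat ds)) (length ps)"
    for ds es :: "unit list list"
    by (simp add: subst_int_def sum comp_def del: nats_sel)
  have app: "\<forall>ds\<in>Obj ?C. \<forall>es\<in>Obj ?C. \<forall>ds'\<in>Obj ?C. \<forall>es'\<in>Obj ?C. \<forall>u\<in>Hom ?C ds' ds. \<forall>v\<in>Hom ?C es es'. \<forall>x\<in>FO ?F (ds, es).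
      FM ?F (ds, es) (ds', es') (u, v) x \<in> FO ?F (ds', es')"
    by (intro ballI kernel_int_app[OF kernel_facts o refl])
  have bij: "\<forall>ds\<in>Obj ?C. \<forall>es\<in>Obj ?C. bij_betw (?s ds es) (FO ?F (ds, es)) (FO ?G (FO (pow_ftr ?m len) ds, FO (pow_ftr ?m len) es))"
  proof (intro ballI)
    fix ds es assume es: "es \<in> Obj ?C"
    have "bij_betw (FM len (concat ds) ps) (Hom (quest X one_cat) (concat ds) ps) (Hom (nats X) (FO len (concat ds)) (FO len ps))"
      using cat_iso_len[of X] unfolding cat_iso_def quest_sel(1) by simp
    moreover have "length es = ?m" using es by simp
    ultimately show "bij_betw (?s ds es) (FO ?F (ds, es)) (FO ?G (FO (pow_ftr ?m len) ds, FO (pow_ftr ?m len) es))"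
      unfolding bij_betw_def pow_ftr_sel len_FO FOG by (simp add: FOF map_prod_inj_on map_prod_surj_on del: nats_sel quest_sel)
  qed
  have nat: "\<forall>ds\<in>Obj ?C. \<forall>es\<in>Obj ?C. \<forall>ds'\<in>Obj ?C. \<forall>es'\<in>Obj ?C. \<forall>u\<in>Hom ?C ds' ds. \<forall>v\<in>Hom ?C es es'. \<forall>x\<in>FO ?F (ds, es).
      ?s ds' es' (FM ?F (ds, es) (ds', es') (u, v) x) =
      FM ?G (FO (pow_ftr ?m len) ds, FO (pow_ftr ?m len) es) (FO (pow_ftr ?m len) ds', FO (pow_ftr ?m len) es')
        (FM (pow_ftr ?m len) ds' ds u, FM (pow_ftr ?m len) es es' v) (?s ds es x)"
  proof (intro ballI)
    fix ds es ds' es' u v x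
    assume *: "ds \<in> Obj ?C" "es \<in> Obj ?C" "ds' \<in> Obj ?C" "es' \<in> Obj ?C" "u \<in> Hom ?C ds' ds" "v \<in> Hom ?C es es'" "x \<in> FO ?F (ds, es)"
    obtain xs k where e: "x = (xs, k)" by force
    have l: "length ds = ?m" "length es = ?m" "length ds' = ?m" "length es' = ?m" using * by simp_all
    have k: "k \<in> Hom (bang X one_cat) ps (concat ds)" and xs: "xs \<in> listset (map (\<lambda>e. FO Z (length e)) es)"
      using *(7) unfolding e FOF[OF l(2)] by simp_all
    have u: "u \<in> Hom (pow_cat (length ds') (bang X one_cat)) ds ds'" using *(5) l by simp
    have eu: "enumerate 0 u \<in> Hom (bang X (bang X one_cat)) ds ds'" using enumerate_Hom[OF _ u] l by simp
    have "FM len (concat ds') (concat ds) (FM bang_mult ds ds' (enumerate 0 u)) =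
        block_map (map length ds') (map length ds) (enumerate 0 (FM (pow_ftr ?m len) ds' ds u))"
      by (rule len_mult[OF eu]) (use l u in \<open>simp_all add: nth_enumerate_eq len_FM\<close>)
    moreover have "FM bang_mult ds ds' (enumerate 0 u) \<in> Hom (bang X one_cat) (concat ds) (concat ds')"
      using mult_Hom[OF kernel_facts, of ds ds' "enumerate 0 u"] eu by simp
    ultimately have "FM len (concat ds') ps (Cmp (bang X one_cat) ps (concat ds) (concat ds') (FM bang_mult ds ds' (enumerate 0 u)) k) =
        Cmp (nats X) (length (concat ds')) (length (concat ds)) (length ps) (FM len (concat ds) ps k)
          (block_map (map length ds') (map length ds) (enumerate 0 (FM (pow_ftr ?m len) ds' ds u)))"
      using k by (simp only: quest_one_Cmp_len)
    then show "?s ds' es' (FM ?F (ds, es) (ds', es') (u, v) x) =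
      FM ?G (FO (pow_ftr ?m len) ds, FO (pow_ftr ?m len) es) (FO (pow_ftr ?m len) ds', FO (pow_ftr ?m len) es')
        (FM (pow_ftr ?m len) ds' ds u, FM (pow_ftr ?m len) es es' v) (?s ds es x)"
      using k xs l len_in[OF k] *(7) unfolding e FOF[OF l(2)]
      by (auto simp: kernel_int_def subst_int_def in_listset sum comp_def simp del: nats_sel)
  qed
  have \<sigma>: "?\<sigma> (ds, x) = (FO (pow_ftr ?m len) ds, ?s ds ds x)" for ds x by (cases x) simp
  have "category ?C" by (intro category_pow category_quest category_one)
  note cm = coend_map_iso[where \<sigma> = ?\<sigma> and s = ?s, OF this cat_iso_pow[OF cat_iso_len] bij app nat \<sigma>]
  show "coend_gen ?C ?F \<subseteq> coend_dom ?C ?F \<times> coend_dom ?C ?F" "coend_gen ?C' ?G = map_prod ?\<sigma> ?\<sigma> ` coend_gen ?C ?F"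
    by (rule cm(1), rule cm(2))
  show "subst_of X Z ps bs (kernel_el X one_cat one_cat (prof_of (ftr_comp Z len)) ps bs ess xs k) =
      coend_cls (pow_cat (length bs) (nats X)) (subst_int X Z (length ps, length bs)) (map length ess, xs, FM len (concat ess) ps k)"
    using cm(3)[of "(ess, xs, k)"] by (simp add: subst_of_def kernel_el_def)
  show "bij_betw (subst_of X Z ps bs) (FO (kernel X one_cat one_cat (prof_of (ftr_comp Z len))) (ps, bs)) (FO (subst_kernel X Z) (length ps, length bs))"
    using cm(4) by (simp add: subst_of_def kernel_def subst_kernel_def)
qed

text \<open>
  That the action of \<open>subst_kernel\<close> on representatives is well defined follows from the corresponding
  fact for the kernel, since every generating pair of the one coend is the image of a generating pair of the
  other; the equation \<open>step\<close> serves both for this and for naturality.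
\<close>

lemma subst_of_natural:
  fixes ps bs ps' bs' :: "unit list"
  assumes w: "w \<in> Hom (bang X one_cat) ps' ps" and h: "h \<in> Hom (bang X one_cat) bs bs'"
    and z: "z \<in> FO (kernel X one_cat one_cat (prof_of (ftr_comp Z len))) (ps, bs)"
  shows "subst_of X Z ps' bs' (FM (kernel X one_cat one_cat (prof_of (ftr_comp Z len))) (ps, bs) (ps', bs') (w, h) z) =
    FM (subst_kernel X Z) (length ps, length bs) (length ps', length bs') (FM len ps ps' w, FM len bs' bs h)
      (subst_of X Z ps bs z)"
proof -
  let ?m = "length bs" and ?m' = "length bs'"
  let ?\<sigma> = "\<lambda>(ess, xs, k). (map length ess, xs, FM len (concat ess) ps k)"
  let ?F = "kernel_int X one_cat one_cat (prof_of (ftr_comp Z len)) (ps, bs)" and ?C = "pow_cat ?m (quest X one_cat)"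
  let ?G = "subst_int X Z (length ps, ?m)" and ?G' = "subst_int X Z (length ps', ?m')"
  let ?f = "FM len bs' bs h" and ?w = "FM len ps ps' w"
  let ?\<tau> = "\<lambda>(ns, zs, k).
     let ns' = map (\<lambda>j. ns ! ?f j) [0..<?m']
     in (ns', map (\<lambda>j. zs ! ?f j) [0..<?m'],
         Cmp (nats X) (sum_list ns') (length ps) (length ps') ?w
           (Cmp (nats X) (sum_list ns') (sum_list ns) (length ps) k
             (block_map ns' ns (map (\<lambda>j. (?f j, Idn (nats X) (ns ! ?f j))) [0..<?m']))))"
  let ?cls = "coend_cls (pow_cat ?m' (nats X)) ?G'"
  note hl = bang_Hom_length[OF h] bang_Hom_less[OF h]
  have dom: "(ds, xs, k) \<in> coend_dom ?C ?F \<longleftrightarrow> length ds = ?m \<and> length xs = ?m \<and>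
     (\<forall>i<?m. xs ! i \<in> FO Z (length (ds ! i))) \<and> k \<in> Hom (bang X one_cat) ps (concat ds)" for ds xs k
    unfolding kernel_int_dom[OF kernel_facts] by simp
  have step: "?cls (?\<tau> (?\<sigma> (ds, xs, k))) =
      subst_of X Z ps' bs' (FM (kernel X one_cat one_cat (prof_of (ftr_comp Z len))) (ps, bs) (ps', bs') (w, h) (kernel_el X one_cat one_cat (prof_of (ftr_comp Z len)) ps bs ds xs k))"
    if el: "(ds, xs, k) \<in> coend_dom ?C ?F" for ds xs k
  proof -
    from el have ds: "length ds = ?m" and xs: "length xs = ?m" "\<forall>i<?m. xs ! i \<in> FO Z (length (ds ! i))"
      and k: "k \<in> Hom (bang X one_cat) ps (concat ds)"
      unfolding dom by simp_all
    let ?r = "reindex (bang X one_cat) ds h"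
    have r: "?r \<in> Hom (bang X (bang X one_cat)) ds (along ds h)"
      using reindex_Hom[OF category_bang[OF category_one] h ds] by simp
    have mr: "FM bang_mult ds (along ds h) ?r \<in> Hom (bang X one_cat) (concat ds) (concat (along ds h))"
      using mult_Hom[OF kernel_facts, of ds "along ds h" ?r] r by simp
    have kw: "Cmp (bang X one_cat) ps' ps (concat ds) k w \<in> Hom (bang X one_cat) ps' (concat ds)"
      using category_comp[OF category_bang[OF category_one], of ps' X ps "concat ds" w k] w k by simp
    have 1: "map (\<lambda>j. map length ds ! ?f j) [0..<?m'] = map length (along ds h)"
      using hl ds by (auto intro!: nth_equalityI simp: len_FM split_def)
    have "FM Z (length e) (length e) (FM len e e (Idn (bang X one_cat) e)) x = x" if "x \<in> FO Z (length e)" for e :: "unit list" and x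
      using functor_id[OF functor_len, of e X] set_functor_id[OF Z, of "length e" x] that by simp
    then have 2: "map (\<lambda>j. FM (prof_of (ftr_comp Z len)) (ds ! fst (h ! j), bs ! fst (h ! j)) (ds ! fst (h ! j), bs' ! j)
         (Idn (bang X one_cat) (ds ! fst (h ! j)), snd (h ! j)) (xs ! fst (h ! j))) [0..<?m'] = map (\<lambda>j. xs ! ?f j) [0..<?m']"
      using hl xs by (auto simp: len_FM)
    have 3: "FM len (concat (along ds h)) (concat ds) (FM bang_mult ds (along ds h) ?r) =
        block_map (map length (along ds h)) (map length ds) (map (\<lambda>j. (?f j, Idn (nats X) (map length ds ! ?f j))) [0..<?m'])"
      by (rule len_mult[OF r]) (use hl ds in \<open>auto simp: len_FM split_def\<close>)
    have "FM len (concat (along ds h)) ps' (Cmp (bang X one_cat) ps' (concat ds) (concat (along ds h)) (FM bang_mult ds (along ds h) ?r)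
          (Cmp (bang X one_cat) ps' ps (concat ds) k w)) =
        Cmp (nats X) (length (concat (along ds h))) (length (concat ds)) (length ps')
          (Cmp (nats X) (length (concat ds)) (length ps) (length ps') ?w (FM len (concat ds) ps k))
          (FM len (concat (along ds h)) (concat ds) (FM bang_mult ds (along ds h) ?r))"
      by (simp only: quest_one_Cmp_len[OF mr kw] quest_one_Cmp_len[OF k w])
    also have "\<dots> = Cmp (nats X) (length (concat (along ds h))) (length ps) (length ps') ?w
        (Cmp (nats X) (length (concat (along ds h))) (length (concat ds)) (length ps) (FM len (concat ds) ps k)
          (FM len (concat (along ds h)) (concat ds) (FM bang_mult ds (along ds h) ?r)))"
      by (rule category_assoc[OF category_nats, symmetric])
        (use functor_mor[OF functor_len, of "concat (along ds h)" X "concat ds" "FM bang_mult ds (along ds h) ?r"]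
             functor_mor[OF functor_len, of "concat ds" X ps k] functor_mor[OF functor_len, of ps X ps' w] mr k w
          in simp_all)
    finally have 4: "FM len (concat (along ds h)) ps' (Cmp (bang X one_cat) ps' (concat ds) (concat (along ds h)) (FM bang_mult ds (along ds h) ?r)
          (Cmp (bang X one_cat) ps' ps (concat ds) k w)) = \<dots>" .
    have 5: "FM (kernel X one_cat one_cat (prof_of (ftr_comp Z len))) (ps, bs) (ps', bs') (w, h) (kernel_el X one_cat one_cat (prof_of (ftr_comp Z len)) ps bs ds xs k) =
      kernel_el X one_cat one_cat (prof_of (ftr_comp Z len)) ps' bs' (along ds h)
        (map (\<lambda>j. FM (prof_of (ftr_comp Z len)) (ds ! fst (h ! j), bs ! fst (h ! j)) (ds ! fst (h ! j), bs' ! j)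
         (Idn (bang X one_cat) (ds ! fst (h ! j)), snd (h ! j)) (xs ! fst (h ! j))) [0..<?m'])
        (Cmp (bang X one_cat) ps' (concat ds) (concat (along ds h)) (FM bang_mult ds (along ds h) ?r)
          (Cmp (bang X one_cat) ps' ps (concat ds) k w))"
      using kernel_FM[OF kernel_facts, of ps bs ps' bs' w h ds xs k] w h ds xs k by simp
    have "subst_of X Z ps' bs' (FM (kernel X one_cat one_cat (prof_of (ftr_comp Z len))) (ps, bs) (ps', bs') (w, h) (kernel_el X one_cat one_cat (prof_of (ftr_comp Z len)) ps bs ds xs k)) =
      ?cls (map length (along ds h), map (\<lambda>j. xs ! ?f j) [0..<?m'],
        FM len (concat (along ds h)) ps' (Cmp (bang X one_cat) ps' (concat ds) (concat (along ds h)) (FM bang_mult ds (along ds h) ?r)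
          (Cmp (bang X one_cat) ps' ps (concat ds) k w)))"
      unfolding 5 2 by (rule subst_of_bij(1))
    also have "\<dots> = ?cls (?\<tau> (?\<sigma> (ds, xs, k)))"
      unfolding 4 3 by (simp only: prod.case Let_def 1 length_concat)
    finally show ?thesis ..
  qed
  obtain ds xs k where "length ds = ?m" "length xs = ?m" "\<forall>i<?m. xs ! i \<in> FO (prof_of (ftr_comp Z len)) (ds ! i, bs ! i)"
    "k \<in> Hom (bang X (op_cat one_cat)) ps (concat ds)" and z': "z = kernel_el X one_cat one_cat (prof_of (ftr_comp Z len)) ps bs ds xs k"
    using z by (rule kernelE[OF kernel_facts])
  then have el: "(ds, xs, k) \<in> coend_dom ?C ?F" unfolding dom by simp
  have "coend_map (pow_cat ?m' (nats X)) ?G' ?\<tau> (coend_cls (pow_cat ?m (nats X)) ?G (?\<sigma> (ds, xs, k))) = ?cls (?\<tau> (?\<sigma> (ds, xs, k)))"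
  proof (rule coend_map_cls)
    fix p' q' assume "(p', q') \<in> coend_gen (pow_cat ?m (nats X)) ?G"
    then obtain p q where pq: "p' = ?\<sigma> p" "q' = ?\<sigma> q" "(p, q) \<in> coend_gen ?C ?F"
      unfolding subst_of_bij(4) by auto
    then have d: "p \<in> coend_dom ?C ?F" "q \<in> coend_dom ?C ?F"
      using subst_of_bij(3)[of bs ps] by blast+
    obtain ds xs k ds' xs' k' where e: "p = (ds, xs, k)" "q = (ds', xs', k')" by (metis prod_cases3)
    show "?cls (?\<tau> p') = ?cls (?\<tau> q')"
      using step[of ds xs k] step[of ds' xs' k'] d coend_cls_gen[OF pq(3)] unfolding pq(1,2) e kernel_el_def by simp
  qed
  moreover have "coend_cls (pow_cat ?m (nats X)) ?G (?\<sigma> (ds, xs, k)) \<in> FO (subst_kernel X Z) (length ps, ?m)"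
    using bij_betw_apply[OF subst_of_bij(2) z] by (simp add: z' subst_of_bij(1))
  moreover have "FM (subst_kernel X Z) (length ps, ?m) (length ps', ?m') (?w, ?f) =
      (\<lambda>c\<in>FO (subst_kernel X Z) (length ps, ?m). coend_map (pow_cat ?m' (nats X)) ?G' ?\<tau> c)"
    by (simp only: subst_kernel_def ftr.select_convs prod.case)
  ultimately show ?thesis
    unfolding z' step[OF el, symmetric] subst_of_bij(1) by (simp only: restrict_apply' prod.case)
qed

lemma subst_of_iso:
  "prof_iso (quest X one_cat) (quest X one_cat) (kernel X one_cat one_cat (prof_of (ftr_comp Z len))) (subst_kernel X Z) len len (subst_of X Z)"
  unfolding prof_iso_def by (simp add: subst_of_bij(2) subst_of_natural)

lemma profunctor_subst_kernel: "profunctor (nats X) (nats X) (subst_kernel X Z)"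
  by (rule profunctor_transport[OF category_quest[OF category_one] category_quest[OF category_one] category_nats category_nats
      profunctor_kernel[OF kernel_facts] cat_iso_len cat_iso_len subst_of_iso])
    (simp add: subst_kernel_def)

end

lemma functor_bang_unit: "is_functor C (bang X C) bang_unit"
proof (rule functorI)
  fix a b f assume "a \<in> Obj C" "b \<in> Obj C" "f \<in> Hom C a b"
  moreover have "(\<lambda>j. fst ([(0 :: nat, f)] ! j)) \<in> cls X 1 1" by (rule cls_id) simp
  ultimately show "FM bang_unit a b f \<in> Hom (bang X C) (FO bang_unit a) (FO bang_unit b)"
    by (simp add: bang_unit_def bang_Hom_iff)
qed (auto simp: bang_unit_def bang_def)

lemma functor_hom:
  assumes C: "category C" and "a \<in> Obj C"
  shows "is_functor C set_cat (hom_ftr C a)"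
  by (rule set_functorI[OF C])
    (use assms in \<open>auto simp: hom_ftr_def category_comp[OF C] category_idl[OF C] category_assoc[OF C]\<close>)

lemma cokl_id_one:
  "nat_iso (quest X one_cat) (ftr_of (cokl_id X one_cat)) (ftr_comp (hom_ftr (nats X) 1) len) (\<lambda>ps. FM len [()] ps)"
  unfolding nat_iso_def nat_trans_def
proof (intro conjI ballI)
  have "is_functor one_cat (quest X one_cat) (op_ftr bang_unit)"
    using functor_op[OF functor_bang_unit[of one_cat X]] by (simp add: quest_def)
  then have "profunctor (quest X one_cat) one_cat (cokl_id X one_cat)"
    unfolding cokl_id_def counit_def by (intro profunctor_rep_prof category_quest category_one)
  then show "is_functor (quest X one_cat) set_cat (ftr_of (cokl_id X one_cat))"
    by (intro functor_ftr_of category_quest category_one)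
  show "is_functor (quest X one_cat) set_cat (ftr_comp (hom_ftr (nats X) 1) len)"
    by (intro functor_ftr_comp[OF functor_len] functor_hom category_nats) simp
  have O: "FO (ftr_of (cokl_id X one_cat)) ps = Hom (quest X one_cat) [()] ps" for ps
    by (simp add: ftr_of_def cokl_id_def counit_def rep_prof_def bang_unit_def)
  have M: "FO (ftr_comp (hom_ftr (nats X) 1) len) ps = Hom (nats X) 1 (length ps)" for ps :: "unit list"
    by (simp add: hom_ftr_def)
  fix ps assume ps: "ps \<in> Obj (quest X one_cat)"
  show b: "bij_betw (FM len [()] ps) (FO (ftr_of (cokl_id X one_cat)) ps) (FO (ftr_comp (hom_ftr (nats X) 1) len) ps)"
  proof -
    have "bij_betw (FM len [()] ps) (Hom (quest X one_cat) [()] ps) (Hom (nats X) (FO len [()]) (FO len ps))"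
    proof -
      have "[()] \<in> Obj (quest X one_cat)" by simp
      then show ?thesis using cat_iso_len[of X] ps unfolding cat_iso_def by blast
    qed
    then show ?thesis unfolding O M by simp
  qed
  then show "FM len [()] ps \<in> FO (ftr_of (cokl_id X one_cat)) ps \<rightarrow> FO (ftr_comp (hom_ftr (nats X) 1) len) ps"
    by (rule bij_betw_imp_funcset)
  fix qs h x assume "qs \<in> Obj (quest X one_cat)" and h: "h \<in> Hom (quest X one_cat) ps qs" and x: "x \<in> FO (ftr_of (cokl_id X one_cat)) ps"
  have x': "x \<in> Hom (quest X one_cat) [()] ps" using x by (simp only: O)
  have id: "[(0, ())] = Idn (quest X one_cat) [()]" by (simp add: bang_def)
  have "FM (ftr_of (cokl_id X one_cat)) ps qs h x = Cmp (quest X one_cat) [()] ps qs h (Cmp (quest X one_cat) [()] [()] ps x [(0, ())])"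
    using x' by (simp add: ftr_of_def cokl_id_def counit_def rep_prof_def bang_unit_def)
  also have "Cmp (quest X one_cat) [()] [()] ps x [(0, ())] = x"
    unfolding id using x' by (intro category_idr category_quest category_one) simp_all
  finally have "FM len [()] qs (FM (ftr_of (cokl_id X one_cat)) ps qs h x) = Cmp (nats X) (length [()]) (length ps) (length qs) (FM len ps qs h) (FM len [()] ps x)"
    using functor_comp[OF functor_len, of "[()]" X ps qs x h] x' h by simp
  then show "FM len [()] qs (FM (ftr_of (cokl_id X one_cat)) ps qs h x) =
      FM (ftr_comp (hom_ftr (nats X) 1) len) ps qs h (FM len [()] ps x)"
    using functor_mor[OF functor_len, of "[()]" X ps x] x' by (simp add: hom_ftr_def)
qed

lemma cokl_comp_subst:
  fixes Y :: "(nat, nat \<Rightarrow> nat, 'y) sftr" and Z :: "(nat, nat \<Rightarrow> nat, 'z) sftr"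
  assumes Y: "is_functor (nats X) set_cat Y" and Z: "is_functor (nats X) set_cat Z"
  defines "\<Psi> \<equiv> prof_of (ftr_comp Y len)" and "\<Phi> \<equiv> prof_of (ftr_comp Z len)"
  shows "\<exists>\<alpha>. nat_iso (quest X one_cat) (ftr_of (cokl_comp X one_cat one_cat one_cat \<Psi> \<Phi>)) (ftr_comp (subst X Y Z) len) \<alpha> \<and>
    (\<forall>ps\<in>Obj (quest X one_cat). \<forall>bs y dss ess xs h k.
       cokl_rep X one_cat one_cat one_cat \<Psi> \<Phi> ps () bs y dss ess xs h k \<longrightarrow>
       \<alpha> ps (cokl_comp_el X one_cat one_cat one_cat \<Psi> \<Phi> ps () bs y dss ess xs h k) =
       subst_el X Y Z (length ps) (length bs) y (map length ess) xs
         (FM len (concat ess) ps (cokl_rep_mor X one_cat ps dss ess h k)))"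
proof -
  have \<Phi>: "profunctor (quest X one_cat) one_cat \<Phi>" and \<Psi>: "profunctor (quest X one_cat) one_cat \<Psi>"
    unfolding \<Phi>_def \<Psi>_def by (rule profunctor_Z[OF Z], rule profunctor_Z[OF Y])
  have \<Psi>': "profunctor (nats X) one_cat (prof_of Y)" by (rule profunctor_prof_of[OF category_nats Y])
  note Q = category_quest[OF category_one, of X]
  let ?c = "cokl_comp X one_cat one_cat one_cat \<Psi> \<Phi>"
  have \<Psi>O: "FO \<Psi> (b, d) = FO (prof_of Y) (FO len b, d)"
    and \<Psi>M: "FM \<Psi> (b, d) (b', d') (u, v) = FM (prof_of Y) (FO len b, d) (FO len b', d') (FM len b b' u, v)" for b d b' d' u v
    by (simp_all add: \<Psi>_def)
  obtain \<alpha> where iso: "prof_iso (quest X one_cat) one_cat ?c (prof_comp (nats X) (nats X) one_cat (prof_of Y) (subst_kernel X Z)) len id_ftr \<alpha>"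
    and el: "\<And>as d bs y dss ess xs h k. as \<in> lists (Obj one_cat) \<Longrightarrow> d \<in> Obj one_cat \<Longrightarrow>
      cokl_rep X one_cat one_cat one_cat \<Psi> \<Phi> as d bs y dss ess xs h k \<Longrightarrow>
      \<alpha> as d (cokl_comp_el X one_cat one_cat one_cat \<Psi> \<Phi> as d bs y dss ess xs h k) =
      prof_comp_el (nats X) (nats X) one_cat (prof_of Y) (subst_kernel X Z) (FO len as, d) (FO len bs) y
        (subst_of X Z as bs (kernel_el X one_cat one_cat \<Phi> as bs ess xs (cokl_rep_mor X one_cat as dss ess h k)))"
    by (rule cokl_comp_iso[OF category_one category_one category_one category_nats category_nats \<Phi> \<Psi>
      profunctor_subst_kernel[OF Z] \<Psi>' functor_len cat_iso_len subst_of_iso[OF Z, folded \<Phi>_def] \<Psi>O \<Psi>M]) (rule that)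
  let ?\<alpha> = "\<lambda>ps. \<alpha> ps ()"
  have "nat_iso (quest X one_cat) (ftr_of ?c) (ftr_comp (subst X Y Z) len) ?\<alpha>"
    unfolding nat_iso_def nat_trans_def
  proof (intro conjI ballI)
    have "profunctor (quest X one_cat) one_cat ?c"
      unfolding cokl_comp_def
      by (intro profunctor_prof_comp Q category_one \<Psi> profunctor_quest_ext[OF category_one category_one \<Phi>])
    then show "is_functor (quest X one_cat) set_cat (ftr_of ?c)" by (rule functor_ftr_of[OF Q])
    show "is_functor (quest X one_cat) set_cat (ftr_comp (subst X Y Z) len)"
      unfolding subst_def
      by (intro functor_ftr_comp[OF functor_len] functor_ftr_of profunctor_prof_comp category_nats category_one
          profunctor_subst_kernel[OF Z] \<Psi>')
    fix ps
    show "bij_betw (?\<alpha> ps) (FO (ftr_of ?c) ps) (FO (ftr_comp (subst X Y Z) len) ps)"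
      using prof_iso_bij[OF iso, of ps "()"] by (simp add: ftr_of_def subst_def)
    then show "?\<alpha> ps \<in> FO (ftr_of ?c) ps \<rightarrow> FO (ftr_comp (subst X Y Z) len) ps"
      by (rule bij_betw_imp_funcset)
    fix qs w x assume "w \<in> Hom (quest X one_cat) ps qs" "x \<in> FO (ftr_of ?c) ps"
    then show "?\<alpha> qs (FM (ftr_of ?c) ps qs w x) = FM (ftr_comp (subst X Y Z) len) ps qs w (?\<alpha> ps x)"
      using prof_iso_nat[OF iso, of ps "()" qs "()" w "()" x] by (simp add: subst_def ftr_of_def)
  qed
  moreover have "?\<alpha> ps (cokl_comp_el X one_cat one_cat one_cat \<Psi> \<Phi> ps () bs y dss ess xs h k) =
       subst_el X Y Z (length ps) (length bs) y (map length ess) xs (FM len (concat ess) ps (cokl_rep_mor X one_cat ps dss ess h k))"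
    if "cokl_rep X one_cat one_cat one_cat \<Psi> \<Phi> ps () bs y dss ess xs h k" for ps bs y dss ess xs h k
    using el[OF _ _ that] by (simp add: subst_el_def \<Phi>_def subst_of_bij(1)[OF Z])
  ultimately show ?thesis by (intro exI[of _ ?\<alpha>]) blast
qed


section \<open>The functor \<open>z \<mapsto> \<integral>\<^sup>m z\<^sup>m \<times> Ym\<close>\<close>

context
  fixes X :: "comb set" and Y :: "(nat, nat \<Rightarrow> nat, 'y) sftr"
  assumes Y: "is_functor (nats X) set_cat Y"
begin

lemma power_coend_dom:
  "(m, t, y) \<in> coend_dom (nats X) (power_coend_int Y z) \<longleftrightarrow> t \<in> {..<m} \<rightarrow>\<^sub>E z \<and> y \<in> FO Y m"
  by (simp add: power_coend_int_def)

lemma power_coend_gen: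
  "coend_gen (nats X) (power_coend_int Y z) =
    {((m, compose {..<m} t f, y), (n, t, FM Y m n f y)) | m n f t y.
      f \<in> Hom (nats X) m n \<and> t \<in> {..<n} \<rightarrow>\<^sub>E z \<and> y \<in> FO Y m}"
proof -
  have id: "FM Y m m (Idn (nats X) m) y = y" if "y \<in> FO Y m" for m y
    using set_functor_id[OF Y, of m y] that by simp
  have idt: "compose {..<m} t (Idn (nats X) m) = t" if "t \<in> {..<m} \<rightarrow>\<^sub>E z" for m t
    using that by (auto simp: compose_def fun_eq_iff PiE_iff extensional_def)
  let ?K = "power_coend_int Y z"
  show ?thesis (is "?L = {?P m n f t y | m n f t y. ?Q m n f t y}")
  proof (intro equalityI subsetI)
    fix r assume "r \<in> ?L"
    then obtain m n f x where r: "r = ((m, FM ?K (n, m) (m, m) (f, Idn (nats X) m) x), (n, FM ?K (n, m) (n, n) (Idn (nats X) n, f) x))"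
      "f \<in> Hom (nats X) m n" "x \<in> FO ?K (n, m)"
      unfolding coend_gen_def by blast
    obtain t y where x: "x = (t, y)" by force
    have Q: "?Q m n f t y" using r by (simp add: x power_coend_int_def del: nats_sel)
    moreover have "r = ?P m n f t y"
      using Q by (simp add: r(1) x power_coend_int_def id idt del: nats_sel)
    ultimately show "r \<in> {?P m n f t y | m n f t y. ?Q m n f t y}" by blast
  next
    fix r assume "r \<in> {?P m n f t y | m n f t y. ?Q m n f t y}"
    then obtain m n f t y where r: "r = ?P m n f t y" and Q: "?Q m n f t y" by blast
    have x: "(t, y) \<in> FO ?K (n, m)" using Q by (simp add: power_coend_int_def)
    have "r = ((m, FM ?K (n, m) (m, m) (f, Idn (nats X) m) (t, y)), (n, FM ?K (n, m) (n, n) (Idn (nats X) n, f) (t, y)))"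
      using Q unfolding r by (simp add: power_coend_int_def id idt del: nats_sel)
    moreover have "m \<in> Obj (nats X)" "n \<in> Obj (nats X)" "f \<in> Hom (nats X) m n" using Q by auto
    ultimately show "r \<in> ?L" using x unfolding coend_gen_def by blast
  qed
qed

lemma power_coend_balance:
  assumes "f \<in> Hom (nats X) m n" "t \<in> {..<n} \<rightarrow>\<^sub>E z" "y \<in> FO Y m"
  shows "power_coend_el X Y z m (compose {..<m} t f) y = power_coend_el X Y z n t (FM Y m n f y)"
  unfolding power_coend_el_def by (rule coend_cls_gen, subst power_coend_gen) (use assms in blast)

lemma power_coend_el_in:
  "t \<in> {..<m} \<rightarrow>\<^sub>E z \<Longrightarrow> y \<in> FO Y m \<Longrightarrow> power_coend_el X Y z m t y \<in> FO (power_coend X Y) z"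
  using coend_cls_in[OF power_coend_dom[THEN iffD2], of t m z y]
  by (simp add: power_coend_el_def power_coend_def)

lemma power_coendE:
  assumes "w \<in> FO (power_coend X Y) z"
  obtains m t y where "t \<in> {..<m} \<rightarrow>\<^sub>E z" "y \<in> FO Y m" "w = power_coend_el X Y z m t y"
proof -
  have "w \<in> coend (nats X) (power_coend_int Y z)" using assms by (simp add: power_coend_def)
  then obtain p where p: "p \<in> coend_dom (nats X) (power_coend_int Y z)" "w = coend_cls (nats X) (power_coend_int Y z) p"
    by (rule coendE)
  obtain m t y where e: "p = (m, t, y)" by (metis prod_cases3)
  show thesis using p that[of t m y] unfolding e power_coend_dom power_coend_el_def by blast
qed

lemma power_coend_FM:
  assumes s: "s \<in> z \<rightarrow>\<^sub>E z'" and t: "t \<in> {..<m} \<rightarrow>\<^sub>E z" and y: "y \<in> FO Y m"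
  shows "FM (power_coend X Y) z z' s (power_coend_el X Y z m t y) = power_coend_el X Y z' m (compose {..<m} s t) y"
proof -
  let ?\<tau> = "\<lambda>(m, t, y). (m, compose {..<m} s t, y)"
  have "coend_map (nats X) (power_coend_int Y z') ?\<tau> (coend_cls (nats X) (power_coend_int Y z) (m, t, y)) =
    coend_cls (nats X) (power_coend_int Y z') (?\<tau> (m, t, y))"
  proof (rule coend_map_cls)
    fix p q assume "(p, q) \<in> coend_gen (nats X) (power_coend_int Y z)"
    then obtain m n f t y where pq: "p = (m, compose {..<m} t f, y)" "q = (n, t, FM Y m n f y)"
      and f: "f \<in> Hom (nats X) m n" and t: "t \<in> {..<n} \<rightarrow>\<^sub>E z" and y: "y \<in> FO Y m"
      unfolding power_coend_gen by blast
    have "compose {..<m} s (compose {..<m} t f) = compose {..<m} (compose {..<n} s t) f"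
      using f by (auto simp: compose_def fun_eq_iff)
    moreover have "compose {..<n} s t \<in> {..<n} \<rightarrow>\<^sub>E z'" using s t by (auto simp: compose_def)
    ultimately show "coend_cls (nats X) (power_coend_int Y z') (?\<tau> p) = coend_cls (nats X) (power_coend_int Y z') (?\<tau> q)"
      using power_coend_balance[OF f _ y, of "compose {..<n} s t" z'] by (simp add: pq power_coend_el_def)
  qed
  then show ?thesis
    using power_coend_el_in[OF t y] by (simp add: power_coend_def power_coend_el_def)
qed

lemma functor_power_coend: "is_functor set_cat set_cat (power_coend X Y :: ('z set, 'z \<Rightarrow> 'z, _) sftr)"
proof (rule set_functorI[OF category_set])
  fix z z' :: "'z set" and s assume "s \<in> Hom set_cat z z'"
  then have s: "s \<in> z \<rightarrow>\<^sub>E z'" by simp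
  have "FM (power_coend X Y) z z' s w \<in> FO (power_coend X Y) z'" if "w \<in> FO (power_coend X Y) z" for w
    using that by (rule power_coendE) (use s in \<open>auto simp: power_coend_FM compose_def intro!: power_coend_el_in\<close>)
  moreover have "FM (power_coend X Y) z z' s \<in> extensional (FO (power_coend X Y) z)"
    by (simp add: power_coend_def)
  ultimately show "FM (power_coend X Y) z z' s \<in> FO (power_coend X Y) z \<rightarrow>\<^sub>E FO (power_coend X Y) z'"
    by (auto simp: PiE_def)
next
  fix z :: "'z set" and w assume "w \<in> FO (power_coend X Y) z"
  then show "FM (power_coend X Y) z z (Idn set_cat z) w = w"
  proof (rule power_coendE)
    fix m t y assume *: "t \<in> {..<m} \<rightarrow>\<^sub>E z" "y \<in> FO Y m" "w = power_coend_el X Y z m t y"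
    have "compose {..<m} (\<lambda>x\<in>z. x) t = t" using *(1) by (auto simp: compose_def fun_eq_iff PiE_iff extensional_def)
    then show ?thesis using power_coend_FM[of "\<lambda>x\<in>z. x" z z t m y] * by simp
  qed
next
  fix z z' z'' :: "'z set" and s s' w
  assume "s \<in> Hom set_cat z z'" "s' \<in> Hom set_cat z' z''" and w: "w \<in> FO (power_coend X Y) z"
  then have s: "s \<in> z \<rightarrow>\<^sub>E z'" "s' \<in> z' \<rightarrow>\<^sub>E z''" by simp_all
  from w show "FM (power_coend X Y) z z'' (Cmp set_cat z z' z'' s' s) w = FM (power_coend X Y) z' z'' s' (FM (power_coend X Y) z z' s w)"
  proof (rule power_coendE)
    fix m t y assume *: "t \<in> {..<m} \<rightarrow>\<^sub>E z" "y \<in> FO Y m" "w = power_coend_el X Y z m t y"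
    have "compose {..<m} (compose z s' s) t = compose {..<m} s' (compose {..<m} s t)"
      using *(1) by (auto simp: compose_def fun_eq_iff)
    moreover have "compose z s' s \<in> z \<rightarrow>\<^sub>E z''" "compose {..<m} s t \<in> {..<m} \<rightarrow>\<^sub>E z'"
      using s *(1) by (auto simp: compose_def)
    ultimately show ?thesis using * s by (simp add: power_coend_FM)
  qed
qed

text \<open>
  A natural transformation \<open>\<gamma>\<close> from \<open>Y\<close> to the restriction of \<open>G\<close> extends to \<open>\<beta> [m, t, y] = G t (\<gamma> y)\<close>, and this is forced,
  because \<open>[m, t, y]\<close> is the image of \<open>\<eta> y = [m, id, y]\<close> under \<open>t\<close>.  Here the function \<open>t\<close> on \<open>{..<m}\<close> is transferred
  to \<open>e ` {..<m}\<close>, which is the purpose of \<open>ext\<close>.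
\<close>

lemma left_kan_power_coend:
  fixes e :: "nat \<Rightarrow> 'u"
  assumes e: "inj e"
  shows "left_kan TYPE('g) (nats X) set_cat (nat_incl e) Y (power_coend X Y)
    (\<lambda>m y. power_coend_el X Y (e ` {..<m}) m (\<lambda>j\<in>{..<m}. e j) y)"
proof -
  let ?L = "power_coend X Y :: ('u set, 'u \<Rightarrow> 'u, _) sftr" and ?K = "nat_incl e"
  let ?\<eta> = "\<lambda>m y. power_coend_el X Y (e ` {..<m}) m (\<lambda>j\<in>{..<m}. e j) y"
  have inv: "the_inv_into {..<m} e (e j) = j" if "j < m" for m j
    using e that by (intro the_inv_into_f_f) (auto intro: inj_on_subset)
  have KO [simp]: "FO ?K m = e ` {..<m}" for m by (simp add: nat_incl_def)
  have KM: "FM ?K m n f (e j) = e (f j)" if "j < m" for m n f j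
    using that by (simp add: nat_incl_def inv)
  have Kext: "FM ?K m n f \<in> extensional (e ` {..<m})" for m n f by (simp add: nat_incl_def)
  have KF: "FM ?K m n f \<in> e ` {..<m} \<rightarrow>\<^sub>E e ` {..<n}" if "f \<in> Hom (nats X) m n" for m n f
    using that Kext by (auto simp: PiE_iff KM)
  have K: "is_functor (nats X) set_cat ?K"
  proof (rule set_functorI[OF category_nats])
    fix m n f assume "f \<in> Hom (nats X) m n"
    then show "FM ?K m n f \<in> FO ?K m \<rightarrow>\<^sub>E FO ?K n" using KF by simp
  next
    fix m x assume "x \<in> FO ?K m"
    then show "FM ?K m m (Idn (nats X) m) x = x" by (auto simp: KM)
  next
    fix l m n f g x assume "f \<in> Hom (nats X) l m" "x \<in> FO ?K l"
    then show "FM ?K l n (Cmp (nats X) l m n g f) x = FM ?K m n g (FM ?K l m f x)"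
    proof -
      obtain j where j: "j < l" "x = e j" using \<open>x \<in> FO ?K l\<close> by auto
      then have "f j < m" using \<open>f \<in> Hom (nats X) l m\<close> by auto
      then show ?thesis using j by (simp add: KM compose_eq)
    qed
  qed
  define ext where "ext m t = (\<lambda>x\<in>e ` {..<m}. t (the_inv_into {..<m} e x))" for m and t :: "nat \<Rightarrow> 'u"
  have ext: "ext m t (e j) = t j" if "j < m" for m t j using that by (simp add: ext_def inv)
  have ext_in: "ext m t \<in> e ` {..<m} \<rightarrow>\<^sub>E s" if "t \<in> {..<m} \<rightarrow>\<^sub>E s" for m t s
  proof (rule PiE_I)
    fix x assume "x \<in> e ` {..<m}"
    then obtain j where "j < m" "x = e j" by auto
    then show "ext m t x \<in> s" using PiE_mem[OF that, of j] by (simp add: ext)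
  qed (simp add: ext_def)
  have extI: "p = ext m t" if "p \<in> extensional (e ` {..<m})" "\<And>j. j < m \<Longrightarrow> p (e j) = t j" for p m t
    using that by (intro extensionalityI[of _ "e ` {..<m}"]) (auto simp: ext ext_def inv)
  have e_in: "(\<lambda>j\<in>{..<m}. e j) \<in> {..<m} \<rightarrow>\<^sub>E e ` {..<m}" for m by auto
  have \<eta>_in: "?\<eta> m y \<in> FO ?L (e ` {..<m})" if "y \<in> FO Y m" for m y
    by (rule power_coend_el_in[OF e_in that])
  have nat\<eta>: "nat_trans (nats X) Y (ftr_comp ?L ?K) ?\<eta>"
    unfolding nat_trans_def
  proof (intro conjI ballI)
    fix m show "?\<eta> m \<in> FO Y m \<rightarrow> FO (ftr_comp ?L ?K) m" using \<eta>_in by simp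
    fix n f y assume f: "f \<in> Hom (nats X) m n" and y: "y \<in> FO Y m"
    have "compose {..<m} (FM ?K m n f) (\<lambda>j\<in>{..<m}. e j) = compose {..<m} (\<lambda>j\<in>{..<n}. e j) f"
      using f by (auto simp: compose_def fun_eq_iff KM)
    then show "?\<eta> n (FM Y m n f y) = FM (ftr_comp ?L ?K) m n f (?\<eta> m y)"
      using power_coend_FM[OF KF[OF f] e_in y] power_coend_balance[OF f e_in y] by simp
  qed (intro Y functor_ftr_comp[OF K functor_power_coend])+
  show ?thesis
    unfolding left_kan_def
  proof (intro conjI allI impI K functor_power_coend nat\<eta>, elim conjE)
    fix G :: "('u set, 'u \<Rightarrow> 'u, 'g) sftr" and \<gamma>
    assume G: "is_functor set_cat set_cat G" and \<gamma>: "nat_trans (nats X) Y (ftr_comp G ?K) \<gamma>"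
    have GM: "FM G s s' f x \<in> FO G s'" if "f \<in> s \<rightarrow>\<^sub>E s'" "x \<in> FO G s" for s s' f x
      using set_functor_app[OF G, of s s' f x] that by simp
    have GC: "FM G s' s'' g (FM G s s' f x) = FM G s s'' (compose s g f) x" if "f \<in> s \<rightarrow>\<^sub>E s'" "g \<in> s' \<rightarrow>\<^sub>E s''" "x \<in> FO G s" for s s' s'' f g x
      using set_functor_comp[OF G, of s s' s'' f g x] that by simp
    have \<gamma>_in: "\<gamma> m y \<in> FO G (e ` {..<m})" if "y \<in> FO Y m" for m y
      using \<gamma> that by (auto simp: nat_trans_def)
    have \<gamma>_nat: "\<gamma> n (FM Y m n f y) = FM G (e ` {..<m}) (e ` {..<n}) (FM ?K m n f) (\<gamma> m y)"
      if "f \<in> Hom (nats X) m n" "y \<in> FO Y m" for m n f y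
    proof -
      have "\<gamma> n (FM Y m n f y) = FM (ftr_comp G ?K) m n f (\<gamma> m y)"
        using \<gamma> that unfolding nat_trans_def nats_sel(1) by blast
      then show ?thesis by simp
    qed
    \<comment> \<open>By \<open>coend_lift\<close> the union is a singleton.\<close>
    define \<beta> where "\<beta> s w = the_elem (\<Union>(m, t, y)\<in>w. {FM G (e ` {..<m}) s (ext m t) (\<gamma> m y)})" for s w
    have \<beta>: "\<beta> s (power_coend_el X Y s m t y) = FM G (e ` {..<m}) s (ext m t) (\<gamma> m y)" for s m t y
    proof -
      let ?T = "\<lambda>(m, t, y). {FM G (e ` {..<m}) s (ext m t) (\<gamma> m y)}"
      have "(\<Union>p\<in>coend_cls (nats X) (power_coend_int Y s) (m, t, y). ?T p) = ?T (m, t, y)"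
      proof (rule coend_lift)
        fix p q assume "(p, q) \<in> coend_gen (nats X) (power_coend_int Y s)"
        then obtain m n f t y where pq: "p = (m, compose {..<m} t f, y)" "q = (n, t, FM Y m n f y)"
          and f: "f \<in> Hom (nats X) m n" and t: "t \<in> {..<n} \<rightarrow>\<^sub>E s" and y: "y \<in> FO Y m"
          unfolding power_coend_gen by blast
        have "compose (e ` {..<m}) (ext n t) (FM ?K m n f) = ext m (compose {..<m} t f)"
        proof (rule extI)
          fix j assume "j < m"
          moreover from this have "f j < n" using f by auto
          ultimately show "compose (e ` {..<m}) (ext n t) (FM ?K m n f) (e j) = compose {..<m} t f j"
            by (simp add: compose_eq KM ext)
        qed (simp add: compose_def)
        then show "?T p = ?T q"
          using GC[OF KF[OF f] ext_in[OF t] \<gamma>_in[OF y]] by (simp add: pq \<gamma>_nat[OF f y])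
      qed
      then show ?thesis by (simp add: \<beta>_def power_coend_el_def)
    qed
    have nat\<beta>: "nat_trans set_cat ?L G \<beta>"
      unfolding nat_trans_def
    proof (intro conjI ballI)
      fix s :: "'u set"
      show "\<beta> s \<in> FO ?L s \<rightarrow> FO G s"
      proof
        fix w assume "w \<in> FO ?L s"
        then show "\<beta> s w \<in> FO G s"
          by (rule power_coendE) (simp add: \<beta> GM ext_in \<gamma>_in)
      qed
      fix s' f w assume "f \<in> Hom set_cat s s'" and w: "w \<in> FO ?L s"
      then have f: "f \<in> s \<rightarrow>\<^sub>E s'" by simp
      from w show "\<beta> s' (FM ?L s s' f w) = FM G s s' f (\<beta> s w)"
      proof (rule power_coendE)
        fix m t y assume *: "t \<in> {..<m} \<rightarrow>\<^sub>E s" "y \<in> FO Y m" "w = power_coend_el X Y s m t y"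
        have "compose (e ` {..<m}) f (ext m t) = ext m (compose {..<m} f t)"
          by (rule extI) (simp_all add: compose_def ext)
        then show ?thesis
          using GC[OF ext_in[OF *(1)] f \<gamma>_in[OF *(2)]] by (simp add: *(3) power_coend_FM[OF f *(1,2)] \<beta>)
      qed
    qed (intro functor_power_coend G)+
    have \<beta>\<eta>: "\<beta> (FO ?K m) (?\<eta> m y) = \<gamma> m y" if "y \<in> FO Y m" for m y
    proof -
      have "ext m (\<lambda>j\<in>{..<m}. e j) = (\<lambda>x\<in>e ` {..<m}. x)"
        by (rule extI[symmetric]) auto
      then show ?thesis using set_functor_id[OF G, of "e ` {..<m}" "\<gamma> m y"] \<gamma>_in[OF that] by (simp add: \<beta>)
    qed
    have uniq: "\<beta>' s w = \<beta> s w"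
      if \<beta>': "nat_trans set_cat ?L G \<beta>'" "\<forall>m\<in>Obj (nats X). \<forall>y\<in>FO Y m. \<beta>' (FO ?K m) (?\<eta> m y) = \<gamma> m y"
        and w: "w \<in> FO ?L s" for \<beta>' s w
      using w
    proof (rule power_coendE)
      fix m t y assume *: "t \<in> {..<m} \<rightarrow>\<^sub>E s" "y \<in> FO Y m" "w = power_coend_el X Y s m t y"
      have "compose {..<m} (ext m t) (\<lambda>j\<in>{..<m}. e j) = t"
        using *(1) by (auto simp: compose_def fun_eq_iff ext PiE_iff extensional_def)
      then have w': "w = FM ?L (e ` {..<m}) s (ext m t) (?\<eta> m y)"
        by (simp add: *(3) power_coend_FM[OF ext_in[OF *(1)] e_in *(2)])
      have "\<beta>' s w = FM G (e ` {..<m}) s (ext m t) (\<beta>' (e ` {..<m}) (?\<eta> m y))"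
        unfolding w' using \<beta>'(1) ext_in[OF *(1)] \<eta>_in[OF *(2)] unfolding nat_trans_def by simp
      also have "\<dots> = \<beta> s w" using \<beta>'(2) *(2) by (simp add: *(3) \<beta>)
      finally show ?thesis .
    qed
    show "\<exists>\<beta>. (nat_trans set_cat ?L G \<beta> \<and> (\<forall>a\<in>Obj (nats X). \<forall>y\<in>FO Y a. \<beta> (FO ?K a) (?\<eta> a y) = \<gamma> a y)) \<and>
        (\<forall>\<beta>'. nat_trans set_cat ?L G \<beta>' \<and> (\<forall>a\<in>Obj (nats X). \<forall>y\<in>FO Y a. \<beta>' (FO ?K a) (?\<eta> a y) = \<gamma> a y) \<longrightarrow>
           (\<forall>s\<in>Obj set_cat. \<forall>x\<in>FO ?L s. \<beta>' s x = \<beta> s x))"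
      by (rule exI[of _ \<beta>]) (intro conjI ballI allI impI; (elim conjE)?; intro nat\<beta> \<beta>\<eta> uniq; assumption)
  qed
qed

end


section \<open>Composites from the empty category\<close>

lemma op_empty_cat [simp]: "op_cat empty_cat = empty_cat"
  by (simp add: op_cat_def empty_cat_def)

lemma Obj_empty_cat [simp]: "Obj empty_cat = {}"
  by (simp add: empty_cat_def)

lemma bang_Hom_Nil: "Hom (bang X C) [] [] = {[]}"
proof -
  have "(\<lambda>j. fst (h ! j)) \<in> cls X 0 0" for h :: "(nat \<times> 'm) list" by (rule cls_id) simp
  then show ?thesis by (auto simp: bang_Hom_iff)
qed

lemma cat_iso_quest_empty: "cat_iso (quest X empty_cat) one_cat \<lparr>FO = (\<lambda>_. ()), FM = (\<lambda>_ _ _. ())\<rparr>"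
  unfolding cat_iso_def by (auto intro!: functorI simp: bij_betw_def bang_Hom_Nil)

definition tuple_prof :: "'z set \<Rightarrow> ('o, 'm, nat, nat \<Rightarrow> nat, nat \<Rightarrow> 'z) prof" where
  "tuple_prof z = \<lparr>FO = (\<lambda>(_, m). {..<m} \<rightarrow>\<^sub>E z),
     FM = (\<lambda>(_, m) (_, m') (_, f). \<lambda>t\<in>{..<m} \<rightarrow>\<^sub>E z. compose {..<m'} t f)\<rparr>"

text \<open>
  The tuple \<open>xs\<close> of a class, transported along \<open>i\<close>; every member of the class yields the same one.
\<close>

definition tuple_of :: "('x \<Rightarrow> 'u) \<Rightarrow> unit list \<Rightarrow> (unit list list \<times> 'x list \<times> (nat \<times> unit) list) set \<Rightarrow> nat \<Rightarrow> 'u" where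
  "tuple_of i bs c = the_elem (\<Union>(ess, xs, k)\<in>c. {\<lambda>j\<in>{..<length bs}. i (xs ! j)})"

context
  fixes X :: "comb set" and \<Phi> :: "(unit list, (nat \<times> unit) list, unit, unit, 'x) prof" and i :: "'x \<Rightarrow> 'u"
  assumes \<Phi>: "profunctor (quest X empty_cat) one_cat \<Phi>" and i: "inj i"
begin

lemmas empty_facts = category_empty category_one \<Phi>

lemma empty_id: "x \<in> FO \<Phi> ([], ()) \<Longrightarrow> FM \<Phi> ([], ()) ([], ()) ([], ()) x = x"
  using profunctor_id[OF \<Phi>, of "[]" "()" x] by (simp add: bang_def)

lemma Nil_lists: "ds \<in> lists {[]} \<longleftrightarrow> (\<forall>j<length ds. ds ! j = [])"
  unfolding in_lists_conv_set all_set_conv_all_nth by simp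

text \<open>
  All objects are \<open>[]\<close> and all morphisms identities, so that the two sides of a generating pair carry the same \<open>xs\<close>.
\<close>

lemma tuple_of_el: "tuple_of i bs (kernel_el X empty_cat one_cat \<Phi> [] bs ess xs k) = (\<lambda>j\<in>{..<length bs}. i (xs ! j))"
proof -
  let ?T = "\<lambda>(ess, xs, k). {\<lambda>j\<in>{..<length bs}. i (xs ! j)}"
  have "(\<Union>p\<in>coend_cls (pow_cat (length bs) (quest X empty_cat)) (kernel_int X empty_cat one_cat \<Phi> ([], bs)) (ess, xs, k). ?T p) =
      ?T (ess, xs, k)"
  proof (rule coend_lift)
    have o: "[] \<in> lists (Obj empty_cat)" "bs \<in> lists (Obj one_cat)" by simp_all
    fix p q assume "(p, q) \<in> coend_gen (pow_cat (length bs) (quest X empty_cat)) (kernel_int X empty_cat one_cat \<Phi> ([], bs))"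
    then obtain ds es u xs k k' where
      p: "p = (ds, xs, k')" and
      q: "q = (es, map (\<lambda>i. FM \<Phi> (ds ! i, bs ! i) (es ! i, bs ! i) (u ! i, Idn one_cat (bs ! i)) (xs ! i)) [0..<length bs], k)"
      and ds: "length ds = length bs" "ds \<in> lists (lists (Obj empty_cat))" and es: "length es = length bs" "es \<in> lists (lists (Obj empty_cat))"
      and u: "u \<in> Hom (pow_cat (length bs) (qop X empty_cat)) es ds"
      and xs: "length xs = length bs" "\<forall>i<length bs. xs ! i \<in> FO \<Phi> (ds ! i, bs ! i)"
      unfolding kernel_gen[OF empty_facts o] by blast
    have "FM \<Phi> (ds ! j, bs ! j) (es ! j, bs ! j) (u ! j, Idn one_cat (bs ! j)) (xs ! j) = xs ! j" if "j < length bs" for j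
      using that ds es u xs empty_id[of "xs ! j"] by (simp add: Nil_lists bang_Hom_Nil del: in_lists_conv_set)
    then show "?T p = ?T q" unfolding p q by (simp add: restrict_def fun_eq_iff)
  qed
  then show ?thesis by (simp add: tuple_of_def kernel_el_def)
qed

lemma tuple_of_bij:
  "bij_betw (tuple_of i bs) (FO (kernel X empty_cat one_cat \<Phi>) ([], bs)) ({..<length bs} \<rightarrow>\<^sub>E i ` FO \<Phi> ([], ()))"
proof (rule bij_betw_imageI)
  show "inj_on (tuple_of i bs) (FO (kernel X empty_cat one_cat \<Phi>) ([], bs))"
  proof (rule inj_onI)
    fix w w' assume w: "w \<in> FO (kernel X empty_cat one_cat \<Phi>) ([], bs)" and w': "w' \<in> FO (kernel X empty_cat one_cat \<Phi>) ([], bs)"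
      and eq: "tuple_of i bs w = tuple_of i bs w'"
    from w obtain ds xs k where d: "length ds = length bs" "ds \<in> lists (lists (Obj empty_cat))" "length xs = length bs"
      "k \<in> Hom (qop X empty_cat) [] (concat ds)" "w = kernel_el X empty_cat one_cat \<Phi> [] bs ds xs k"
      by (rule kernelE[OF empty_facts])
    from w' obtain ds' xs' k' where d': "length ds' = length bs" "ds' \<in> lists (lists (Obj empty_cat))" "length xs' = length bs"
      "k' \<in> Hom (qop X empty_cat) [] (concat ds')" "w' = kernel_el X empty_cat one_cat \<Phi> [] bs ds' xs' k'"
      by (rule kernelE[OF empty_facts])
    have n: "ds ! j = []" "ds' ! j = []" if "j < length bs" for j
      using d(1,2) d'(1,2) that by (simp_all add: Nil_lists del: in_lists_conv_set)
    have c: "concat ds = []" "concat ds' = []"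
      using n d(1) d'(1) by (auto simp: in_set_conv_nth)
    have "k = k'" using d(4) d'(4) unfolding c by (simp add: bang_Hom_Nil)
    moreover have "ds = ds'" using n d(1) d'(1) by (auto intro: nth_equalityI)
    moreover have "xs ! j = xs' ! j" if "j < length bs" for j
      using fun_cong[OF eq, of j] that injD[OF i] by (simp add: d(5) d'(5) tuple_of_el)
    then have "xs = xs'" using d(3) d'(3) by (auto intro: nth_equalityI)
    ultimately show "w = w'" by (simp add: d(5) d'(5))
  qed
  show "tuple_of i bs ` FO (kernel X empty_cat one_cat \<Phi>) ([], bs) = {..<length bs} \<rightarrow>\<^sub>E i ` FO \<Phi> ([], ())"
  proof (intro equalityI subsetI)
    fix t assume "t \<in> tuple_of i bs ` FO (kernel X empty_cat one_cat \<Phi>) ([], bs)"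
    then obtain c where c: "c \<in> FO (kernel X empty_cat one_cat \<Phi>) ([], bs)" "t = tuple_of i bs c" by blast
    from c(1) obtain ds xs k where "length ds = length bs" "ds \<in> lists (lists (Obj empty_cat))" "length xs = length bs"
      "\<forall>j<length bs. xs ! j \<in> FO \<Phi> (ds ! j, bs ! j)" "c = kernel_el X empty_cat one_cat \<Phi> [] bs ds xs k"
      by (rule kernelE[OF empty_facts])
    then show "t \<in> {..<length bs} \<rightarrow>\<^sub>E i ` FO \<Phi> ([], ())"
      by (auto simp: c(2) tuple_of_el Nil_lists simp del: in_lists_conv_set)
  next
    fix t assume t: "t \<in> {..<length bs} \<rightarrow>\<^sub>E i ` FO \<Phi> ([], ())"
    define xs where "xs = map (\<lambda>j. inv i (t j)) [0..<length bs]"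
    have xs: "xs ! j \<in> FO \<Phi> ([], ())" "i (xs ! j) = t j" if "j < length bs" for j
      using PiE_mem[OF t, of j] that inv_f_f[OF i] by (auto simp: xs_def)
    have "kernel_el X empty_cat one_cat \<Phi> [] bs (replicate (length bs) []) xs [] \<in> FO (kernel X empty_cat one_cat \<Phi>) ([], bs)"
      by (rule kernel_el_in[OF empty_facts]) (use xs in \<open>auto simp: xs_def bang_Hom_Nil concat_replicate_trivial\<close>)
    moreover have "t = tuple_of i bs (kernel_el X empty_cat one_cat \<Phi> [] bs (replicate (length bs) []) xs [])"
      using t xs by (auto simp: tuple_of_el fun_eq_iff PiE_iff extensional_def)
    ultimately show "t \<in> tuple_of i bs ` FO (kernel X empty_cat one_cat \<Phi>) ([], bs)" by blast
  qed
qed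

lemma tuple_of_natural:
  assumes u: "u \<in> Hom (bang X one_cat) bs bs'" and z: "z \<in> FO (kernel X empty_cat one_cat \<Phi>) ([], bs)"
  shows "tuple_of i bs' (FM (kernel X empty_cat one_cat \<Phi>) ([], bs) ([], bs') ([], u) z) =
    compose {..<length bs'} (tuple_of i bs z) (FM len bs' bs u)"
proof -
  from z obtain ds xs k where d: "length ds = length bs" "ds \<in> lists (lists (Obj empty_cat))" "length xs = length bs"
    "\<forall>j<length bs. xs ! j \<in> FO \<Phi> (ds ! j, bs ! j)"
    "k \<in> Hom (qop X empty_cat) [] (concat ds)" and z': "z = kernel_el X empty_cat one_cat \<Phi> [] bs ds xs k"
    by (rule kernelE[OF empty_facts])
  have n: "ds ! j = []" if "j < length bs" for j
    using d(1,2) that by (simp add: Nil_lists del: in_lists_conv_set)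
  have u': "u \<in> Hom (bang X (op_cat one_cat)) bs bs'" using u by simp
  have k0: "[] \<in> Hom (qop X empty_cat) [] []" by (simp add: bang_Hom_Nil)
  have o: "[] \<in> lists (Obj empty_cat)" "bs \<in> lists (Obj one_cat)" "bs' \<in> lists (Obj one_cat)" by simp_all
  have idn: "Idn (bang X empty_cat) [] = []" by (simp add: bang_def)
  show ?thesis
    unfolding z' kernel_FM[OF empty_facts o(1,2,1,3) k0 u' d(1-5)] tuple_of_el
    using bang_Hom_less[OF u] d(4) n empty_id
    by (auto simp: compose_def len_FM fun_eq_iff idn)
qed

lemma tuple_of_iso:
  "prof_iso (quest X empty_cat) (quest X one_cat) (kernel X empty_cat one_cat \<Phi>) (tuple_prof (i ` FO \<Phi> ([], ()))) id_ftr len (\<lambda>_. tuple_of i)"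
  unfolding prof_iso_def using bij_betw_apply[OF tuple_of_bij]
  by (auto simp: bang_Hom_Nil tuple_of_natural tuple_of_bij tuple_prof_def)

lemma profunctor_tuple: "profunctor (quest X empty_cat) (nats X) (tuple_prof (i ` FO \<Phi> ([], ())))"
  by (rule profunctor_transport[OF category_quest[OF category_empty] category_quest[OF category_one]
      category_quest[OF category_empty] category_nats profunctor_kernel[OF empty_facts] cat_iso_id cat_iso_len tuple_of_iso])
    (auto simp: tuple_prof_def)

lemma cokl_comp_power_coend:
  fixes Y :: "(nat, nat \<Rightarrow> nat, 'y) sftr"
  assumes Y: "is_functor (nats X) set_cat Y"
  defines "\<Psi> \<equiv> prof_of (ftr_comp Y len)" and "z \<equiv> FO \<Phi> ([], ())"
  shows "\<exists>\<theta>. bij_betw \<theta> (FO (cokl_comp X empty_cat one_cat one_cat \<Psi> \<Phi>) ([], ())) (FO (power_coend X Y) (i ` z)) \<and>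
    (\<forall>bs y dss ess xs h k.
       cokl_rep X empty_cat one_cat one_cat \<Psi> \<Phi> [] () bs y dss ess xs h k \<longrightarrow>
       \<theta> (cokl_comp_el X empty_cat one_cat one_cat \<Psi> \<Phi> [] () bs y dss ess xs h k) =
       power_coend_el X Y (i ` z) (length bs) (\<lambda>j\<in>{..<length bs}. i (xs ! j)) y)"
proof -
  let ?E = "tuple_prof (i ` z) :: (unit list, (nat \<times> unit) list, nat, nat \<Rightarrow> nat, nat \<Rightarrow> 'u) prof"
  have E: "profunctor (quest X empty_cat) (nats X) ?E" unfolding z_def by (rule profunctor_tuple)
  have \<Psi>: "profunctor (quest X one_cat) one_cat \<Psi>"
    unfolding \<Psi>_def by (rule profunctor_Z[OF Y])
  have \<Psi>': "profunctor (nats X) one_cat (prof_of Y)" by (rule profunctor_prof_of[OF category_nats Y])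
  note Q0 = category_quest[OF category_empty, of X]
  have \<Psi>O: "FO \<Psi> (b, d) = FO (prof_of Y) (FO len b, d)"
    and \<Psi>M: "FM \<Psi> (b, d) (b', d') (u, v) = FM (prof_of Y) (FO len b, d) (FO len b', d') (FM len b b' u, v)" for b d b' d' u v
    by (simp_all add: \<Psi>_def)
  have idF: "is_functor (quest X empty_cat) (quest X empty_cat) id_ftr" using cat_iso_id by (auto simp: cat_iso_def)
  let ?F = "prof_comp_int (quest X empty_cat) one_cat (prof_of Y) ?E ([], ())" and ?G = "power_coend_int Y (i ` z)"
  obtain \<alpha> where iso: "prof_iso (quest X empty_cat) one_cat (cokl_comp X empty_cat one_cat one_cat \<Psi> \<Phi>)
      (prof_comp (quest X empty_cat) (nats X) one_cat (prof_of Y) ?E) id_ftr id_ftr \<alpha>"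
    and el: "\<And>as d bs y dss ess xs h k. as \<in> lists (Obj empty_cat) \<Longrightarrow> d \<in> Obj one_cat \<Longrightarrow>
      cokl_rep X empty_cat one_cat one_cat \<Psi> \<Phi> as d bs y dss ess xs h k \<Longrightarrow>
      \<alpha> as d (cokl_comp_el X empty_cat one_cat one_cat \<Psi> \<Phi> as d bs y dss ess xs h k) =
      prof_comp_el (quest X empty_cat) (nats X) one_cat (prof_of Y) ?E (as, d) (length bs) y
        (tuple_of i bs (kernel_el X empty_cat one_cat \<Phi> as bs ess xs (cokl_rep_mor X empty_cat as dss ess h k)))"
    by (rule cokl_comp_iso[OF category_empty category_one category_one Q0 category_nats \<Phi> \<Psi> E \<Psi>'
      idF cat_iso_len tuple_of_iso[folded z_def] \<Psi>O \<Psi>M, unfolded id_ftr_sel len_FO]) (rule that)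
  from prof_iso_bij[OF iso, of "[]" "()"] have \<alpha>: "bij_betw (\<alpha> [] ()) (FO (cokl_comp X empty_cat one_cat one_cat \<Psi> \<Phi>) ([], ())) (coend (nats X) ?F)"
    by (simp add: prof_comp_def)
  \<comment> \<open>The integrands of \<open>prof_comp\<close> and of \<open>power_coend\<close> differ in the order of their factors.\<close>
  let ?\<sigma> = "\<lambda>(m, y, t). (m, t, y)"
  have b: "\<forall>m\<in>Obj (nats X). \<forall>n\<in>Obj (nats X). bij_betw prod.swap (FO ?F (m, n)) (FO ?G (FO id_ftr m, FO id_ftr n))"
    by (simp add: prof_comp_int_def power_coend_int_def tuple_prof_def bij_betw_def product_swap)
  have app: "\<forall>m\<in>Obj (nats X). \<forall>n\<in>Obj (nats X). \<forall>m'\<in>Obj (nats X). \<forall>n'\<in>Obj (nats X). \<forall>u\<in>Hom (nats X) m' m. \<forall>v\<in>Hom (nats X) n n'. \<forall>p\<in>FO ?F (m, n).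
      FM ?F (m, n) (m', n') (u, v) p \<in> FO ?F (m', n')"
    using category_id[OF Q0, of "[]"] by (auto simp: prof_comp_int_def intro!: profunctor_app[OF E] set_functor_app[OF Y] simp del: nats_sel quest_sel(2))
  have n: "\<forall>m\<in>Obj (nats X). \<forall>n\<in>Obj (nats X). \<forall>m'\<in>Obj (nats X). \<forall>n'\<in>Obj (nats X). \<forall>u\<in>Hom (nats X) m' m. \<forall>v\<in>Hom (nats X) n n'. \<forall>p\<in>FO ?F (m, n).
      prod.swap (FM ?F (m, n) (m', n') (u, v) p) =
      FM ?G (FO id_ftr m, FO id_ftr n) (FO id_ftr m', FO id_ftr n') (FM id_ftr m' m u, FM id_ftr n n' v) (prod.swap p)"
    by (auto simp: prof_comp_int_def power_coend_int_def tuple_prof_def)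
  have \<sigma>: "?\<sigma> (m, p) = (FO id_ftr m, prod.swap p)" for m p by (cases p) simp
  note swap = coend_map_iso[where \<sigma> = ?\<sigma> and s = "\<lambda>_ _. prod.swap", OF category_nats cat_iso_id b app n \<sigma>]
  define \<theta> where "\<theta> = coend_map (nats X) ?G ?\<sigma> \<circ> \<alpha> [] ()"
  have "bij_betw \<theta> (FO (cokl_comp X empty_cat one_cat one_cat \<Psi> \<Phi>) ([], ())) (FO (power_coend X Y) (i ` z))"
    using bij_betw_trans[OF \<alpha> swap(4)] by (simp add: \<theta>_def power_coend_def)
  moreover have "\<theta> (cokl_comp_el X empty_cat one_cat one_cat \<Psi> \<Phi> [] () bs y dss ess xs h k) =
       power_coend_el X Y (i ` z) (length bs) (\<lambda>j\<in>{..<length bs}. i (xs ! j)) y"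
    if "cokl_rep X empty_cat one_cat one_cat \<Psi> \<Phi> [] () bs y dss ess xs h k" for bs y dss ess xs h k
  proof -
    have "\<alpha> [] () (cokl_comp_el X empty_cat one_cat one_cat \<Psi> \<Phi> [] () bs y dss ess xs h k) =
       prof_comp_el (quest X empty_cat) (nats X) one_cat (prof_of Y) ?E ([], ()) (length bs) y (\<lambda>j\<in>{..<length bs}. i (xs ! j))"
      using el[OF _ _ that] unfolding tuple_of_el id_ftr_sel len_FO by simp
    then show ?thesis
      unfolding \<theta>_def comp_apply prof_comp_el_def power_coend_el_def by (simp only: swap(3) prod.case)
  qed
  ultimately show ?thesis by blast
qed

end

theorem mainTheorem2:
  fixes X :: "comb set"
  assumes "X \<noteq> {CDelta}" and "X \<noteq> {CDelta, CEpsilon}"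
  shows
    \<comment> \<open>the composition in general\<close>
    "(\<forall>(A :: ('o, 'm) cat) (B :: ('p, 'n) cat) (D :: ('q, 'k) cat)
       (\<Phi> :: ('o list, (nat \<times> 'm) list, 'p, 'n, 'x) prof)
       (\<Psi> :: ('p list, (nat \<times> 'n) list, 'q, 'k, 'y) prof).
       category A \<and> category B \<and> category D \<and>
       profunctor (quest X A) B \<Phi> \<and> profunctor (quest X B) D \<Psi> \<longrightarrow>
       (\<exists>\<alpha>. nat_iso (prod_cat (quest X A) (op_cat D)) (cokl_comp X A B D \<Psi> \<Phi>) (formula X A B D \<Psi> \<Phi>) \<alpha> \<and>
          (\<forall>as\<in>Obj (quest X A). \<forall>d\<in>Obj D. \<forall>bs y dss ess xs h k.
             cokl_rep X A B D \<Psi> \<Phi> as d bs y dss ess xs h k \<longrightarrow>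
             \<alpha> (as, d) (cokl_comp_el X A B D \<Psi> \<Phi> as d bs y dss ess xs h k) =
             formula_el X A B D \<Psi> \<Phi> as d bs y ess xs (cokl_rep_mor X A as dss ess h k))))
   \<and>
     \<comment> \<open>the case \<open>A = B = D = \<one>\<close>: substitution, and the identity of \<open>\<one>\<close>\<close>
     cat_iso (quest X one_cat) (nats X) len \<and>
     (\<forall>(Y :: (nat, nat \<Rightarrow> nat, 'y) sftr) (Z :: (nat, nat \<Rightarrow> nat, 'x) sftr).
       is_functor (nats X) set_cat Y \<and> is_functor (nats X) set_cat Z \<longrightarrow>
       (let \<Psi> = prof_of (ftr_comp Y len); \<Phi> = prof_of (ftr_comp Z len) in
        \<exists>\<alpha>. nat_iso (quest X one_cat)
               (ftr_of (cokl_comp X one_cat one_cat one_cat \<Psi> \<Phi>)) (ftr_comp (subst X Y Z) len) \<alpha> \<and>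
          (\<forall>ps\<in>Obj (quest X one_cat). \<forall>bs y dss ess xs h k.
             cokl_rep X one_cat one_cat one_cat \<Psi> \<Phi> ps () bs y dss ess xs h k \<longrightarrow>
             \<alpha> ps (cokl_comp_el X one_cat one_cat one_cat \<Psi> \<Phi> ps () bs y dss ess xs h k) =
             subst_el X Y Z (length ps) (length bs) y (map length ess) xs
               (FM len (concat ess) ps (cokl_rep_mor X one_cat ps dss ess h k))))) \<and>
     nat_iso (quest X one_cat) (ftr_of (cokl_id X one_cat)) (ftr_comp (hom_ftr (nats X) 1) len)
       (\<lambda>ps. FM len [()] ps)
   \<and>
     \<comment> \<open>the case \<open>A\<close> empty, \<open>B = D = \<one>\<close>: the value of the left Kan extension\<close>
     cat_iso (quest X empty_cat) one_cat \<lparr>FO = (\<lambda>_. ()), FM = (\<lambda>_ _ _. ())\<rparr> \<and>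
     (\<forall>(Y :: (nat, nat \<Rightarrow> nat, 'y) sftr) (\<Phi> :: (unit list, (nat \<times> unit) list, unit, unit, 'x) prof).
       is_functor (nats X) set_cat Y \<and> profunctor (quest X empty_cat) one_cat \<Phi> \<longrightarrow>
       (let \<Psi> = prof_of (ftr_comp Y len); z = FO \<Phi> ([], ()) in
        (\<exists>\<theta>. bij_betw \<theta> (FO (cokl_comp X empty_cat one_cat one_cat \<Psi> \<Phi>) ([], ())) (FO (power_coend X Y) z) \<and>
          (\<forall>bs y dss ess xs h k.
             cokl_rep X empty_cat one_cat one_cat \<Psi> \<Phi> [] () bs y dss ess xs h k \<longrightarrow>
             \<theta> (cokl_comp_el X empty_cat one_cat one_cat \<Psi> \<Phi> [] () bs y dss ess xs h k) =
             power_coend_el X Y z (length bs) (\<lambda>i\<in>{..<length bs}. xs ! i) y)) \<and>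
        (\<forall>(e :: nat \<Rightarrow> 'u) (i :: 'x \<Rightarrow> 'u). inj e \<and> inj i \<longrightarrow>
          left_kan TYPE('g) (nats X) set_cat (nat_incl e) Y (power_coend X Y)
            (\<lambda>m y. power_coend_el X Y (e ` {..<m}) m (\<lambda>j\<in>{..<m}. e j) y) \<and>
          (\<exists>\<theta>. bij_betw \<theta> (FO (cokl_comp X empty_cat one_cat one_cat \<Psi> \<Phi>) ([], ())) (FO (power_coend X Y) (i ` z)) \<and>
            (\<forall>bs y dss ess xs h k.
               cokl_rep X empty_cat one_cat one_cat \<Psi> \<Phi> [] () bs y dss ess xs h k \<longrightarrow>
               \<theta> (cokl_comp_el X empty_cat one_cat one_cat \<Psi> \<Phi> [] () bs y dss ess xs h k) =
               power_coend_el X Y (i ` z) (length bs) (\<lambda>j\<in>{..<length bs}. i (xs ! j)) y)))))"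
proof (intro conjI allI impI, goal_cases)
  case (1 A B D \<Phi> \<Psi>)
  then show ?case by (intro cokl_comp_formula) auto
next
  case 2
  show ?case by (rule cat_iso_len)
next
  case (3 Y Z)
  then show ?case unfolding Let_def by (intro cokl_comp_subst) auto
next
  case 4
  show ?case by (rule cokl_id_one)
next
  case 5
  show ?case by (rule cat_iso_quest_empty)
next
  case (6 Y \<Phi>)
  then have Y: "is_functor (nats X) set_cat Y" and \<Phi>: "profunctor (quest X empty_cat) one_cat \<Phi>" by auto
  show ?case
    unfolding Let_def
  proof (intro conjI allI impI, goal_cases)
    case 1
    show ?case using cokl_comp_power_coend[OF \<Phi> inj_on_id2 Y] by simp
  next
    case (2 e i)
    then show ?case by (intro left_kan_power_coend[OF Y]) simp
  next
    case (3 e i)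
    then show ?case by (intro cokl_comp_power_coend[OF \<Phi> _ Y]) simp
  qed
qed

end
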